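(* Let $\mathfrak X$ be a Banach space, $p\in(0,\infty)$, let $V\in\mathscr A_r(\mathbb R^n;\mathscr L(\mathfrak X))$ with $r\in[p,\infty)$ have doubling dimension $\beta$, and let $s\in\mathbb R$. Suppose that $B$ is a $(D,E,F)$-almost diagonal operator satisfying $$D>J+\frac{\beta-n}r,\qquad E>\frac n2+s,\qquad F>J-\frac n2-s+\frac{\beta-n}r,$$ where $J:=n/\min\{1,p,q\}$ in the Triebel--Lizorkin case and $J:=n/\min\{1,p\}$ in the Besov case. (i) (Besov case) If $q\in(0,\infty]$, then $B$ is bounded on $\dot b^s_{p,q}(V)=\dot b^s_{p,q}(\rho^V_r)$. (ii) (Triebel--Lizorkin case) If $q\in(0,r+\varepsilon_V)$, where $\varepsilon_V$ is the optimal reverse H\"older lifting index of $V$, then $B$ is bounded on $\dot f^s_{p,q}(V)=\dot f^s_{p,q}(\rho^V_r)$.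
   Context: Weights. $f:\mathbb R^n\to\mathfrak X$ is strongly measurable if it is a pointwise limit of simple functions. $V:\mathbb R^n\to\mathscr L(\mathfrak X)$ is a weight if $V(\cdot)\mathfrak e$ and $V(\cdot)^{-1}\mathfrak e$ are strongly measurable for every $\mathfrak e\in\mathfrak X$ and $V(x)$ is invertible for a.e. $x$. It is a $p$-weight ($p\in(0,\infty]$) if moreover $\mathbf 1_QV(\cdot)\mathfrak e\in L^p(\mathbb R^n;\mathfrak X)$ for all cubes $Q$ and all $\mathfrak e$. $V^{-*}(x):=(V(x)^{-1})^*\in\mathscr L(\mathfrak X^* )$, to which the same notions apply with $\mathfrak X^*$ in place of $\mathfrak X$. $\rho^V_{p,Q}(\mathfrak e):=\big(\frac1{|Q|}\int_Q\|V(x)\mathfrak e\|^p\,dx\big)^{1/p}$, similarly $\rho^{V^{-*}}_{p,Q}(\mathfrak e^* )$; $\rho^*(\mathfrak e^* ):=\sup_{\mathfrak e\ne0}|\langle\mathfrak e^*,\mathfrak e\rangle|/\rho(\mathfrak e)$. $\mathscr A_p$ condition. For $p\in(0,\infty)$, $V\in\mathscr A_p(\mathbb R^n;\mathscr L(\mathfrak X))$ means that $V$ is a $p$-weight and there is a finite $C$ such that for all cubes $Q$: (i) if $p\in(1,\infty)$, $p'=p/(p-1)$: also $V^{-*}$ is a $p'$-weight and $\rho^{V^{-*}}_{p',Q}(\mathfrak e^* )\le C(\rho^V_{p,Q})^*(\mathfrak e^* )$ for all $\mathfrak e^*\in\mathfrak X^*$; (ii) if $p\in(0,1]$: $\operatorname{ess\,sup}_{y\in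 Q}\rho^V_{p,Q}(V(y)^{-1}\mathfrak e)\le C\|\mathfrak e\|$ for all $\mathfrak e\in\mathfrak X$. $V\in\mathscr A_r$ has doubling dimension $\beta\in[n,\infty)$ if there is $C$ with $\rho^V_{r,S}(\mathfrak e)\le C(\ell(S)/\ell(Q))^{(\beta-n)/r}\rho^V_{r,Q}(\mathfrak e)$ for all cubes $Q\subset S$ and all $\mathfrak e\in\mathfrak X$. The optimal reverse H\"older lifting index $\varepsilon_V$ of $V\in\mathscr A_r$ is the supremum of all $\varepsilon\in(0,\infty)$ for which there is $C<\infty$ with $\rho^V_{r+\varepsilon,Q}(\mathfrak e)\le C\rho^V_{r,Q}(\mathfrak e)$ for all cubes $Q$ and all $\mathfrak e\in\mathfrak X$ (always $\varepsilon_V>0$). Almost diagonal operators. $\mathscr D_j=\{2^{-j}([0,1)^n+k):k\in\mathbb Z^n\}$, $\mathscr D=\bigcup_j\mathscr D_j$; $\ell(Q)$ is the side length, $x_Q$ the lower-left vertex of $Q$. A scalar matrix $B=\{b_{QR}\}_{Q,R\in\mathscr D}$ is $(D,E,F)$-almost diagonal if there is $C<\infty$ with $$|b_{QR}|\le C\Big(1+\frac{\ell(R)}{\ell(Q)}\Big)^{-E}\Big(1+\frac{\ell(Q)}{\ell(R)}\Big)^{-F}\Big(1+\frac{|x_Q-x_R|}{\max\{\ell(Q),\ell(R)\}}\Big)^{-D}$$ for all $Q,R\in\mathscr D$. It acts on sequences $t=\{t_Q\}_{Q\in\mathscr D}$ in $\mathfrak X$ by $(Bt)_Q:=\sum_Rb_{QR}t_R$.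 Sequence spaces. For $t=\{t_Q\}_{Q\in\mathscr D}$ let $t_j:=\sum_{Q\in\mathscr D_j}t_Q|Q|^{-1/2}\mathbf 1_Q$. The space $\dot f^s_{p,q}(V)$ (resp. $\dot b^s_{p,q}(V)$) consists of $t$ with finite quasi-norm $\|(\sum_jg_j^q)^{1/q}\|_{L^p}$ (resp. $(\sum_j\|g_j\|_{L^p}^q)^{1/q}$), where $g_j:=2^{js}\|Vt_j\|_{\mathfrak X}$ (usual modification if $q=\infty$); $\dot f^s_{p,q}(\rho^V_r)$ and $\dot b^s_{p,q}(\rho^V_r)$ are defined in the same way with $g_j:=2^{js}\sum_{Q\in\mathscr D_j}\rho^V_{r,Q}(t_Q)|Q|^{-1/2}\mathbf 1_Q$. Equality of spaces is meant with equivalent quasi-norms. *)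

theory Defs
  imports "HOL-Analysis.Analysis" "HOL-Probability.Essential_Supremum"
begin

section \<open>Scalars and Banach spaces over them\<close>

text \<open>The scalar field is the real or the complex field. A normed space over it is a type of class
  \<^class>\<open>real_normed_vector\<close> together with a scalar multiplication by the field; for real scalars
  this is \<^term>\<open>scaleR\<close>.\<close>

class real_or_complex = real_normed_field +
  assumes real_or_complex:
    "(\<forall>z. \<exists>a. z = a *\<^sub>R 1) \<or> (\<exists>i. i * i = -1 \<and> (\<forall>z. \<exists>a b. z = a *\<^sub>R 1 + b *\<^sub>R i))"

instance real :: real_or_complex
  by standard simp

instance complex :: real_or_complex
proof
  have "z = Re z *\<^sub>R 1 + Im z *\<^sub>R \<i>" for z :: complex
    by (simp add: complex_eq_iff)
  then show "(\<forall>z::complex. \<exists>a. z = a *\<^sub>R 1) \<or>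
      (\<exists>i::complex. i * i = -1 \<and> (\<forall>z. \<exists>a b. z = a *\<^sub>R 1 + b *\<^sub>R i))"
    using i_squared by blast
qed

locale normed_space_over = vector_space smul
  for smul :: "'k::real_or_complex \<Rightarrow> 'a::real_normed_vector \<Rightarrow> 'a" +
  assumes scale_of_real: "smul (of_real a) x = a *\<^sub>R x"
    and norm_scale: "norm (smul c x) = norm c * norm x"

lemma normed_space_over_scaleR: "normed_space_over (scaleR :: real \<Rightarrow> 'a::real_normed_vector \<Rightarrow> 'a)"
  by unfold_locales (simp_all add: algebra_simps)

lemma normed_space_over_mult: "normed_space_over ((*) :: 'k::real_or_complex \<Rightarrow> 'k \<Rightarrow> 'k)"
  by unfold_locales (simp_all add: algebra_simps norm_mult scaleR_conv_of_real)


section \<open>Operators and duals\<close>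

text \<open>Weights take values in the operators on the space and also in those on its dual. The
  dual is a closed subspace \<open>E\<close> of the type of bounded real-linear maps into the scalars, so the
  notions are relative to a carrier \<open>E\<close>; it is \<^term>\<open>UNIV\<close> for the space itself. An operator on
  \<open>E\<close> is represented by a bounded real-linear map of the ambient type. For the two carriers used,
  each bounded operator on \<open>E\<close> has such an extension; only its values on \<open>E\<close> matter.\<close>

definition operators ::
  "('k \<Rightarrow> 'b \<Rightarrow> 'b) \<Rightarrow> 'b set \<Rightarrow> ('b::real_normed_vector \<Rightarrow>\<^sub>L 'b) set" where
  "operators smul E = {T. (\<forall>u\<in>E. blinfun_apply T u \<in> E) \<and>
     (\<forall>c. \<forall>u\<in>E. blinfun_apply T (smul c u) = smul c (blinfun_apply T u))}"

definition is_inverse_op ::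
  "('k \<Rightarrow> 'b \<Rightarrow> 'b) \<Rightarrow> 'b set \<Rightarrow> ('b::real_normed_vector \<Rightarrow>\<^sub>L 'b) \<Rightarrow> ('b \<Rightarrow>\<^sub>L 'b) \<Rightarrow> bool" where
  "is_inverse_op smul E T S \<longleftrightarrow> S \<in> operators smul E \<and>
     (\<forall>u\<in>E. blinfun_apply S (blinfun_apply T u) = u \<and> blinfun_apply T (blinfun_apply S u) = u)"

definition invertible_op ::
  "('k \<Rightarrow> 'b \<Rightarrow> 'b) \<Rightarrow> 'b set \<Rightarrow> ('b::real_normed_vector \<Rightarrow>\<^sub>L 'b) \<Rightarrow> bool" where
  "invertible_op smul E T \<longleftrightarrow> (\<exists>S. is_inverse_op smul E T S)"

text \<open>A weight is invertible only almost everywhere; the value 0 chosen on the exceptional null set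
  affects none of the notions below, since they are based on the (complete) Lebesgue measure.\<close>

definition inverse_op ::
  "('k \<Rightarrow> 'b \<Rightarrow> 'b) \<Rightarrow> 'b set \<Rightarrow> ('b::real_normed_vector \<Rightarrow>\<^sub>L 'b) \<Rightarrow> ('b \<Rightarrow>\<^sub>L 'b)" where
  "inverse_op smul E T = (if invertible_op smul E T then SOME S. is_inverse_op smul E T S else 0)"

definition dual_space ::
  "('k \<Rightarrow> 'a \<Rightarrow> 'a) \<Rightarrow> ('a::real_normed_vector \<Rightarrow>\<^sub>L 'k::real_or_complex) set" where
  "dual_space smul = {\<phi>. \<forall>c e. blinfun_apply \<phi> (smul c e) = c * blinfun_apply \<phi> e}"

definition dual_scale ::
  "'k \<Rightarrow> ('a::real_normed_vector \<Rightarrow>\<^sub>L 'k::real_or_complex) \<Rightarrow> ('a \<Rightarrow>\<^sub>L 'k)" where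
  "dual_scale c \<phi> = blinfun_mult_right c o\<^sub>L \<phi>"

definition adjoint_op ::
  "('a::real_normed_vector \<Rightarrow>\<^sub>L 'a) \<Rightarrow> (('a \<Rightarrow>\<^sub>L 'k::real_or_complex) \<Rightarrow>\<^sub>L ('a \<Rightarrow>\<^sub>L 'k))" where
  "adjoint_op T = Blinfun (\<lambda>\<phi>. \<phi> o\<^sub>L T)"

definition inverse_adjoint ::
  "('k::real_or_complex \<Rightarrow> 'a \<Rightarrow> 'a) \<Rightarrow> ('x \<Rightarrow> 'a::real_normed_vector \<Rightarrow>\<^sub>L 'a)
     \<Rightarrow> 'x \<Rightarrow> (('a \<Rightarrow>\<^sub>L 'k) \<Rightarrow>\<^sub>L ('a \<Rightarrow>\<^sub>L 'k))" where
  "inverse_adjoint smul V x = adjoint_op (inverse_op smul UNIV (V x))"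


section \<open>Powers, quasi-norms and cubes\<close>

text \<open>Used for exponents \<open>a > 0\<close> only.\<close>

definition epowr :: "ennreal \<Rightarrow> real \<Rightarrow> ennreal" where
  "epowr x a = (if x = \<infinity> then \<infinity> else ennreal (enn2real x powr a))"

definition Lp_qnorm :: "real \<Rightarrow> (real ^ 'n \<Rightarrow> ennreal) \<Rightarrow> ennreal" where
  "Lp_qnorm p g = epowr (\<integral>\<^sup>+x. epowr (g x) p \<partial>lebesgue) (1 / p)"

definition lq_qnorm :: "ennreal \<Rightarrow> (int \<Rightarrow> ennreal) \<Rightarrow> ennreal" where
  "lq_qnorm q a = (if q = \<infinity> then (SUP j. a j)
     else epowr (\<Sum>\<^sub>\<infinity>j. epowr (a j) (enn2real q)) (1 / enn2real q))"

text \<open>The cube with lower-left vertex \<open>a\<close> and side length \<open>l\<close>.\<close>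

definition cube :: "real ^ 'n \<Rightarrow> real \<Rightarrow> (real ^ 'n) set" where
  "cube a l = {x. \<forall>i. a $ i \<le> x $ i \<and> x $ i < a $ i + l}"


section \<open>Weights\<close>

definition strongly_measurable ::
  "'b set \<Rightarrow> (real ^ 'n \<Rightarrow> 'b::real_normed_vector) \<Rightarrow> bool" where
  "strongly_measurable E f \<longleftrightarrow>
     (\<exists>F :: nat \<Rightarrow> real ^ 'n \<Rightarrow> 'b. (\<forall>i. simple_function lebesgue (F i) \<and> range (F i) \<subseteq> E) \<and>
        (\<forall>x. (\<lambda>i. F i x) \<longlonglongrightarrow> f x))"

definition weight ::
  "('k \<Rightarrow> 'b \<Rightarrow> 'b) \<Rightarrow> 'b set \<Rightarrow> (real ^ 'n \<Rightarrow> 'b::real_normed_vector \<Rightarrow>\<^sub>L 'b) \<Rightarrow> bool" where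
  "weight smul E W \<longleftrightarrow>
     (\<forall>x. W x \<in> operators smul E) \<and>
     (\<forall>u\<in>E. strongly_measurable E (\<lambda>x. blinfun_apply (W x) u)) \<and>
     (\<forall>u\<in>E. strongly_measurable E (\<lambda>x. blinfun_apply (inverse_op smul E (W x)) u)) \<and>
     (AE x in lebesgue. invertible_op smul E (W x))"

definition p_weight ::
  "('k \<Rightarrow> 'b \<Rightarrow> 'b) \<Rightarrow> 'b set \<Rightarrow> real \<Rightarrow> (real ^ 'n \<Rightarrow> 'b::real_normed_vector \<Rightarrow>\<^sub>L 'b) \<Rightarrow> bool" where
  "p_weight smul E p W \<longleftrightarrow> weight smul E W \<and>
     (\<forall>a. \<forall>l>0. \<forall>u\<in>E.
        (\<integral>\<^sup>+x\<in>cube a l. ennreal (norm (blinfun_apply (W x) u) powr p) \<partial>lebesgue) < \<infinity>)"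

definition rho ::
  "(real ^ 'n \<Rightarrow> 'b::real_normed_vector \<Rightarrow>\<^sub>L 'b) \<Rightarrow> real \<Rightarrow> (real ^ 'n) set \<Rightarrow> 'b \<Rightarrow> ennreal" where
  "rho W p Q u = epowr
     ((\<integral>\<^sup>+x\<in>Q. ennreal (norm (blinfun_apply (W x) u) powr p) \<partial>lebesgue) / emeasure lebesgue Q)
     (1 / p)"

definition rho_star ::
  "('a::real_normed_vector \<Rightarrow> ennreal) \<Rightarrow> ('a \<Rightarrow>\<^sub>L 'k::real_or_complex) \<Rightarrow> ennreal" where
  "rho_star \<rho> \<phi> = (SUP e\<in>{e. e \<noteq> 0}. ennreal (norm (blinfun_apply \<phi> e)) / \<rho> e)"

definition Ap_weight ::
  "('k::real_or_complex \<Rightarrow> 'a \<Rightarrow> 'a) \<Rightarrow> real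
     \<Rightarrow> (real ^ 'n \<Rightarrow> 'a::real_normed_vector \<Rightarrow>\<^sub>L 'a) \<Rightarrow> bool" where
  "Ap_weight smul p V \<longleftrightarrow> 0 < p \<and> p_weight smul UNIV p V \<and>
     (if 1 < p then
        p_weight dual_scale (dual_space smul) (p / (p - 1)) (inverse_adjoint smul V) \<and>
        (\<exists>C::real. \<forall>a. \<forall>l>0. \<forall>\<phi>\<in>dual_space smul.
           rho (inverse_adjoint smul V) (p / (p - 1)) (cube a l) \<phi>
             \<le> ennreal C * rho_star (rho V p (cube a l)) \<phi>)
      else
        (\<exists>C::real. \<forall>a. \<forall>l>0. \<forall>e.
           esssup (restrict_space lebesgue (cube a l))
             (\<lambda>y. rho V p (cube a l) (blinfun_apply (inverse_op smul UNIV (V y)) e))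
             \<le> ennreal (C * norm e)))"

definition has_doubling_dimension ::
  "(real ^ 'n \<Rightarrow> 'a::real_normed_vector \<Rightarrow>\<^sub>L 'a) \<Rightarrow> real \<Rightarrow> real \<Rightarrow> bool" where
  "has_doubling_dimension V r \<beta> \<longleftrightarrow> real CARD('n) \<le> \<beta> \<and>
     (\<exists>C::real. \<forall>a b. \<forall>l>0. \<forall>m>0. cube a l \<subseteq> cube b m \<longrightarrow>
        (\<forall>e. rho V r (cube b m) e
           \<le> ennreal (C * (m / l) powr ((\<beta> - real CARD('n)) / r)) * rho V r (cube a l) e))"

definition reverse_Hoelder_index ::
  "(real ^ 'n \<Rightarrow> 'a::real_normed_vector \<Rightarrow>\<^sub>L 'a) \<Rightarrow> real \<Rightarrow> ennreal" where
  "reverse_Hoelder_index V r =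
     (SUP \<epsilon>\<in>{\<epsilon>. 0 < \<epsilon> \<and> (\<exists>C::real. \<forall>a. \<forall>l>0. \<forall>e.
        rho V (r + \<epsilon>) (cube a l) e \<le> ennreal C * rho V r (cube a l) e)}. ennreal \<epsilon>)"


section \<open>Dyadic cubes and almost diagonal operators\<close>

text \<open>The index \<open>(j, k)\<close> stands for the dyadic cube of side length \<open>2\<close> to the \<open>-j\<close> at position \<open>k\<close>;
  different indices give different cubes.\<close>

type_synonym 'n dyadic = "int \<times> (int ^ 'n)"

definition dlen :: "('n::finite) dyadic \<Rightarrow> real" where
  "dlen Q = 2 powi (- fst Q)"

definition dvertex :: "('n::finite) dyadic \<Rightarrow> real ^ 'n" where
  "dvertex Q = dlen Q *\<^sub>R (\<chi> i. real_of_int (snd Q $ i))"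

definition dcube :: "('n::finite) dyadic \<Rightarrow> (real ^ 'n) set" where
  "dcube Q = cube (dvertex Q) (dlen Q)"

definition dvol :: "('n::finite) dyadic \<Rightarrow> real" where
  "dvol Q = measure lebesgue (dcube Q)"

definition almost_diagonal ::
  "real \<Rightarrow> real \<Rightarrow> real \<Rightarrow> (('n::finite) dyadic \<Rightarrow> 'n dyadic \<Rightarrow> 'k::real_or_complex) \<Rightarrow> bool" where
  "almost_diagonal D E F b \<longleftrightarrow> (\<exists>C. \<forall>Q R.
     norm (b Q R) \<le> C * (1 + dlen R / dlen Q) powr (- E) * (1 + dlen Q / dlen R) powr (- F)
       * (1 + norm (dvertex Q - dvertex R) / max (dlen Q) (dlen R)) powr (- D))"

definition matrix_apply ::
  "('k \<Rightarrow> 'a \<Rightarrow> 'a) \<Rightarrow> (('n::finite) dyadic \<Rightarrow> 'n dyadic \<Rightarrow> 'k) \<Rightarrow> ('n dyadic \<Rightarrow> 'a::real_normed_vector)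
     \<Rightarrow> 'n dyadic \<Rightarrow> 'a" where
  "matrix_apply smul b t Q = (\<Sum>\<^sub>\<infinity>R. smul (b Q R) (t R))"


section \<open>Sequence spaces\<close>

definition level_fun :: "(('n::finite) dyadic \<Rightarrow> 'a::real_normed_vector) \<Rightarrow> int \<Rightarrow> real ^ 'n \<Rightarrow> 'a" where
  "level_fun t j x =
     (\<Sum>\<^sub>\<infinity>k. (dvol (j, k) powr (- 1/2) * indicator (dcube (j, k)) x) *\<^sub>R t (j, k))"

definition pointwise_part ::
  "(real ^ 'n \<Rightarrow> 'a::real_normed_vector \<Rightarrow>\<^sub>L 'a) \<Rightarrow> real \<Rightarrow> ('n dyadic \<Rightarrow> 'a)
     \<Rightarrow> int \<Rightarrow> real ^ 'n \<Rightarrow> ennreal" where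
  "pointwise_part V s t j x =
     ennreal (2 powr (real_of_int j * s) * norm (blinfun_apply (V x) (level_fun t j x)))"

definition averaged_part ::
  "(real ^ 'n \<Rightarrow> 'a::real_normed_vector \<Rightarrow>\<^sub>L 'a) \<Rightarrow> real \<Rightarrow> real \<Rightarrow> ('n dyadic \<Rightarrow> 'a)
     \<Rightarrow> int \<Rightarrow> real ^ 'n \<Rightarrow> ennreal" where
  "averaged_part V r s t j x = ennreal (2 powr (real_of_int j * s)) *
     (\<Sum>\<^sub>\<infinity>k. rho V r (dcube (j, k)) (t (j, k)) *
        ennreal (dvol (j, k) powr (- 1/2)) * indicator (dcube (j, k)) x)"

definition besov_qnorm :: "real \<Rightarrow> ennreal \<Rightarrow> (int \<Rightarrow> real ^ 'n \<Rightarrow> ennreal) \<Rightarrow> ennreal" where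
  "besov_qnorm p q g = lq_qnorm q (\<lambda>j. Lp_qnorm p (g j))"

definition triebel_qnorm :: "real \<Rightarrow> ennreal \<Rightarrow> (int \<Rightarrow> real ^ 'n \<Rightarrow> ennreal) \<Rightarrow> ennreal" where
  "triebel_qnorm p q g = Lp_qnorm p (\<lambda>x. lq_qnorm q (\<lambda>j. g j x))"

text \<open>The quasi-norms of the four spaces; they are infinite exactly off the space.\<close>

definition b_V ::
  "(real ^ 'n \<Rightarrow> 'a::real_normed_vector \<Rightarrow>\<^sub>L 'a) \<Rightarrow> real \<Rightarrow> real \<Rightarrow> ennreal \<Rightarrow> ('n dyadic \<Rightarrow> 'a) \<Rightarrow> ennreal" where
  "b_V V s p q t = besov_qnorm p q (pointwise_part V s t)"

definition b_rho ::
  "(real ^ 'n \<Rightarrow> 'a::real_normed_vector \<Rightarrow>\<^sub>L 'a) \<Rightarrow> real \<Rightarrow> real \<Rightarrow> real \<Rightarrow> ennreal \<Rightarrow> ('n dyadic \<Rightarrow> 'a) \<Rightarrow> ennreal" where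
  "b_rho V r s p q t = besov_qnorm p q (averaged_part V r s t)"

definition f_V ::
  "(real ^ 'n \<Rightarrow> 'a::real_normed_vector \<Rightarrow>\<^sub>L 'a) \<Rightarrow> real \<Rightarrow> real \<Rightarrow> ennreal \<Rightarrow> ('n dyadic \<Rightarrow> 'a) \<Rightarrow> ennreal" where
  "f_V V s p q t = triebel_qnorm p q (pointwise_part V s t)"

definition f_rho ::
  "(real ^ 'n \<Rightarrow> 'a::real_normed_vector \<Rightarrow>\<^sub>L 'a) \<Rightarrow> real \<Rightarrow> real \<Rightarrow> real \<Rightarrow> ennreal \<Rightarrow> ('n dyadic \<Rightarrow> 'a) \<Rightarrow> ennreal" where
  "f_rho V r s p q t = triebel_qnorm p q (averaged_part V r s t)"

definition qspace :: "('t \<Rightarrow> ennreal) \<Rightarrow> 't set" where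
  "qspace N = {t. N t < \<infinity>}"

definition same_qspace :: "('t \<Rightarrow> ennreal) \<Rightarrow> ('t \<Rightarrow> ennreal) \<Rightarrow> bool" where
  "same_qspace M N \<longleftrightarrow> qspace M = qspace N \<and>
     (\<exists>C::real. \<forall>t\<in>qspace M. M t \<le> ennreal C * N t \<and> N t \<le> ennreal C * M t)"

text \<open>Boundedness includes that the series defining the operator converge (unconditionally) on the
  space; the summability is explicit because \<^const>\<open>infsum\<close> is 0 for divergent series.\<close>

definition matrix_bounded_on ::
  "('k \<Rightarrow> 'a \<Rightarrow> 'a) \<Rightarrow> (('n::finite) dyadic \<Rightarrow> 'n dyadic \<Rightarrow> 'k)
     \<Rightarrow> (('n dyadic \<Rightarrow> 'a::real_normed_vector) \<Rightarrow> ennreal) \<Rightarrow> bool" where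
  "matrix_bounded_on smul b N \<longleftrightarrow> (\<exists>C::real. \<forall>t\<in>qspace N.
     (\<forall>Q. (\<lambda>R. smul (b Q R) (t R)) summable_on UNIV) \<and>
     N (matrix_apply smul b t) \<le> ennreal C * N t)"

end

theory Submission
  imports Defs
begin

text \<open>With \<open>A < min(1, p, q)\<close> close to the minimum, all norms become norms in \<open>L\<^sup>P(\<ell>\<^sup>Q)\<close>,
  \<open>P = p/A > 1\<close> and \<open>Q = q/A > 1\<close>, of \<open>A\<close>-th powers; in the Besov case this is applied with \<open>Q = P\<close> to
  each level separately. In such spaces dyadic averages over the cube
  of level \<open>c(i)\<close> around a point, or over a neighbour of it, are bounded uniformly in the levels: by the
  maximal function if \<open>Q \<le> P\<close>, and by duality otherwise.

  The \<open>A\<^sub>r\<close> condition enters through one fact: on a set \<open>E \<subseteq> Q\<close> of at least half the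
  measure, \<open>\<integral>\<^sub>E \<parallel>V e\<parallel>\<^sup>r\<close> controls \<open>\<integral>\<^sub>Q \<parallel>V e\<parallel>\<^sup>r\<close>, uniformly in \<open>e\<close>. Hence \<open>\<parallel>V e\<parallel> \<ge> c \<rho>\<^sub>Q(e)\<close> on
  half of \<open>Q\<close>, which bounds \<open>\<rho>\<^sub>Q(e)\<close> by averages of small powers of \<open>\<parallel>V e\<parallel>\<close>; and \<open>\<parallel>V e\<parallel>\<^sup>r\<close> satisfies a
  reverse Hoelder inequality on dyadic cubes.

  For the matrix, \<open>\<parallel>V(x) t\<^sub>R\<parallel>\<close> with \<open>x \<in> Q\<close> is compared not with \<open>\<rho>\<^sub>R(t\<^sub>R)\<close> directly but through a
  dyadic cube \<open>S \<ni> x\<close> whose size is that of the larger cube times the relative distance: doubling gives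
  \<open>\<rho>\<^sub>S(t\<^sub>R) \<le> C (\<ell>(S)/\<ell>(R))^((\<beta>-n)/r) \<rho>\<^sub>R(t\<^sub>R)\<close>, and, after testing against a dual function,
  the reverse Hoelder inequality on \<open>S\<close> leaves a scalar dyadic average. Summation over level differences and
  distances is a sum of geometric series, convergent by the conditions on \<open>D, E, F\<close>.\<close>

section \<open>Powers of extended nonnegative numbers\<close>

text \<open>The space may be infinite-dimensional, so all weighted estimates are made for |V e| with
  one vector e at a time, with constants uniform in e, and the seminorms \<rho> stand in for
  matrices. Since A < 1, A-th powers of sums are subadditive; since P, Q > 1, duality is available.
  Passing from R to a cube S that is l generations larger costs |S|/|R| = 2^(l n) by integration and
  2^(l A (\<beta>-n)/r) by doubling. Decay in the distance beats this if A D > n + A (\<beta>-n)/r,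
  that is D > n/A + (\<beta>-n)/r; letting A approach the minimum produces J. The condition on F
  arises in the same way when R is smaller than Q. If R is larger, the level difference adds no
  generations, and E > n/2 + s suffices. The bound on q comes from the dual side: with U' conjugate
  to U0/A, averages of h^U' are taken, and their boundedness is used for the exponents P'/U' and
  Q'/U', which exceed 1 when U0 > p and U0 > q. So the reverse Hoelder inequality has to reach an
  exponent above q; in the Besov case one above p \<le> r is enough.\<close>

lemma epowr_ennreal: "0 \<le> x \<Longrightarrow> epowr (ennreal x) a = ennreal (x powr a)"
  by (simp add: epowr_def)

lemma epowr_top [simp]: "epowr top a = top"
  by (simp add: epowr_def)

lemma epowr_0 [simp]: "epowr 0 a = 0"
  by (simp add: epowr_def)

lemma epowr_1 [simp]: "epowr 1 a = 1"
  by (simp add: epowr_def)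

lemma epowr_eq_0_iff [simp]: "epowr x a = 0 \<longleftrightarrow> x = 0"
  by (cases x rule: ennreal_cases) (auto simp: epowr_def ennreal_eq_0_iff)

lemma epowr_eq_top_iff [simp]: "epowr x a = top \<longleftrightarrow> x = top"
  by (auto simp: epowr_def)

lemma epowr_one_right [simp]: "epowr x 1 = x"
  by (cases x rule: ennreal_cases) (auto simp: epowr_def)

lemma epowr_mono: "0 \<le> a \<Longrightarrow> x \<le> y \<Longrightarrow> epowr x a \<le> epowr y a"
  by (cases x rule: ennreal_cases; cases y rule: ennreal_cases)
    (auto simp: epowr_def powr_mono2 ennreal_leI top_unique)

lemma epowr_mult: "epowr (x * y) a = epowr x a * epowr y a"
proof (cases x rule: ennreal_cases)
  case x: (real x)
  show ?thesis
  proof (cases y rule: ennreal_cases)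
    case (real y)
    with x show ?thesis
      by (simp add: epowr_ennreal powr_mult flip: ennreal_mult)
  next
    case top
    with x show ?thesis by (cases "x = 0") (auto simp: ennreal_mult_top epowr_ennreal)
  qed
next
  case top
  show ?thesis
  proof (cases "y = 0")
    case False
    then have "epowr y a \<noteq> 0" by simp
    with False top show ?thesis by (simp add: ennreal_top_mult)
  qed simp
qed

lemma epowr_epowr: "epowr (epowr x a) b = epowr x (a * b)"
  by (cases x rule: ennreal_cases) (auto simp: epowr_ennreal powr_powr)

lemma epowr_add: "epowr x a * epowr x b = epowr x (a + b)"
  by (cases x rule: ennreal_cases) (auto simp: epowr_ennreal powr_add ennreal_mult)

lemma epowr_inverse_cancel: "a \<noteq> 0 \<Longrightarrow> epowr (epowr x a) (1 / a) = x"
  "a \<noteq> 0 \<Longrightarrow> epowr (epowr x (1 / a)) a = x"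
  by (simp_all add: epowr_epowr)

lemma epowr_le_iff: "0 < a \<Longrightarrow> epowr x a \<le> epowr y a \<longleftrightarrow> x \<le> y"
  by (metis epowr_inverse_cancel(1) epowr_mono less_le zero_le_divide_1_iff)

lemma epowr_less_top [simp]: "epowr x a < top \<longleftrightarrow> x < top"
  by (simp add: less_top[symmetric])

lemma epowr_le_swap: "0 < a \<Longrightarrow> epowr x a \<le> y \<longleftrightarrow> x \<le> epowr y (1 / a)"
  by (metis epowr_inverse_cancel(2) epowr_le_iff less_irrefl)

lemma epowr_SUP: "0 < a \<Longrightarrow> epowr (SUP i\<in>I. f i) a = (SUP i\<in>I. epowr (f i) a)"
proof (rule antisym)
  assume a: "0 < a"
  show "epowr (SUP i\<in>I. f i) a \<le> (SUP i\<in>I. epowr (f i) a)"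
    unfolding epowr_le_swap[OF a]
    by (rule SUP_least, subst epowr_le_swap[OF a, symmetric], rule SUP_upper)
  show "(SUP i\<in>I. epowr (f i) a) \<le> epowr (SUP i\<in>I. f i) a"
    using a by (intro SUP_least epowr_mono SUP_upper) auto
qed

lemma borel_measurable_epowr [measurable]:
  assumes [measurable]: "f \<in> borel_measurable M"
  shows "(\<lambda>x. epowr (f x) a) \<in> borel_measurable M"
  unfolding epowr_def by measurable

text \<open>Each of the two summands t satisfies t^a = t t^(a-1) \<le> t (u+v)^(a-1); adding the two
  gives the claim.\<close>

lemma epowr_superadd:
  assumes "1 \<le> a"
  shows "epowr x a + epowr y a \<le> epowr (x + y) a"
proof (cases x rule: ennreal_cases)
  case x: (real u)
  show ?thesis
  proof (cases y rule: ennreal_cases)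
    case (real v)
    have "u powr a + v powr a \<le> (u + v) powr a"
    proof (cases "u + v = 0")
      case False
      have *: "t powr a \<le> t * (u + v) powr (a - 1)" if "0 \<le> t" "t \<le> u + v" for t
      proof (cases "t = 0")
        case False
        then have "t powr a = t * t powr (a - 1)" using that by (simp add: powr_diff)
        also have "\<dots> \<le> t * (u + v) powr (a - 1)"
          using that assms by (intro mult_left_mono powr_mono2) auto
        finally show ?thesis .
      qed simp
      have "u powr a + v powr a \<le> (u + v) * (u + v) powr (a - 1)"
        using *[of u] *[of v] x real by (auto simp: distrib_right)
      also have "\<dots> = (u + v) powr a" using False x real by (simp add: powr_diff)
      finally show ?thesis .
    qed (use x real in \<open>auto simp: add_nonneg_eq_0_iff\<close>)
    with x real show ?thesis by (simp add: epowr_ennreal flip: ennreal_plus)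
  qed simp
qed simp

lemma epowr_subadd:
  assumes "0 < a" "a \<le> 1"
  shows "epowr (x + y) a \<le> epowr x a + epowr y a"
proof -
  have "epowr (epowr x a) (1/a) + epowr (epowr y a) (1/a) \<le> epowr (epowr x a + epowr y a) (1/a)"
    using assms by (intro epowr_superadd) auto
  then show ?thesis using assms by (simp add: epowr_epowr epowr_le_swap)
qed

lemma Young_ennreal:
  assumes pq: "1 < p" "1 < q" "1 / p + 1 / q = (1::real)"
  shows "x * y \<le> ennreal (1 / p) * epowr x p + ennreal (1 / q) * epowr y q"
proof (cases x rule: ennreal_cases)
  case x: (real u)
  show ?thesis
  proof (cases y rule: ennreal_cases)
    case (real v)
    then show ?thesis using x pq Youngs_inequality[of p q u v]
      by (simp add: epowr_ennreal flip: ennreal_plus ennreal_mult)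
  qed (use pq in \<open>simp add: ennreal_mult_top\<close>)
qed (use pq in \<open>simp add: ennreal_mult_top\<close>)

section \<open>Countable sums in the extended nonnegative numbers\<close>

text \<open>As integrals against the counting measure, sums fall under Tonelli, monotone convergence
  and Hoelder's inequality for integrals.\<close>

abbreviation csum :: "('i \<Rightarrow> ennreal) \<Rightarrow> ennreal" where
  "csum f \<equiv> integral\<^sup>N (count_space UNIV) f"

lemma csum_eq_suminf:
  assumes "infinite (UNIV :: 'i::countable set)"
  shows "csum (f :: 'i \<Rightarrow> ennreal) = (\<Sum>n. f (from_nat_into UNIV n))"
  using nn_integral_bij_count_space[OF bij_betw_from_nat_into[of "UNIV::'i set"], of f] assms
  by (simp add: nn_integral_count_space_nat)

lemma borel_measurable_csum [measurable]:
  fixes f :: "'i::countable \<Rightarrow> 'x \<Rightarrow> ennreal"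
  assumes [measurable]: "\<And>i. f i \<in> borel_measurable M"
  shows "(\<lambda>x. csum (\<lambda>i. f i x)) \<in> borel_measurable M"
proof (cases "finite (UNIV :: 'i set)")
  case True
  then show ?thesis by (simp add: nn_integral_count_space_finite)
next
  case False
  then show ?thesis by (simp add: csum_eq_suminf)
qed

lemma nn_integral_csum:
  fixes f :: "'i::countable \<Rightarrow> 'x \<Rightarrow> ennreal"
  assumes "\<And>i. f i \<in> borel_measurable M"
  shows "(\<integral>\<^sup>+x. csum (\<lambda>i. f i x) \<partial>M) = csum (\<lambda>i. \<integral>\<^sup>+x. f i x \<partial>M)"
  by (rule nn_integral_count_space_nn_integral) (use assms in auto)

lemma csum_swap:
  fixes f :: "'i::countable \<Rightarrow> 'l \<Rightarrow> ennreal"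
  shows "csum (\<lambda>l. csum (\<lambda>i. f i l)) = csum (\<lambda>i. csum (\<lambda>l. f i l))"
  by (rule nn_integral_count_space_nn_integral) auto

lemma csum_mono: "(\<And>i. f i \<le> g i) \<Longrightarrow> csum f \<le> csum g"
  by (rule nn_integral_mono) auto

lemma csum_cmult: "csum (\<lambda>i. c * f i) = c * csum f"
  by (rule nn_integral_cmult) auto

lemma csum_multc: "csum (\<lambda>i. f i * c) = csum f * c"
  by (rule nn_integral_multc) auto

lemma csum_add: "csum (\<lambda>i. f i + g i) = csum f + csum g"
  by (rule nn_integral_add) auto

lemma sum_le_csum: "finite F \<Longrightarrow> sum f F \<le> csum f"
proof -
  assume F: "finite F"
  have "sum f F = (\<integral>\<^sup>+i. f i * indicator F i \<partial>count_space UNIV)"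
    using F by (subst nn_integral_indicator_finite) auto
  also have "\<dots> \<le> csum f" by (intro csum_mono) (simp add: indicator_def)
  finally show ?thesis .
qed

lemma le_csum: "f i \<le> csum f"
  using sum_le_csum[of "{i}" f] by simp

lemma csum_single:
  assumes "\<And>j. j \<noteq> i \<Longrightarrow> f j = 0"
  shows "csum f = f i"
  by (subst nn_integral_count_space'[of "{i}"]) (use assms in auto)

lemma csum_reindex: "bij g \<Longrightarrow> csum (\<lambda>i. f (g i)) = csum f"
  by (rule nn_integral_bij_count_space)

lemma csum_le_finite_sums:
  fixes f :: "'i::countable \<Rightarrow> ennreal"
  assumes "\<And>F. finite F \<Longrightarrow> sum f F \<le> C"
  shows "csum f \<le> C"
proof (cases "finite (UNIV :: 'i set)")
  case True
  then show ?thesis using assms by (simp add: nn_integral_count_space_finite)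
next
  case False
  have "(\<Sum>n. f (from_nat_into UNIV n)) \<le> C"
  proof (rule suminf_le_const)
    fix n
    have "inj_on (from_nat_into (UNIV::'i set)) {..<n}"
      using bij_betw_from_nat_into[of "UNIV :: 'i set"] False
      by (auto simp: bij_betw_def intro: inj_on_subset)
    then have "(\<Sum>i<n. f (from_nat_into UNIV i)) = sum f (from_nat_into UNIV ` {..<n})"
      by (simp add: sum.reindex)
    then show "(\<Sum>i<n. f (from_nat_into UNIV i)) \<le> C"
      using assms by simp
  qed simp
  then show ?thesis by (simp add: csum_eq_suminf[OF False])
qed

text \<open>The quasi-norms are defined with \<open>infsum\<close>. For nonnegative terms both
  notions are the supremum of the finite partial sums.\<close>

lemma infsum_eq_csum:
  fixes f :: "'i::countable \<Rightarrow> ennreal"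
  shows "infsum f UNIV = csum f"
proof -
  have "infsum f UNIV = (SUP F\<in>{F. finite F \<and> F \<subseteq> UNIV}. sum f F)"
    by (rule nonneg_infsum_complete) auto
  also have "\<dots> = csum f"
    by (intro antisym SUP_least csum_le_finite_sums)
      (auto intro!: sum_le_csum SUP_upper)
  finally show ?thesis .
qed

lemma csum_iterated:
  fixes f :: "'i::countable \<times> 'l::countable \<Rightarrow> ennreal"
  shows "csum f = csum (\<lambda>i. csum (\<lambda>l. f (i, l)))"
  by (rule nn_integral_fst_count_space[symmetric])

lemma epowr_csum_le:
  fixes f :: "'i::countable \<Rightarrow> ennreal"
  assumes "0 < a" "a \<le> 1"
  shows "epowr (csum f) a \<le> csum (\<lambda>i. epowr (f i) a)"
proof -
  have fin: "epowr (sum f F) a \<le> (\<Sum>i\<in>F. epowr (f i) a)" if "finite F" for F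
    using that
  proof induction
    case (insert i F)
    then have "epowr (sum f (insert i F)) a \<le> epowr (f i) a + epowr (sum f F) a"
      using assms by (simp add: epowr_subadd)
    with insert show ?case by (auto intro: order_trans add_left_mono)
  qed simp
  show ?thesis
    unfolding epowr_le_swap[OF assms(1)]
  proof (rule csum_le_finite_sums)
    fix F :: "'i set" assume "finite F"
    then have "epowr (sum f F) a \<le> csum (\<lambda>i. epowr (f i) a)"
      using fin sum_le_csum order_trans by fast
    then show "sum f F \<le> epowr (csum (\<lambda>i. epowr (f i) a)) (1 / a)"
      by (simp add: epowr_le_swap[OF assms(1)])
  qed
qed

section \<open>Hoelder's inequality\<close>

text \<open>Young's inequality is integrated after dividing by the norms. This requires norms in (0,
  top): if one of them is 0, the left side vanishes, and if one is infinite and the other nonzero,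
  the right side is \<open>top\<close>.\<close>

lemma Hoelder_nn_integral:
  assumes pq: "1 < p" "1 < q" "1 / p + 1 / q = (1::real)"
    and [measurable]: "f \<in> borel_measurable M" "g \<in> borel_measurable M"
  shows "(\<integral>\<^sup>+x. f x * g x \<partial>M) \<le>
    epowr (\<integral>\<^sup>+x. epowr (f x) p \<partial>M) (1 / p) * epowr (\<integral>\<^sup>+x. epowr (g x) q \<partial>M) (1 / q)"
    (is "?L \<le> epowr ?A (1/p) * epowr ?B (1/q)")
proof -
  have zero: "?L = 0" if "?A = 0 \<or> ?B = 0"
  proof -
    have "AE x in M. f x * g x = 0"
      using that by (auto simp: nn_integral_0_iff_AE elim: eventually_mono)
    then show ?thesis by (simp add: nn_integral_0_iff_AE)
  qed
  show ?thesis
  proof (cases "?A = 0 \<or> ?B = 0 \<or> ?A = top \<or> ?B = top")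
    case True
    consider "?A = 0 \<or> ?B = 0" | "?A \<noteq> 0" "?B \<noteq> 0" "?A = top \<or> ?B = top" using True by blast
    then show ?thesis
    proof cases
      case 1
      then show ?thesis using zero by simp
    next
      case 2
      then have "epowr ?A (1/p) * epowr ?B (1/q) = top"
        by (auto simp: ennreal_mult_eq_top_iff)
      then show ?thesis by simp
    qed
  next
    case False
    define a where "a = epowr ?A (1/p)"
    define b where "b = epowr ?B (1/q)"
    have ab: "a \<noteq> 0" "a \<noteq> top" "b \<noteq> 0" "b \<noteq> top" using False unfolding a_def b_def by simp_all
    have cancel: "c * inverse c = 1" if "c \<noteq> 0" "c \<noteq> top" for c :: ennreal
      by (metis that divide_ennreal_def ennreal_divide_self less_top)
    have inv: "epowr (inverse c) p * epowr c p = 1" if "c \<noteq> 0" "c \<noteq> top" for c p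
      using cancel[OF that] by (simp add: epowr_mult[symmetric] mult.commute[of "inverse c"])
    have "epowr a p = ?A" "epowr b q = ?B" using pq by (simp_all add: a_def b_def epowr_epowr)
    then have iA: "epowr (inverse a) p * ?A = 1" "epowr (inverse b) q * ?B = 1"
      using inv[of a p] inv[of b q] ab by simp_all
    have "inverse a * inverse b * ?L = (\<integral>\<^sup>+x. (inverse a * f x) * (inverse b * g x) \<partial>M)"
      by (subst nn_integral_cmult[symmetric]) (auto simp: ac_simps)
    also have "\<dots> \<le> (\<integral>\<^sup>+x. ennreal (1/p) * epowr (inverse a * f x) p
        + ennreal (1/q) * epowr (inverse b * g x) q \<partial>M)"
      by (intro nn_integral_mono Young_ennreal pq)
    also have "\<dots> = (\<integral>\<^sup>+x. ennreal (1/p) * (epowr (inverse a) p * epowr (f x) p) \<partial>M)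
        + (\<integral>\<^sup>+x. ennreal (1/q) * (epowr (inverse b) q * epowr (g x) q) \<partial>M)"
      by (subst nn_integral_add) (auto simp: epowr_mult)
    also have "\<dots> = ennreal (1/p) * (epowr (inverse a) p * ?A) + ennreal (1/q) * (epowr (inverse b) q * ?B)"
      by (simp add: nn_integral_cmult)
    also have "\<dots> = 1" using pq iA by (simp flip: ennreal_plus)
    finally have "a * b * (inverse a * inverse b * ?L) \<le> a * b * 1"
      by (rule mult_left_mono) simp
    also have "a * b * (inverse a * inverse b * ?L) = (a * inverse a) * (b * inverse b) * ?L"
      by (simp add: ac_simps)
    also have "\<dots> = ?L" using ab by (simp add: cancel)
    finally show ?thesis by (simp add: a_def b_def)
  qed
qed

lemma conjugate_exponent: "1 < p \<Longrightarrow> 1 < p / (p - 1) \<and> 1 / p + 1 / (p / (p - 1)) = (1::real)"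
  by (simp add: field_simps)

section \<open>Mixed norms\<close>

text \<open>The norm of a family in L^P(l^Q), for arbitrary functions with values in [0, top];
  infinite values replace membership conditions.\<close>

definition mix :: "'x measure \<Rightarrow> real \<Rightarrow> real \<Rightarrow> ('i \<Rightarrow> 'x \<Rightarrow> ennreal) \<Rightarrow> ennreal" where
  "mix M P Q g = epowr (\<integral>\<^sup>+x. epowr (csum (\<lambda>i. epowr (g i x) Q)) (P / Q) \<partial>M) (1 / P)"

lemma mix_mono:
  assumes "0 < P" "0 < Q" "\<And>i x. g i x \<le> h i x"
  shows "mix M P Q g \<le> mix M P Q h"
  unfolding mix_def using assms
  by (intro epowr_mono nn_integral_mono csum_mono) auto

lemma mix_mono_AE:
  fixes g :: "'i::countable \<Rightarrow> 'x \<Rightarrow> ennreal"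
  assumes "0 < P" "0 < Q" "\<And>i. AE x in M. g i x \<le> h i x"
  shows "mix M P Q g \<le> mix M P Q h"
proof -
  have "AE x in M. \<forall>i. g i x \<le> h i x" using assms(3) by (simp add: AE_all_countable)
  then show ?thesis
    unfolding mix_def using assms(1,2)
    by (intro epowr_mono nn_integral_mono_AE) (auto intro!: epowr_mono csum_mono elim!: eventually_mono)
qed

lemma mix_cmult:
  fixes g :: "'i::countable \<Rightarrow> 'x \<Rightarrow> ennreal"
  assumes "0 < P" "0 < Q" and [measurable]: "\<And>i. g i \<in> borel_measurable M"
  shows "mix M P Q (\<lambda>i x. c * g i x) = c * mix M P Q g"
proof -
  have "epowr (csum (\<lambda>i. epowr (c * g i x) Q)) (P / Q) =
      epowr c P * epowr (csum (\<lambda>i. epowr (g i x) Q)) (P / Q)" for x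
    using assms by (simp add: epowr_mult csum_cmult epowr_epowr)
  then show ?thesis
    unfolding mix_def using assms by (simp add: nn_integral_cmult epowr_mult epowr_epowr)
qed

lemma mix_reindex: "bij \<sigma> \<Longrightarrow> mix M P Q (\<lambda>i. g (\<sigma> i)) = mix M P Q g"
  unfolding mix_def by (simp add: csum_reindex[of \<sigma> "\<lambda>i. epowr (g i x) Q" for x])

lemma mix_single:
  assumes "0 < P" "0 < Q" "\<And>i x. i \<noteq> i0 \<Longrightarrow> g i x = 0"
  shows "mix M P Q g = epowr (\<integral>\<^sup>+x. epowr (g i0 x) P \<partial>M) (1 / P)"
proof -
  have "csum (\<lambda>i. epowr (g i x) Q) = epowr (g i0 x) Q" for x
    by (rule csum_single) (simp add: assms)
  then show ?thesis unfolding mix_def using assms by (simp add: epowr_epowr)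
qed

text \<open>Passing to a-th powers divides both exponents by a. This is how p and q, which may lie
  below 1, are exchanged for exponents above 1.\<close>

lemma mix_epowr:
  assumes "0 < a" "0 < P" "0 < Q"
  shows "mix M P Q (\<lambda>i x. epowr (g i x) a) = epowr (mix M (P * a) (Q * a) g) a"
  unfolding mix_def using assms by (simp add: epowr_epowr mult.commute)

text \<open>Hoelder's inequality in the index for fixed x, followed by Hoelder's inequality in
  x.\<close>

lemma mix_Hoelder:
  fixes g h :: "'i::countable \<Rightarrow> 'x \<Rightarrow> ennreal"
  assumes P: "1 < P" "1 < P'" "1 / P + 1 / P' = 1" and Q: "1 < Q" "1 < Q'" "1 / Q + 1 / Q' = 1"
    and [measurable]: "\<And>i. g i \<in> borel_measurable M" "\<And>i. h i \<in> borel_measurable M"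
  shows "csum (\<lambda>i. \<integral>\<^sup>+x. g i x * h i x \<partial>M) \<le> mix M P Q g * mix M P' Q' h"
proof -
  have "csum (\<lambda>i. \<integral>\<^sup>+x. g i x * h i x \<partial>M) = (\<integral>\<^sup>+x. csum (\<lambda>i. g i x * h i x) \<partial>M)"
    by (rule nn_integral_csum[symmetric]) simp
  also have "\<dots> \<le> (\<integral>\<^sup>+x. epowr (csum (\<lambda>i. epowr (g i x) Q)) (1 / Q)
      * epowr (csum (\<lambda>i. epowr (h i x) Q')) (1 / Q') \<partial>M)"
    using Q by (intro nn_integral_mono Hoelder_nn_integral) auto
  also have "\<dots> \<le> mix M P Q g * mix M P' Q' h"
    using Hoelder_nn_integral[OF P, of "\<lambda>x. epowr (csum (\<lambda>i. epowr (g i x) Q)) (1 / Q)" M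
        "\<lambda>x. epowr (csum (\<lambda>i. epowr (h i x) Q')) (1 / Q')"]
    by (simp add: mix_def epowr_epowr)
  finally show ?thesis .
qed

text \<open>The extremal function of the duality is \<open>h\<^sub>i = g\<^sub>i^(Q-1) (\<Sum> g\<^sub>i^Q)^(P/Q-1)\<close>; the truncation makes
  the norm of \<open>g\<close> finite, so that it can be cancelled.\<close>

lemma mix_le_of_dual:
  fixes g :: "'i::countable \<Rightarrow> 'x \<Rightarrow> ennreal"
  assumes sf: "sigma_finite_measure M"
    and P: "1 < P" "1 < P'" "1 / P + 1 / P' = 1" and Q: "1 < Q" "1 < Q'" "1 / Q + 1 / Q' = 1"
    and [measurable]: "\<And>i. g i \<in> borel_measurable M"
    and dual: "\<And>h. (\<And>i. h i \<in> borel_measurable M) \<Longrightarrow>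
      csum (\<lambda>i. \<integral>\<^sup>+x. g i x * h i x \<partial>M) \<le> C * mix M P' Q' h"
  shows "mix M P Q g \<le> C"
proof -
  obtain A :: "nat \<Rightarrow> 'x set" where A: "range A \<subseteq> sets M" "(\<Union>i. A i) = space M"
    "\<And>i. emeasure M (A i) \<noteq> \<infinity>" "incseq A"
    using sigma_finite_measure.sigma_finite_incseq[OF sf] by metis
  have [measurable]: "A i \<in> sets M" for i using A(1) by auto
  \<comment> \<open>Three truncations at once: finitely many components, a set of finite measure,
    bounded values. Together they bound \<open>G m\<close> by a constant on
    \<open>A m\<close>.\<close>
  define gt where "gt m i x = (if to_nat i \<le> m \<and> x \<in> A m then min (g i x) (of_nat m) else 0)" for m i x
  have [measurable]: "gt m i \<in> borel_measurable M" for m i unfolding gt_def by measurable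
  define G where "G m x = csum (\<lambda>i. epowr (gt m i x) Q)" for m x
  have [measurable]: "G m \<in> borel_measurable M" for m unfolding G_def by measurable
  have bound: "epowr (\<integral>\<^sup>+x. epowr (G m x) (P / Q) \<partial>M) (1 / P) \<le> C" (is "epowr ?I _ \<le> _") for m
  proof -
    define K where "K = csum (\<lambda>i::'i. epowr (of_nat m) Q * indicator {i. to_nat i \<le> m} i)"
    have "finite {i::'i. to_nat i \<le> m}"
      by (rule finite_imageD[of to_nat]) (auto intro: finite_subset[of _ "{..m}"] inj_on_subset[OF inj_to_nat])
    then have K: "K < top"
      unfolding K_def
      by (subst nn_integral_indicator_finite) (auto simp: ennreal_mult_less_top of_nat_less_top)
    have "G m x \<le> K * indicator (A m) x" for x
    proof (cases "x \<in> A m")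
      case True
      then show ?thesis unfolding G_def K_def using Q
        by (auto simp: gt_def intro!: csum_mono epowr_mono)
    next
      case False
      then have "gt m i x = 0" for i by (simp add: gt_def)
      then show ?thesis by (simp add: G_def)
    qed
    then have "?I \<le> (\<integral>\<^sup>+x. epowr (K * indicator (A m) x) (P / Q) \<partial>M)"
      using P Q by (intro nn_integral_mono epowr_mono) auto
    also have "\<dots> = (\<integral>\<^sup>+x. epowr K (P / Q) * indicator (A m) x \<partial>M)"
      by (intro nn_integral_cong) (auto simp: indicator_def)
    also have "\<dots> = epowr K (P / Q) * emeasure M (A m)" by (simp add: nn_integral_cmult_indicator)
    also have "\<dots> < top"
    proof (rule ennreal_mult_less_top[THEN iffD2], intro disjI2 conjI)
      show "epowr K (P / Q) < top" using K by simp
      show "emeasure M (A m) < top" using A(3)[of m] by (simp add: top.not_eq_extremum)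
    qed
    finally have Ifin: "?I < top" .
    define h where "h i x = epowr (gt m i x) (Q - 1) * epowr (G m x) (P / Q - 1)" for i x
    have [measurable]: "h i \<in> borel_measurable M" for i unfolding h_def by measurable
    have 1: "csum (\<lambda>i. gt m i x * h i x) = epowr (G m x) (P / Q)" for x
    proof -
      have "gt m i x * h i x = epowr (gt m i x) Q * epowr (G m x) (P / Q - 1)" for i
        using epowr_add[of "gt m i x" 1 "Q - 1"] by (simp add: h_def mult.assoc[symmetric])
      then have "csum (\<lambda>i. gt m i x * h i x) = G m x * epowr (G m x) (P / Q - 1)"
        by (simp add: csum_multc G_def)
      also have "\<dots> = epowr (G m x) (P / Q)"
        using epowr_add[of "G m x" 1 "P / Q - 1"] by simp
      finally show ?thesis .
    qed
    \<comment> \<open>Conjugacy in this form turns the Q'-th powers of h into Q-th powers of g, and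
      the remaining exponent of G collapses to P / Q.\<close>
    have QQ: "(Q - 1) * Q' = Q" "(P - 1) * P' = P" using P Q by (auto simp: field_simps)
    have 2: "epowr (csum (\<lambda>i. epowr (h i x) Q')) (P' / Q') = epowr (G m x) (P / Q)" for x
    proof -
      have "epowr (h i x) Q' = epowr (gt m i x) Q * epowr (G m x) ((P / Q - 1) * Q')" for i
        by (simp add: h_def epowr_mult epowr_epowr QQ)
      then have "csum (\<lambda>i. epowr (h i x) Q') = G m x * epowr (G m x) ((P / Q - 1) * Q')"
        by (simp add: csum_multc G_def)
      also have "\<dots> = epowr (G m x) (1 + (P / Q - 1) * Q')"
        using epowr_add[of "G m x" 1] by simp
      finally have "epowr (csum (\<lambda>i. epowr (h i x) Q')) (P' / Q')
          = epowr (G m x) ((1 + (P / Q - 1) * Q') * (P' / Q'))" by (simp add: epowr_epowr)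
      also have "(1 + (P / Q - 1) * Q') * (P' / Q') = P / Q"
      proof -
        have "1 + (P / Q - 1) * Q' = (P - 1) * Q' / Q" using QQ Q by (simp add: field_simps)
        then have "(1 + (P / Q - 1) * Q') * (P' / Q') = ((P - 1) * P') / Q" using Q by simp
        then show ?thesis using QQ by simp
      qed
      finally show ?thesis .
    qed
    have "?I = csum (\<lambda>i. \<integral>\<^sup>+x. gt m i x * h i x \<partial>M)"
      by (simp add: nn_integral_csum[symmetric] 1)
    also have "\<dots> \<le> csum (\<lambda>i. \<integral>\<^sup>+x. g i x * h i x \<partial>M)"
      by (intro csum_mono nn_integral_mono mult_right_mono) (auto simp: gt_def)
    also have "\<dots> \<le> C * mix M P' Q' h" by (rule dual) simp
    also have "mix M P' Q' h = epowr ?I (1 / P')" by (simp add: mix_def 2)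
    finally have le: "?I \<le> C * epowr ?I (1 / P')" .
    show ?thesis
    proof (cases "?I = 0")
      case False
      have "epowr ?I (1 / P') * epowr ?I (1 / P) \<le> epowr ?I (1 / P') * C"
        using le P by (simp add: epowr_add add.commute mult.commute)
      then show ?thesis
        using False Ifin by (simp add: ennreal_mult_le_mult_iff)
    qed simp
  qed
  have inc: "gt m i x \<le> gt m' i x" if "m \<le> m'" for m m' i x
  proof (cases "to_nat i \<le> m \<and> x \<in> A m")
    case True
    then have "to_nat i \<le> m' \<and> x \<in> A m'" using that incseqD[OF A(4) that] by auto
    moreover have "min (g i x) (of_nat m) \<le> min (g i x) (of_nat m')"
      by (rule min.mono) (use that in auto)
    ultimately show ?thesis using True by (simp add: gt_def)
  next
    case False
    then have "gt m i x = 0" by (auto simp: gt_def)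
    then show ?thesis by simp
  qed
  have gt_SUP: "(SUP m. gt m i x) = g i x" if xM: "x \<in> space M" for i x
  proof (rule antisym)
    show "(SUP m. gt m i x) \<le> g i x"
      by (rule SUP_least) (simp only: gt_def split: if_split, simp)
    obtain m0 where m0: "x \<in> A m0" using A(2) xM by blast
    show "g i x \<le> (SUP m. gt m i x)"
      unfolding le_SUP_iff
    proof (intro allI impI)
      fix y assume y: "y < g i x"
      have "y < top" by (rule less_le_trans[OF y top_greatest])
      then obtain k where k: "y < of_nat k" using ennreal_Ex_less_of_nat[of y] by auto
      define m where "m = max k (max m0 (to_nat i))"
      have "m0 \<le> m" "to_nat i \<le> m" "k \<le> m" unfolding m_def by linarith+
      then have "gt m i x = min (g i x) (of_nat m)"
        using m0 incseqD[OF A(4), of m0 m] by (auto simp: gt_def)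
      moreover have "(of_nat k :: ennreal) \<le> of_nat m" using \<open>k \<le> m\<close> by simp
      with k have "y < of_nat m" by (rule less_le_trans)
      ultimately show "\<exists>m\<in>UNIV. y < gt m i x" using y by (intro bexI[of _ m]) simp_all
    qed
  qed
  have Ginc: "incseq (\<lambda>m. G m x)" for x
    unfolding G_def incseq_def using Q inc by (auto intro!: csum_mono epowr_mono)
  have G_SUP: "csum (\<lambda>i. epowr (g i x) Q) = (SUP m. G m x)" if "x \<in> space M" for x
  proof -
    have "csum (\<lambda>i. epowr (g i x) Q) = csum (\<lambda>i. SUP m. epowr (gt m i x) Q)"
      using Q by (intro nn_integral_cong) (simp only: gt_SUP[OF that, symmetric], subst epowr_SUP, auto)
    also have "\<dots> = (SUP m. csum (\<lambda>i. epowr (gt m i x) Q))"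
      using Q by (intro nn_integral_monotone_convergence_SUP)
        (auto simp: incseq_def le_fun_def intro!: epowr_mono inc)
    finally show ?thesis by (simp only: G_def)
  qed
  have "(\<integral>\<^sup>+x. epowr (csum (\<lambda>i. epowr (g i x) Q)) (P / Q) \<partial>M)
      = (\<integral>\<^sup>+x. (SUP m. epowr (G m x) (P / Q)) \<partial>M)"
    using P Q by (intro nn_integral_cong) (simp add: G_SUP epowr_SUP)
  also have "\<dots> = (SUP m. \<integral>\<^sup>+x. epowr (G m x) (P / Q) \<partial>M)"
    using P Q Ginc
    by (intro nn_integral_monotone_convergence_SUP)
      (auto simp: incseq_def le_fun_def intro!: epowr_mono)
  finally show ?thesis
    unfolding mix_def using P by (simp add: epowr_SUP SUP_le_iff bound)
qed

text \<open>Minkowski's inequality for countably many summands. The pairing with a dual function is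
  additive in g, so it suffices to interchange the sums and to apply Hoelder's inequality to each
  summand.\<close>

lemma mix_csum_le:
  fixes g :: "'l::countable \<Rightarrow> 'i::countable \<Rightarrow> 'x \<Rightarrow> ennreal"
  assumes sf: "sigma_finite_measure M" and P: "1 < P" and Q: "1 < Q"
    and meas: "\<And>l i. g l i \<in> borel_measurable M"
  shows "mix M P Q (\<lambda>i x. csum (\<lambda>l. g l i x)) \<le> csum (\<lambda>l. mix M P Q (g l))"
proof -
  let ?P' = "P / (P - 1)" and ?Q' = "Q / (Q - 1)"
  have P': "1 < ?P'" "1 / P + 1 / ?P' = 1" and Q': "1 < ?Q'" "1 / Q + 1 / ?Q' = 1"
    using conjugate_exponent[OF P] conjugate_exponent[OF Q] by auto
  show ?thesis
  proof (rule mix_le_of_dual[OF sf P P' Q Q'])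
    show "(\<lambda>x. csum (\<lambda>l. g l i x)) \<in> borel_measurable M" for i
      by (intro borel_measurable_csum meas)
    fix h :: "'i \<Rightarrow> 'x \<Rightarrow> ennreal" assume h: "\<And>i. h i \<in> borel_measurable M"
    have "(\<integral>\<^sup>+x. csum (\<lambda>l. g l i x) * h i x \<partial>M) = csum (\<lambda>l. \<integral>\<^sup>+x. g l i x * h i x \<partial>M)" for i
    proof -
      have "(\<integral>\<^sup>+x. csum (\<lambda>l. g l i x) * h i x \<partial>M) = (\<integral>\<^sup>+x. csum (\<lambda>l. g l i x * h i x) \<partial>M)"
        by (rule nn_integral_cong) (rule csum_multc[symmetric])
      also have "\<dots> = csum (\<lambda>l. \<integral>\<^sup>+x. g l i x * h i x \<partial>M)"
        by (rule nn_integral_csum) (intro borel_measurable_times_ennreal meas h)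
      finally show ?thesis .
    qed
    then have "csum (\<lambda>i. \<integral>\<^sup>+x. csum (\<lambda>l. g l i x) * h i x \<partial>M)
        = csum (\<lambda>i. csum (\<lambda>l. \<integral>\<^sup>+x. g l i x * h i x \<partial>M))" by presburger
    also have "\<dots> = csum (\<lambda>l. csum (\<lambda>i. \<integral>\<^sup>+x. g l i x * h i x \<partial>M))" by (rule csum_swap)
    also have "\<dots> \<le> csum (\<lambda>l. mix M P Q (g l) * mix M ?P' ?Q' h)"
      by (intro csum_mono mix_Hoelder P Q P' Q' meas h)
    also have "\<dots> = csum (\<lambda>l. mix M P Q (g l)) * mix M ?P' ?Q' h" by (rule csum_multc)
    finally show "csum (\<lambda>i. \<integral>\<^sup>+x. csum (\<lambda>l. g l i x) * h i x \<partial>M)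
        \<le> csum (\<lambda>l. mix M P Q (g l)) * mix M ?P' ?Q' h" .
  qed
qed

section \<open>Dyadic cubes\<close>

lemma cube_measurable [measurable, simp]: "cube a l \<in> sets lebesgue"
proof -
  have "cube a l = (\<Inter>i. {x. a $ i \<le> x $ i} \<inter> {x. x $ i < a $ i + l})" by (auto simp: cube_def)
  moreover have "{x. a $ i \<le> x $ i} \<inter> {x. x $ i < a $ i + l} \<in> sets borel" for i
    by (intro sets.Int borel_closed borel_open closed_Collect_le open_Collect_less continuous_intros)
  ultimately have "cube a l \<in> sets borel" by (auto intro!: sets.countable_INT')
  then show ?thesis by simp
qed

text \<open>The half-open cube lies between an open and a closed box of the same volume.\<close>

lemma emeasure_cube:
  fixes a :: "real ^ 'n"
  assumes "0 \<le> l"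
  shows "emeasure lebesgue (cube a l) = ennreal (l ^ CARD('n))"
proof -
  let ?b = "a + (\<chi> i. l)"
  have prod: "(\<Prod>i\<in>Basis. (?b - a) \<bullet> i) = l ^ CARD('n)"
    by (simp add: Basis_vec_def inner_axis prod.UNION_disjoint axis_eq_axis)
  have le: "\<And>i. i \<in> Basis \<Longrightarrow> a \<bullet> i \<le> ?b \<bullet> i"
    using assms by (auto simp: Basis_vec_def inner_axis)
  have "box a ?b \<subseteq> cube a l" "cube a l \<subseteq> cbox a ?b"
    by (auto simp: cube_def mem_box_cart less_imp_le)
  then have "emeasure lebesgue (box a ?b) \<le> emeasure lebesgue (cube a l)"
    "emeasure lebesgue (cube a l) \<le> emeasure lebesgue (cbox a ?b)"
    by (auto intro!: emeasure_mono simp del: emeasure_completion)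
  then show ?thesis
    using le prod by (simp add: emeasure_lborel_box emeasure_lborel_cbox del: emeasure_completion add: emeasure_completion[of "box a ?b"] emeasure_completion[of "cbox a ?b"])
qed

declare emeasure_completion [simp del]

text \<open>\<open>cell j x\<close> is the position of the dyadic cube of level \<open>j\<close> that contains \<open>x\<close>, and \<open>anc l k\<close> the
  position of the ancestor, \<open>l\<close> generations up, of a cube at position \<open>k\<close>.\<close>

definition cell :: "int \<Rightarrow> real ^ 'n \<Rightarrow> int ^ 'n" where
  "cell j x = (\<chi> i. \<lfloor>x $ i * 2 powi j\<rfloor>)"

definition anc :: "nat \<Rightarrow> int ^ 'n \<Rightarrow> int ^ 'n" where
  "anc l k = (\<chi> i. k $ i div 2 ^ l)"

definition parent :: "nat \<Rightarrow> ('n::finite) dyadic \<Rightarrow> 'n dyadic" where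
  "parent l Q = (fst Q - int l, anc l (snd Q))"

lemma dlen_pos [simp]: "0 < dlen Q"
  by (simp add: dlen_def)

lemma mem_dcube_iff: "x \<in> dcube (j, k) \<longleftrightarrow> k = cell j x"
proof -
  have "dlen (j,k) * real_of_int (k $ i) \<le> x $ i \<and> x $ i < dlen (j,k) * real_of_int (k $ i) + dlen (j,k)
    \<longleftrightarrow> k $ i = \<lfloor>x $ i * 2 powi j\<rfloor>" for i
  proof -
    have pos: "0 < (2::real) powi j" by simp
    have *: "dlen (j,k) * c \<le> d \<longleftrightarrow> c \<le> d * 2 powi j" "d < dlen (j,k) * c \<longleftrightarrow> d * 2 powi j < c" for c d
      by (simp_all add: dlen_def power_int_minus field_simps)
    have "dlen (j,k) * real_of_int (k $ i) + dlen (j,k) = dlen (j,k) * (real_of_int (k $ i) + 1)"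
      by (simp add: algebra_simps)
    then have "dlen (j,k) * real_of_int (k $ i) \<le> x $ i \<and> x $ i < dlen (j,k) * real_of_int (k $ i) + dlen (j,k)
      \<longleftrightarrow> real_of_int (k $ i) \<le> x $ i * 2 powi j \<and> x $ i * 2 powi j < real_of_int (k $ i) + 1"
      using * by simp
    also have "\<dots> \<longleftrightarrow> k $ i = \<lfloor>x $ i * 2 powi j\<rfloor>" by linarith
    finally show ?thesis .
  qed
  then show ?thesis by (simp add: dcube_def cube_def dvertex_def cell_def vec_eq_iff)
qed

lemma dcube_measurable [measurable, simp]: "dcube Q \<in> sets lebesgue"
  by (simp add: dcube_def)

lemma emeasure_dcube:
  "emeasure lebesgue (dcube (Q :: ('n::finite) dyadic)) = ennreal (dlen Q ^ CARD('n))"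
  by (simp add: dcube_def emeasure_cube less_imp_le)

lemma dvol_eq: "dvol (Q :: ('n::finite) dyadic) = dlen Q ^ CARD('n)"
  by (simp add: dvol_def measure_def emeasure_dcube)

lemma dvol_pos [simp]: "0 < dvol Q"
  by (simp add: dvol_eq)

lemma emeasure_dcube_dvol: "emeasure lebesgue (dcube Q) = ennreal (dvol Q)"
  by (simp add: emeasure_dcube dvol_eq)

lemma dlen_level: "dlen (j, k) = 2 powr (- real_of_int j)"
  by (simp add: dlen_def flip: powr_real_of_int')

lemma dvol_level: "dvol (j, k :: int ^ 'n) = 2 powr (- real_of_int j * real CARD('n))"
  by (simp add: dvol_eq dlen_level powr_powr flip: powr_realpow)

lemma emeasure_dcube_level:
  fixes k k' :: "int ^ 'n"
  shows "emeasure lebesgue (dcube (j, k)) = emeasure lebesgue (dcube (j, k'))"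
  by (simp add: emeasure_dcube dlen_def)

lemma emeasure_dcube_nz [simp]: "emeasure lebesgue (dcube Q) \<noteq> 0" "emeasure lebesgue (dcube Q) \<noteq> top"
  by (simp_all add: emeasure_dcube_dvol ennreal_eq_0_iff not_le)

lemma cell_dvertex [simp]: "cell j (dvertex (j, k)) = k"
  by (simp add: cell_def dvertex_def dlen_def vec_eq_iff power_int_minus field_simps)

lemma dvertex_in_dcube: "dvertex Q \<in> dcube Q"
  by (cases Q) (simp add: mem_dcube_iff)

text \<open>Rounding down commutes with division by a positive integer: the integer part of y / 2^l
  is the integer part of y divided by 2^l and rounded down again.\<close>

lemma anc_cell: "anc l (cell j x) = cell (j - int l) x"
proof -
  have "\<lfloor>x $ i * 2 powi j\<rfloor> div 2 ^ l = \<lfloor>x $ i * 2 powi (j - int l)\<rfloor>" for i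
    using floor_divide_real_eq_div[of "2 ^ l" "x $ i * 2 powi j"]
    by (simp add: power_int_diff)
  then show ?thesis by (simp add: anc_def cell_def vec_eq_iff)
qed

lemma anc_anc: "anc a (anc b k) = anc (a + b) k"
  by (simp add: anc_def vec_eq_iff zdiv_zmult2_eq[symmetric] power_add mult.commute)

lemma parent_parent: "parent a (parent b Q) = parent (a + b) Q"
  by (simp add: parent_def anc_anc)

lemma anc_0 [simp]: "anc 0 k = k"
  by (simp add: anc_def vec_eq_iff)

lemma parent_0 [simp]: "parent 0 Q = Q"
  by (simp add: parent_def)

lemma mem_dcube: "x \<in> dcube Q \<longleftrightarrow> snd Q = cell (fst Q) x"
  by (cases Q) (simp add: mem_dcube_iff)

lemma dcube_parent: "dcube Q \<subseteq> dcube (parent l Q)"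
  by (auto simp: mem_dcube parent_def anc_cell)

text \<open>Both cubes are the cells of the same x at their levels, and an ancestor of a cell of x
  is a cell of x.\<close>

lemma dcube_nested:
  assumes "x \<in> dcube Q" "x \<in> dcube R" "fst R \<le> fst Q"
  shows "R = parent (nat (fst Q - fst R)) Q"
  using assms by (simp add: mem_dcube parent_def anc_cell prod_eq_iff)

lemma csum_cell:
  "csum (\<lambda>k. f k * indicator (dcube (j, k)) x) = f (cell j x)"
  by (subst csum_single[of "cell j x"]) (auto simp: mem_dcube indicator_def)

lemma nn_integral_dcubes:
  fixes f :: "real ^ 'n \<Rightarrow> ennreal"
  assumes [measurable]: "f \<in> borel_measurable lebesgue"
  shows "(\<integral>\<^sup>+x. f x \<partial>lebesgue) = csum (\<lambda>k. \<integral>\<^sup>+x\<in>dcube (j, k). f x \<partial>lebesgue)"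
proof -
  have "(\<integral>\<^sup>+x. f x \<partial>lebesgue) = (\<integral>\<^sup>+x. csum (\<lambda>k. f x * indicator (dcube (j, k)) x) \<partial>lebesgue)"
    by (simp add: csum_cell)
  also have "\<dots> = csum (\<lambda>k. \<integral>\<^sup>+x\<in>dcube (j, k). f x \<partial>lebesgue)"
    by (rule nn_integral_csum) simp
  finally show ?thesis .
qed

lemma sigma_finite_lebesgue: "sigma_finite_measure (lebesgue :: (real ^ 'n) measure)"
proof (unfold sigma_finite_measure_def, intro exI conjI)
  let ?A = "range (\<lambda>k :: int ^ 'n. dcube (0, k))"
  show "countable ?A" by simp
  show "?A \<subseteq> sets lebesgue" by auto
  show "\<Union> ?A = space lebesgue" by (auto simp: mem_dcube)
  show "\<forall>a\<in>?A. emeasure lebesgue a \<noteq> \<infinity>" by auto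
qed

text \<open>A lower bound for the levels is an upper bound for the sizes, so only finitely many
  ancestors of Q can lie in the family; the largest of them is taken.\<close>

lemma maximal_dyadic:
  assumes "Q \<in> \<F>" and "\<And>Q. Q \<in> \<F> \<Longrightarrow> N \<le> fst Q"
  obtains l where "parent l Q \<in> \<F>" "\<And>m. 0 < m \<Longrightarrow> parent m (parent l Q) \<notin> \<F>"
proof -
  let ?P = "\<lambda>l. parent l Q \<in> \<F>"
  have bound: "l \<le> nat (fst Q - N)" if "?P l" for l
    using assms(2)[OF that] by (simp add: parent_def)
  define l where "l = Greatest ?P"
  have "?P 0" using assms by simp
  then have "?P l" unfolding l_def by (rule GreatestI_nat) (use bound in blast)
  moreover have "parent m (parent l Q) \<notin> \<F>" if "0 < m" for m
  proof
    assume "parent m (parent l Q) \<in> \<F>"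
    then have "m + l \<le> l" unfolding parent_parent l_def[symmetric]
      using Greatest_le_nat[of ?P "m + l", OF _ bound] by (simp add: l_def)
    with that show False by simp
  qed
  ultimately show ?thesis by (rule that)
qed

text \<open>Maximality is tested against all proper ancestors, not just the parent: the family need
  not contain the intermediate cubes of a chain, and disjointness depends on this.\<close>

definition maximal_cubes :: "('n::finite) dyadic set \<Rightarrow> 'n dyadic set" where
  "maximal_cubes \<F> = {Q \<in> \<F>. \<forall>m>0. parent m Q \<notin> \<F>}"

lemma maximal_cubes_subset: "maximal_cubes \<F> \<subseteq> \<F>"
  by (auto simp: maximal_cubes_def)

lemma maximal_cubes_ancestor:
  assumes "Q \<in> \<F>" and "\<And>Q. Q \<in> \<F> \<Longrightarrow> N \<le> fst Q"
  obtains l where "parent l Q \<in> maximal_cubes \<F>"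
proof -
  obtain l where "parent l Q \<in> \<F>" "\<And>m. 0 < m \<Longrightarrow> parent m (parent l Q) \<notin> \<F>"
    using maximal_dyadic[OF assms(1), of N] assms(2) by blast
  then show ?thesis by (intro that[of l]) (auto simp: maximal_cubes_def)
qed

lemma maximal_cubes_Union:
  assumes "\<And>Q. Q \<in> \<F> \<Longrightarrow> N \<le> fst Q"
  shows "(\<Union>Q\<in>maximal_cubes \<F>. dcube Q) = (\<Union>Q\<in>\<F>. dcube Q)"
proof
  show "(\<Union>Q\<in>\<F>. dcube Q) \<subseteq> (\<Union>Q\<in>maximal_cubes \<F>. dcube Q)"
  proof
    fix x assume "x \<in> (\<Union>Q\<in>\<F>. dcube Q)"
    then obtain Q where Q: "Q \<in> \<F>" "x \<in> dcube Q" by auto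
    obtain l where "parent l Q \<in> maximal_cubes \<F>" using maximal_cubes_ancestor[OF Q(1) assms] .
    then show "x \<in> (\<Union>Q\<in>maximal_cubes \<F>. dcube Q)" using Q(2) dcube_parent by blast
  qed
qed (use maximal_cubes_subset in blast)

lemma disjoint_family_maximal_cubes: "disjoint_family_on dcube (maximal_cubes \<F>)"
proof -
  have False if "Q \<in> maximal_cubes \<F>" "R \<in> maximal_cubes \<F>" "Q \<noteq> R" "fst R \<le> fst Q"
    "x \<in> dcube Q" "x \<in> dcube R" for Q R x
  proof -
    have R: "R = parent (nat (fst Q - fst R)) Q" using dcube_nested that by blast
    then have "0 < nat (fst Q - fst R)" using that(3) by (metis gr0I parent_0)
    then have "parent (nat (fst Q - fst R)) Q \<notin> \<F>" using that(1) by (auto simp: maximal_cubes_def)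
    then show False using R that(2) maximal_cubes_subset by auto
  qed
  then show ?thesis unfolding disjoint_family_on_def by (metis disjoint_iff linear)
qed

text \<open>Offsets from a cube to the cubes of the same level that touch it, itself
  included.\<close>

definition nbrs :: "(int ^ 'n) set" where
  "nbrs = {\<nu>. \<forall>i. \<nu> $ i \<in> {-1, 0, 1}}"

lemma zero_nbrs [simp]: "0 \<in> nbrs"
  by (simp add: nbrs_def)

lemma finite_nbrs [simp]: "finite (nbrs :: (int ^ 'n) set)"
proof -
  have "nbrs \<subseteq> vec_lambda ` (PiE UNIV (\<lambda>i::'n. {-1, 0, 1::int}))"
  proof
    fix \<nu> :: "int ^ 'n" assume "\<nu> \<in> nbrs"
    then have "vec_nth \<nu> \<in> PiE UNIV (\<lambda>i::'n. {-1, 0, 1::int})" by (auto simp: nbrs_def PiE_def extensional_def)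
    then show "\<nu> \<in> vec_lambda ` (PiE UNIV (\<lambda>i::'n. {-1, 0, 1::int}))"
      by (metis image_eqI vec_lambda_eta)
  qed
  then show ?thesis by (rule finite_subset) (simp add: finite_PiE)
qed

lemma uminus_nbrs [simp]: "\<nu> \<in> nbrs \<Longrightarrow> - \<nu> \<in> nbrs"
  by (force simp: nbrs_def)

text \<open>Rounded division by 2^l is monotone, and a shift of the argument by 2^l shifts the
  quotient by exactly one; so a shift by at most one changes the quotient by at most one.\<close>

lemma anc_add_nbrs:
  assumes "\<nu> \<in> nbrs"
  shows "\<exists>\<mu>\<in>nbrs. anc l (k + \<nu>) = anc l k + \<mu>"
proof -
  have "(k $ i + \<nu> $ i) div 2 ^ l - k $ i div 2 ^ l \<in> {-1, 0, 1}" for i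
  proof -
    define p :: int where "p = 2 ^ l"
    have p: "1 \<le> p" by (simp add: p_def)
    have \<nu>: "\<nu> $ i \<in> {-1, 0, 1}" using assms by (simp add: nbrs_def)
    have "(k $ i - p) div p \<le> (k $ i + \<nu> $ i) div p" "(k $ i + \<nu> $ i) div p \<le> (k $ i + p) div p"
      using p \<nu> by (intro zdiv_mono1; force)+
    moreover have "(k $ i - p) div p = k $ i div p - 1" "(k $ i + p) div p = k $ i div p + 1"
      using p div_mult_self1[of p "k $ i" "-1"] by auto
    ultimately show ?thesis unfolding p_def by auto
  qed
  then have "anc l (k + \<nu>) - anc l k \<in> nbrs" by (simp add: nbrs_def anc_def)
  then show ?thesis by (intro bexI[of _ "anc l (k + \<nu>) - anc l k"]) auto
qed

definition dtriple :: "('n::finite) dyadic \<Rightarrow> (real ^ 'n) set" where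
  "dtriple Q = cube (dvertex Q - (\<chi> i. dlen Q)) (3 * dlen Q)"

lemma dtriple_measurable [measurable, simp]: "dtriple Q \<in> sets lebesgue"
  by (simp add: dtriple_def)

lemma emeasure_dtriple:
  "emeasure lebesgue (dtriple (Q :: ('n::finite) dyadic)) = 3 ^ CARD('n) * emeasure lebesgue (dcube Q)"
  by (simp add: dtriple_def emeasure_cube emeasure_dcube less_imp_le power_mult_distrib ennreal_mult
      flip: ennreal_power)

lemma dcube_nbr_subset_dtriple:
  assumes "\<nu> \<in> nbrs"
  shows "dcube (j, k + \<nu>) \<subseteq> dtriple (j, k)"
proof -
  have "real_of_int (k $ i) - 1 \<le> real_of_int ((k + \<nu>) $ i) \<and> real_of_int ((k + \<nu>) $ i) \<le> real_of_int (k $ i) + 1" for i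
  proof -
    have "\<nu> $ i \<in> {-1, 0, 1}" using assms by (simp add: nbrs_def)
    then show ?thesis by auto
  qed
  then have "dlen (j,k) * (real_of_int (k $ i) - 1) \<le> dlen (j,k) * real_of_int ((k + \<nu>) $ i)"
    "dlen (j,k) * real_of_int ((k + \<nu>) $ i) \<le> dlen (j,k) * (real_of_int (k $ i) + 1)" for i
    by (intro mult_left_mono less_imp_le[OF dlen_pos]; blast)+
  then have *: "dlen (j,k) * real_of_int (k $ i) - dlen (j,k) \<le> dlen (j,k) * real_of_int ((k + \<nu>) $ i)"
    "dlen (j,k) * real_of_int ((k + \<nu>) $ i) \<le> dlen (j,k) * real_of_int (k $ i) + dlen (j,k)" for i
    by (simp_all only: right_diff_distrib distrib_left mult_1_right)
  show ?thesis
  proof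
    fix x assume "x \<in> dcube (j, k + \<nu>)"
    then have x: "dlen (j,k) * real_of_int ((k + \<nu>) $ i) \<le> x $ i"
      "x $ i < dlen (j,k) * real_of_int ((k + \<nu>) $ i) + dlen (j,k)" for i
      by (auto simp: dcube_def cube_def dvertex_def dlen_def)
    have "dlen (j,k) * real_of_int (k $ i) - dlen (j,k) \<le> x $ i"
      "x $ i < dlen (j,k) * real_of_int (k $ i) - dlen (j,k) + 3 * dlen (j,k)" for i
      using x[of i] *[of i] by linarith+
    then show "x \<in> dtriple (j, k)" by (simp add: dtriple_def cube_def dvertex_def)
  qed
qed

lemma dcube_subset_open:
  fixes x :: "real ^ 'n"
  assumes "open U" "x \<in> U"
  obtains J where "\<And>j. J \<le> j \<Longrightarrow> dcube (j, cell j x) \<subseteq> U"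
proof -
  obtain e where e: "0 < e" "ball x e \<subseteq> U" using assms openE by blast
  obtain m :: nat where m: "real CARD('n) / e < 2 ^ m"
    using real_arch_pow[of 2 "real CARD('n) / e"] by auto
  have "dcube (j, cell j x) \<subseteq> U" if "int m \<le> j" for j
  proof
    fix y assume y: "y \<in> dcube (j, cell j x)"
    have x: "x \<in> dcube (j, cell j x)" by (simp add: mem_dcube)
    let ?d = "dlen (j, cell j x)"
    have "\<bar>(y - x) $ i\<bar> \<le> ?d" for i
      using x y by (auto simp: dcube_def cube_def abs_le_iff dest!: spec[of _ i])
    then have "norm (y - x) \<le> (\<Sum>i\<in>(UNIV::'n set). ?d)"
      using norm_le_l1_cart[of "y - x"] by (meson order_trans sum_mono)
    also have "\<dots> = real CARD('n) * ?d" by simp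
    also have "\<dots> \<le> real CARD('n) * 2 powi (- int m)"
      using that by (intro mult_left_mono) (auto simp: dlen_def intro!: power_int_increasing)
    also have "\<dots> < e" using m e by (simp add: power_int_minus field_simps)
    finally show "y \<in> U" using e by (auto simp: dist_norm norm_minus_commute)
  qed
  then show ?thesis by (rule that)
qed

section \<open>Dyadic averages and the maximal function\<close>

definition davg :: "('n::finite) dyadic \<Rightarrow> (real ^ 'n \<Rightarrow> ennreal) \<Rightarrow> ennreal" where
  "davg Q f = (\<integral>\<^sup>+x\<in>dcube Q. f x \<partial>lebesgue) / emeasure lebesgue (dcube Q)"

text \<open>For \<nu> = 0 this is the conditional expectation given the cubes of level j. The offset
  is included because two cubes at a distance below a given scale need not share an ancestor of that
  scale; their ancestors are only neighbours.\<close>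

definition avgop :: "int \<Rightarrow> int ^ 'n \<Rightarrow> (real ^ 'n \<Rightarrow> ennreal) \<Rightarrow> real ^ 'n \<Rightarrow> ennreal" where
  "avgop j \<nu> f x = davg (j, cell j x + \<nu>) f"

lemma borel_measurable_avgop [measurable]: "avgop j \<nu> f \<in> borel_measurable lebesgue"
proof -
  have "avgop j \<nu> f = (\<lambda>x. csum (\<lambda>k. davg (j, k + \<nu>) f * indicator (dcube (j, k)) x))"
    by (simp add: csum_cell avgop_def fun_eq_iff)
  then show ?thesis by simp
qed

lemma davg_mono: "(\<And>x. f x \<le> g x) \<Longrightarrow> davg Q f \<le> davg Q g"
  unfolding davg_def by (intro divide_right_mono_ennreal nn_integral_mono mult_right_mono) auto

lemma davg_add:
  assumes [measurable]: "f \<in> borel_measurable lebesgue" "g \<in> borel_measurable lebesgue"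
  shows "davg Q (\<lambda>x. f x + g x) = davg Q f + davg Q g"
  unfolding davg_def by (simp add: distrib_right nn_integral_add add_divide_distrib_ennreal)

lemma davg_const: "davg Q (\<lambda>x. c) = c"
  unfolding davg_def by (simp add: nn_integral_cmult_indicator ennreal_mult_divide_eq)

lemma ennreal_cancel: "c \<noteq> 0 \<Longrightarrow> c \<noteq> top \<Longrightarrow> c * inverse c = (1::ennreal)"
  by (metis divide_ennreal_def ennreal_divide_self less_top)

lemma ennreal_divide_times: "v \<noteq> 0 \<Longrightarrow> v \<noteq> top \<Longrightarrow> x / v * v = (x::ennreal)"
proof -
  assume v: "v \<noteq> 0" "v \<noteq> top"
  have "x / v * v = x * (v * inverse v)" by (simp only: divide_ennreal_def ac_simps)
  then show ?thesis by (simp add: ennreal_cancel v)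
qed

lemma davg_times: "davg Q f * emeasure lebesgue (dcube Q) = (\<integral>\<^sup>+x\<in>dcube Q. f x \<partial>lebesgue)"
  unfolding davg_def by (rule ennreal_divide_times) simp_all

lemma epowr_inverse: "x \<noteq> 0 \<Longrightarrow> x \<noteq> top \<Longrightarrow> epowr (inverse x) a = inverse (epowr x a)"
  by (cases x rule: ennreal_cases)
    (auto simp: epowr_ennreal inverse_ennreal ennreal_eq_0_iff not_le inverse_powr)

text \<open>Hoelder's inequality against the constant 1 on the cube; this form also admits infinite
  values of f.\<close>

lemma davg_Jensen:
  assumes q: "1 \<le> q" and [measurable]: "f \<in> borel_measurable lebesgue"
  shows "epowr (davg Q f) q \<le> davg Q (\<lambda>x. epowr (f x) q)"
proof (cases "q = 1")
  case False
  with q have q1: "1 < q" by simp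
  define q' where "q' = q / (q - 1)"
  have q': "1 < q'" "1 / q + 1 / q' = 1" using conjugate_exponent[OF q1] by (auto simp: q'_def)
  have qq: "1 / q' * q = q - 1" using q1 by (simp add: q'_def)
  let ?v = "emeasure lebesgue (dcube Q)"
  let ?I = "\<integral>\<^sup>+x\<in>dcube Q. epowr (f x) q \<partial>lebesgue"
  have "(\<integral>\<^sup>+x\<in>dcube Q. f x \<partial>lebesgue)
      = (\<integral>\<^sup>+x. (f x * indicator (dcube Q) x) * indicator (dcube Q) x \<partial>lebesgue)"
    by (intro nn_integral_cong) (simp add: indicator_def)
  also have "\<dots> \<le> epowr (\<integral>\<^sup>+x. epowr (f x * indicator (dcube Q) x) q \<partial>lebesgue) (1 / q)
      * epowr (\<integral>\<^sup>+x. epowr (indicator (dcube Q) x) q' \<partial>lebesgue) (1 / q')"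
    by (rule Hoelder_nn_integral[OF q1 q']) auto
  also have "(\<integral>\<^sup>+x. epowr (f x * indicator (dcube Q) x) q \<partial>lebesgue) = ?I"
    by (intro nn_integral_cong) (simp add: indicator_def)
  also have "(\<integral>\<^sup>+x. epowr (indicator (dcube Q) x) q' \<partial>lebesgue) = (\<integral>\<^sup>+x. indicator (dcube Q) x \<partial>lebesgue)"
    by (intro nn_integral_cong) (simp add: indicator_def)
  finally have "davg Q f \<le> epowr ?I (1 / q) * epowr ?v (1 / q') / ?v"
    unfolding davg_def by (simp add: divide_right_mono_ennreal)
  then have "epowr (davg Q f) q \<le> epowr (epowr ?I (1 / q) * epowr ?v (1 / q') * inverse ?v) q"
    using q by (intro epowr_mono) (auto simp: divide_ennreal_def)
  also have "\<dots> = ?I * (epowr ?v (q - 1) * inverse (epowr ?v q))"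
    using q1 qq by (simp add: epowr_mult epowr_epowr epowr_inverse mult.assoc)
  also have "epowr ?v (q - 1) * inverse (epowr ?v q) = inverse ?v"
  proof -
    have "epowr ?v q * inverse ?v = epowr ?v (q - 1) * (?v * inverse ?v)"
      using epowr_add[of ?v "q - 1" 1] by (simp add: mult.assoc[symmetric])
    then have "epowr ?v q * inverse ?v = epowr ?v (q - 1)" by (simp add: ennreal_cancel)
    then have "epowr ?v (q - 1) * inverse (epowr ?v q) = inverse ?v * (epowr ?v q * inverse (epowr ?v q))"
      by (simp only: mult.assoc[symmetric] mult.commute[of "inverse (emeasure lebesgue (dcube Q))"])
    then show ?thesis by (simp add: ennreal_cancel)
  qed
  finally show ?thesis by (simp add: davg_def divide_ennreal_def)
qed simp

lemma avgop_Jensen: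
  assumes "1 \<le> q" "f \<in> borel_measurable lebesgue"
  shows "epowr (avgop j \<nu> f x) q \<le> avgop j \<nu> (\<lambda>x. epowr (f x) q) x"
  unfolding avgop_def by (rule davg_Jensen[OF assms])

text \<open>The kernel is 1/|Q| on pairs of cubes with offset \<nu>; transposing it reverses the
  offset. All cubes of a level have the same measure, hence the single factor
  \<open>?v\<close>.\<close>

lemma avgop_dual:
  fixes f h :: "real ^ 'n \<Rightarrow> ennreal"
  assumes [measurable]: "f \<in> borel_measurable lebesgue" "h \<in> borel_measurable lebesgue"
  shows "(\<integral>\<^sup>+x. avgop j \<nu> f x * h x \<partial>lebesgue) = (\<integral>\<^sup>+x. f x * avgop j (- \<nu>) h x \<partial>lebesgue)"
proof -
  let ?v = "inverse (emeasure lebesgue (dcube (j, 0::int^'n)))"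
  let ?If = "\<lambda>k. \<integral>\<^sup>+x\<in>dcube (j, k). f x \<partial>lebesgue" and ?Ih = "\<lambda>k. \<integral>\<^sup>+x\<in>dcube (j, k). h x \<partial>lebesgue"
  have davg: "davg (j, k) g = (\<integral>\<^sup>+x\<in>dcube (j, k). g x \<partial>lebesgue) * ?v"
    for k :: "int ^ 'n" and g
    unfolding davg_def divide_ennreal_def by (simp add: emeasure_dcube_level[of j k 0])
  have "(\<integral>\<^sup>+x\<in>dcube (j, k). avgop j \<nu> f x * h x \<partial>lebesgue) = ?If (k + \<nu>) * ?v * ?Ih k" for k
  proof -
    have "(\<integral>\<^sup>+x\<in>dcube (j, k). avgop j \<nu> f x * h x \<partial>lebesgue)
        = (\<integral>\<^sup>+x. (?If (k + \<nu>) * ?v) * (h x * indicator (dcube (j, k)) x) \<partial>lebesgue)"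
      by (intro nn_integral_cong) (auto simp: indicator_def avgop_def mem_dcube davg)
    then show ?thesis by (simp add: nn_integral_cmult)
  qed
  then have "(\<integral>\<^sup>+x. avgop j \<nu> f x * h x \<partial>lebesgue) = csum (\<lambda>k. ?If (k + \<nu>) * ?v * ?Ih k)"
    by (subst nn_integral_dcubes[of _ j]) auto
  also have "\<dots> = csum (\<lambda>k. ?If (k + \<nu>) * (?v * ?Ih (k + \<nu> + - \<nu>)))"
    by (simp add: mult.assoc)
  also have "\<dots> = csum (\<lambda>k. ?If k * (?v * ?Ih (k + - \<nu>)))"
    by (rule csum_reindex[of "\<lambda>k. k + \<nu>"]) (rule bij_plus_right)
  also have "\<dots> = csum (\<lambda>k. \<integral>\<^sup>+x\<in>dcube (j, k). f x * avgop j (- \<nu>) h x \<partial>lebesgue)"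
  proof (rule nn_integral_cong)
    fix k :: "int ^ 'n"
    have "(\<integral>\<^sup>+x\<in>dcube (j, k). f x * avgop j (- \<nu>) h x \<partial>lebesgue)
        = (\<integral>\<^sup>+x. (?v * ?Ih (k + - \<nu>)) * (f x * indicator (dcube (j, k)) x) \<partial>lebesgue)"
      by (intro nn_integral_cong) (auto simp: indicator_def avgop_def mem_dcube davg ac_simps)
    then show "?If k * (?v * ?Ih (k + - \<nu>)) = (\<integral>\<^sup>+x\<in>dcube (j, k). f x * avgop j (- \<nu>) h x \<partial>lebesgue)"
      by (simp only: mult.commute[of "?If k"]) (subst nn_integral_cmult, auto)
  qed
  also have "\<dots> = (\<integral>\<^sup>+x. f x * avgop j (- \<nu>) h x \<partial>lebesgue)"
    by (rule nn_integral_dcubes[symmetric]) simp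
  finally show ?thesis .
qed

lemma nn_integral_avgop:
  assumes [measurable]: "f \<in> borel_measurable lebesgue"
  shows "(\<integral>\<^sup>+x. avgop j \<nu> f x \<partial>lebesgue) = (\<integral>\<^sup>+x. f x \<partial>lebesgue)"
  using avgop_dual[of f "\<lambda>_. 1" j \<nu>] by (simp add: avgop_def davg_const)

section \<open>The weak type inequality for shifted dyadic averages\<close>

lemma csum_indicator_disjoint:
  assumes "disjoint_family_on A I"
  shows "csum (\<lambda>i. indicator I i * indicator (A i) x) = (indicator (\<Union>i\<in>I. A i) x :: ennreal)"
proof (cases "\<exists>i\<in>I. x \<in> A i")
  case True
  then obtain i where i: "i \<in> I" "x \<in> A i" by blast
  have "csum (\<lambda>i. indicator I i * indicator (A i) x :: ennreal) = indicator I i * indicator (A i) x"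
    using assms i by (intro csum_single) (auto simp: disjoint_family_on_def indicator_def)
  then show ?thesis using i by (auto simp: indicator_def)
next
  case False
  then have *: "(\<lambda>i. indicator I i * indicator (A i) x :: ennreal) = (\<lambda>i. 0)"
    by (auto simp: indicator_def fun_eq_iff)
  show ?thesis unfolding * using False by (auto simp: indicator_def)
qed

lemma avgop_level_set_measurable [measurable]: "{x. \<exists>j\<ge>N. lm < avgop j \<nu> g x} \<in> sets lebesgue"
proof -
  have "{x \<in> space lebesgue. lm < avgop j \<nu> g x} \<in> sets lebesgue" for j by measurable
  moreover have "{x. \<exists>j\<ge>N. lm < avgop j \<nu> g x} = (\<Union>j\<in>{N..}. {x \<in> space lebesgue. lm < avgop j \<nu> g x})"
    by auto
  ultimately show ?thesis by (simp add: sets.countable_UN')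
qed

text \<open>The maximal cubes with average above \<open>lm\<close> are disjoint, and each has
  measure at most the integral of g over it divided by \<open>lm\<close>. The averaged cube is a
  neighbour of the one containing x, so it is the triples of the maximal cubes that cover the level
  set. The restriction j \<ge> N bounds the sizes and so provides maximal cubes.\<close>

lemma weak_type_levels:
  fixes g :: "real ^ 'n \<Rightarrow> ennreal"
  assumes \<nu>: "\<nu> \<in> nbrs" and lm: "lm \<noteq> 0" "lm \<noteq> top" and [measurable]: "g \<in> borel_measurable lebesgue"
  shows "emeasure lebesgue {x. \<exists>j\<ge>N. lm < avgop j \<nu> g x} \<le> 3 ^ CARD('n) * inverse lm * (\<integral>\<^sup>+x. g x \<partial>lebesgue)"
proof -
  define \<F> where "\<F> = {Q :: 'n dyadic. N \<le> fst Q \<and> lm < davg Q g}"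
  let ?M = "maximal_cubes \<F>"
  have F: "N \<le> fst Q" if "Q \<in> \<F>" for Q using that by (simp add: \<F>_def)
  have sub: "indicator {x. \<exists>j\<ge>N. lm < avgop j \<nu> g x} x \<le> csum (\<lambda>Q. indicator ?M Q * indicator (dtriple Q) x)" for x
  proof (cases "\<exists>j\<ge>N. lm < avgop j \<nu> g x")
    case True
    then obtain j where j: "N \<le> j" "lm < avgop j \<nu> g x" by blast
    then have "(j, cell j x + \<nu>) \<in> \<F>" by (simp add: \<F>_def avgop_def)
    then obtain l where l: "parent l (j, cell j x + \<nu>) \<in> ?M" using maximal_cubes_ancestor F by blast
    \<comment> \<open>The cube of x has offset - \<nu> from the selected one, and their ancestors
      remain neighbours.\<close>
    obtain \<mu> where \<mu>: "\<mu> \<in> nbrs" "anc l ((cell j x + \<nu>) + - \<nu>) = anc l (cell j x + \<nu>) + \<mu>"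
      using anc_add_nbrs[OF uminus_nbrs[OF \<nu>]] by blast
    have "x \<in> dcube (j - int l, anc l (cell j x + \<nu>) + \<mu>)"
      using \<mu>(2) by (simp add: mem_dcube anc_cell[symmetric])
    then have "x \<in> dtriple (parent l (j, cell j x + \<nu>))"
      using dcube_nbr_subset_dtriple[OF \<mu>(1)] by (auto simp: parent_def)
    then have "1 \<le> indicator ?M (parent l (j, cell j x + \<nu>)) * (indicator (dtriple (parent l (j, cell j x + \<nu>))) x :: ennreal)"
      using l by simp
    also have "\<dots> \<le> csum (\<lambda>Q. indicator ?M Q * indicator (dtriple Q) x)"
      by (rule le_csum[of "\<lambda>Q. indicator ?M Q * indicator (dtriple Q) x"])
    finally show ?thesis by (simp add: indicator_def)
  qed simp
  have small: "indicator ?M Q * emeasure lebesgue (dcube Q)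
      \<le> indicator ?M Q * (inverse lm * (\<integral>\<^sup>+x\<in>dcube Q. g x \<partial>lebesgue))" for Q
  proof (cases "Q \<in> ?M")
    case True
    then have "Q \<in> \<F>" using maximal_cubes_subset by blast
    then have "lm \<le> davg Q g" by (simp add: \<F>_def less_imp_le)
    then have "inverse lm * emeasure lebesgue (dcube Q) * lm
        \<le> inverse lm * emeasure lebesgue (dcube Q) * davg Q g"
      by (rule mult_left_mono) simp
    moreover have "inverse lm * emeasure lebesgue (dcube Q) * lm = emeasure lebesgue (dcube Q)"
    proof -
      have "inverse lm * emeasure lebesgue (dcube Q) * lm = (lm * inverse lm) * emeasure lebesgue (dcube Q)"
        by (simp only: ac_simps)
      then show ?thesis by (simp add: ennreal_cancel[OF lm])
    qed
    moreover have "emeasure lebesgue (dcube Q) * davg Q g = (\<integral>\<^sup>+x\<in>dcube Q. g x \<partial>lebesgue)"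
      by (simp only: davg_times mult.commute[of "emeasure lebesgue (dcube Q)"])
    ultimately show ?thesis using True by (simp add: mult.assoc)
  qed simp
  have "emeasure lebesgue {x. \<exists>j\<ge>N. lm < avgop j \<nu> g x}
      = (\<integral>\<^sup>+x. indicator {x. \<exists>j\<ge>N. lm < avgop j \<nu> g x} x \<partial>lebesgue)"
    by (rule nn_integral_indicator[symmetric]) (rule avgop_level_set_measurable)
  also have "\<dots> \<le> (\<integral>\<^sup>+x. csum (\<lambda>Q. indicator ?M Q * indicator (dtriple Q) x) \<partial>lebesgue)"
    by (rule nn_integral_mono) (rule sub)
  also have "\<dots> = csum (\<lambda>Q. indicator ?M Q * emeasure lebesgue (dtriple Q))"
    by (subst nn_integral_csum) (auto simp: nn_integral_cmult)
  also have "\<dots> = 3 ^ CARD('n) * csum (\<lambda>Q. indicator ?M Q * emeasure lebesgue (dcube Q))"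
    by (simp add: emeasure_dtriple csum_cmult[symmetric] ac_simps)
  also have "\<dots> \<le> 3 ^ CARD('n) * csum (\<lambda>Q. indicator ?M Q * (inverse lm * (\<integral>\<^sup>+x\<in>dcube Q. g x \<partial>lebesgue)))"
    by (intro mult_left_mono csum_mono small) simp
  also have "csum (\<lambda>Q. indicator ?M Q * (inverse lm * (\<integral>\<^sup>+x\<in>dcube Q. g x \<partial>lebesgue)))
      = inverse lm * csum (\<lambda>Q. \<integral>\<^sup>+x. g x * (indicator ?M Q * indicator (dcube Q) x) \<partial>lebesgue)"
    by (simp add: csum_cmult[symmetric] nn_integral_cmult[symmetric] ac_simps)
  also have "csum (\<lambda>Q. \<integral>\<^sup>+x. g x * (indicator ?M Q * indicator (dcube Q) x) \<partial>lebesgue)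
      = (\<integral>\<^sup>+x. g x * csum (\<lambda>Q. indicator ?M Q * indicator (dcube Q) x) \<partial>lebesgue)"
    by (subst nn_integral_csum[symmetric]) (auto simp: csum_cmult)
  also have "\<dots> \<le> (\<integral>\<^sup>+x. g x * 1 \<partial>lebesgue)"
    unfolding csum_indicator_disjoint[OF disjoint_family_maximal_cubes]
    by (intro nn_integral_mono mult_left_mono) (auto simp: indicator_def)
  finally show ?thesis by (simp add: mult.assoc mult_left_mono)
qed

definition dmax :: "int ^ 'n \<Rightarrow> (real ^ 'n \<Rightarrow> ennreal) \<Rightarrow> real ^ 'n \<Rightarrow> ennreal" where
  "dmax \<nu> g x = (SUP j. avgop j \<nu> g x)"

lemma borel_measurable_dmax [measurable]: "dmax \<nu> g \<in> borel_measurable lebesgue"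
  unfolding dmax_def by measurable

lemma dmax_level_set_measurable: "{x. c < dmax \<nu> g x} \<in> sets lebesgue"
proof -
  have "{x \<in> space lebesgue. c < dmax \<nu> g x} \<in> sets lebesgue" by measurable
  then show ?thesis by simp
qed

text \<open>The bound for levels j \<ge> N does not depend on N, and the level sets increase as N
  decreases.\<close>

lemma weak_type:
  fixes g :: "real ^ 'n \<Rightarrow> ennreal"
  assumes "\<nu> \<in> nbrs" "lm \<noteq> 0" "lm \<noteq> top" "g \<in> borel_measurable lebesgue"
  shows "emeasure lebesgue {x. lm < dmax \<nu> g x} \<le> 3 ^ CARD('n) * inverse lm * (\<integral>\<^sup>+x. g x \<partial>lebesgue)"
proof -
  let ?A = "\<lambda>m::nat. {x. \<exists>j\<ge>- int m. lm < avgop j \<nu> g x}"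
  have "{x. lm < dmax \<nu> g x} = (\<Union>m. ?A m)"
  proof -
    have "\<exists>m. - int m \<le> j" for j by (rule exI[of _ "nat (- j)"]) simp
    then show ?thesis unfolding dmax_def less_SUP_iff by blast
  qed
  moreover have "emeasure lebesgue (\<Union>m. ?A m) = (SUP m. emeasure lebesgue (?A m))"
  proof (rule SUP_emeasure_incseq[symmetric])
    have "?A m \<in> sets lebesgue" for m by (rule avgop_level_set_measurable)
    then show "range ?A \<subseteq> sets lebesgue" by blast
    show "incseq ?A" unfolding incseq_def
    proof (intro allI impI subsetI)
      fix m n :: nat and x assume "m \<le> n" "x \<in> ?A m"
      then obtain j where "- int m \<le> j" "lm < avgop j \<nu> g x" by blast
      with \<open>m \<le> n\<close> show "x \<in> ?A n" by (auto intro!: exI[of _ j])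
    qed
  qed
  ultimately show ?thesis using weak_type_levels[OF assms] by (simp add: SUP_le_iff)
qed

section \<open>Dyadic layer cake\<close>

lemma suminf_geometric_ennreal:
  assumes "0 \<le> c" "0 \<le> x" "x < 1"
  shows "(\<Sum>m. ennreal (c * x ^ m)) = ennreal (c / (1 - x))"
proof -
  have "(\<lambda>m. c * x ^ m) sums (c * (1 / (1 - x)))"
    by (intro sums_mult geometric_sums) (use assms in simp)
  then show ?thesis using assms by (subst suminf_ennreal2) (auto simp: sums_iff)
qed

lemma csum_geometric_le:
  fixes k0 :: int and a :: real
  assumes "0 < a"
  shows "csum (\<lambda>k::int. ennreal (2 powr (a * k)) * indicator {..k0} k)
    = ennreal (2 powr (a * k0) / (1 - 2 powr (- a)))"
proof -
  have bij: "bij_betw (\<lambda>m::nat. k0 - int m) UNIV {..k0}"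
    by (rule bij_betwI[of _ _ _ "\<lambda>k. nat (k0 - k)"]) auto
  have "csum (\<lambda>k::int. ennreal (2 powr (a * k)) * indicator {..k0} k)
      = (\<integral>\<^sup>+k. ennreal (2 powr (a * k)) \<partial>count_space {..k0})"
    by (simp add: nn_integral_count_space_indicator)
  also have "\<dots> = csum (\<lambda>m::nat. ennreal (2 powr (a * (k0 - int m))))"
    by (subst nn_integral_bij_count_space[OF bij, symmetric]) simp
  also have "\<dots> = (\<Sum>m. ennreal (2 powr (a * k0) * (2 powr (- a)) ^ m))"
  proof -
    have "2 powr (a * (k0 - int m)) = 2 powr (a * k0) * (2 powr (- a)) ^ m" for m
      by (simp add: powr_realpow[symmetric] powr_powr powr_add[symmetric] algebra_simps)
    then show ?thesis by (simp add: nn_integral_count_space_nat)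
  qed
  also have "\<dots> = ennreal (2 powr (a * k0) / (1 - 2 powr (- a)))"
    using assms by (intro suminf_geometric_ennreal) (auto simp: powr_less_one)
  finally show ?thesis .
qed

lemma dyadic_scale:
  assumes "0 < y"
  obtains k :: int where "2 powr k < y" "y \<le> 2 powr (k + 1)"
proof
  define k where "k = \<lceil>log 2 y\<rceil> - 1"
  have "real_of_int k < log 2 y" "log 2 y \<le> k + 1" unfolding k_def by linarith+
  then show "2 powr k < y" "y \<le> 2 powr (k + 1)"
    using assms by (auto simp: less_log_iff log_le_iff)
qed

text \<open>For finite y > 0 the single term with 2^(k+1) < y \<le> 2^(k+2) already dominates y^s.
  The threshold is 2^(k+1) rather than 2^k because the function is later split at height 2^k, half
  of it.\<close>

lemma layer_cake_upper:
  fixes s :: real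
  assumes "0 < s"
  shows "epowr y s \<le> csum (\<lambda>k::int. ennreal (2 powr (s * (k + 2))) * indicator {k::int. ennreal (2 powr (k + 1)) < y} k)"
    (is "_ \<le> csum ?f")
proof (cases y rule: ennreal_cases)
  case (real u)
  show ?thesis
  proof (cases "u = 0")
    case False
    with real obtain k :: int where k: "2 powr k < u" "u \<le> 2 powr (k + 1)" using dyadic_scale[of u] by auto
    have "epowr y s \<le> ennreal (2 powr (s * (k + 1)))"
    proof -
      have "u powr s \<le> (2 powr (k + 1)) powr s" using assms real k by (intro powr_mono2) auto
      then show ?thesis using real by (simp add: epowr_ennreal powr_powr mult.commute ennreal_leI)
    qed
    also have "\<dots> = ?f (k - 1)" using k real by (simp add: ennreal_less_iff add.commute)
    also have "\<dots> \<le> csum ?f" by (rule le_csum)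
    finally show ?thesis .
  qed (use real in simp)
next
  case top
  have le: "of_nat m \<le> csum ?f" for m :: nat
  proof -
    obtain k :: nat where k: "real m < (2 powr s) ^ k" using real_arch_pow[of "2 powr s" "real m"] assms by auto
    have "(2 powr s) ^ k = 2 powr (s * k)" by (simp add: powr_realpow[symmetric] powr_powr)
    also have "\<dots> \<le> 2 powr (s * (k + 2))" using assms by (intro powr_mono) (auto simp: mult_left_mono)
    finally have "ennreal (real m) \<le> ennreal (2 powr (s * (k + 2)))" using k by (intro ennreal_leI) simp
    then have "of_nat m \<le> ?f (int k)" using top by (simp add: ennreal_of_nat_eq_real_of_nat add.commute)
    also have "\<dots> \<le> csum ?f" by (rule le_csum)
    finally show ?thesis .
  qed
  have "csum ?f = top"
  proof (rule ccontr)
    assume "csum ?f \<noteq> top"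
    then obtain m where "csum ?f < of_nat m" using ennreal_Ex_less_of_nat[of "csum ?f"] top.not_eq_extremum by blast
    then show False using le[of m] by simp
  qed
  then show ?thesis by simp
qed

text \<open>The terms present form a geometric series, which is comparable to its last term, and 2^k
  < y there.\<close>

lemma layer_cake_lower:
  fixes a :: real
  assumes "0 < a"
  shows "csum (\<lambda>k::int. ennreal (2 powr (a * k)) * indicator {k::int. ennreal (2 powr k) < y} k)
    \<le> ennreal (1 / (1 - 2 powr (- a))) * epowr y a" (is "csum ?f \<le> _")
proof (cases y rule: ennreal_cases)
  case (real u)
  have pos: "0 < 1 - 2 powr (- a)" using assms by (simp add: powr_less_one)
  show ?thesis
  proof (cases "u = 0")
    case True
    then show ?thesis using real by simp
  next
    case False
    with real obtain k :: int where k: "2 powr k < u" "u \<le> 2 powr (k + 1)" using dyadic_scale[of u] by auto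
    have "i \<le> k" if "2 powr i < u" for i :: int
    proof -
      have "2 powr real_of_int i < 2 powr (k + 1)" using that k by linarith
      then have "real_of_int i < k + 1" by simp
      then show ?thesis by linarith
    qed
    then have "csum ?f \<le> csum (\<lambda>i::int. ennreal (2 powr (a * i)) * indicator {..k} i)"
      using real by (intro csum_mono mult_left_mono) (auto simp: indicator_def ennreal_less_iff)
    also have "\<dots> = ennreal (2 powr (a * k) / (1 - 2 powr (- a)))" by (rule csum_geometric_le[OF assms])
    also have "\<dots> \<le> ennreal (u powr a / (1 - 2 powr (- a)))"
    proof (intro ennreal_leI divide_right_mono)
      have "(2 powr k) powr a \<le> u powr a" using assms k by (intro powr_mono2) auto
      then show "2 powr (a * k) \<le> u powr a" by (simp add: powr_powr mult.commute)
    qed (use pos in simp)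
    also have "\<dots> = ennreal (1 / (1 - 2 powr (- a))) * epowr y a"
      using real pos by (simp add: epowr_ennreal ennreal_mult[symmetric])
    finally show ?thesis .
  qed
next
  case top
  have "0 < 1 - 2 powr (- a)" using assms by (simp add: powr_less_one)
  then have "ennreal (1 / (1 - 2 powr (- a))) \<noteq> 0" by (simp add: ennreal_eq_0_iff not_le)
  then show ?thesis using top by (simp add: ennreal_mult_top)
qed

text \<open>Marcinkiewicz interpolation between the weak type inequality and the trivial bound for
  bounded functions, with dyadic heights so that the layer cake integrals become sums. One power of
  h is kept from the weak type bound; the sum over the heights below h supplies the other s -
  1.\<close>

lemma maximal_strong_type:
  fixes h :: "real ^ 'n \<Rightarrow> ennreal"
  assumes \<nu>: "\<nu> \<in> nbrs" and s: "1 < s" and [measurable]: "h \<in> borel_measurable lebesgue"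
  shows "(\<integral>\<^sup>+x. epowr (dmax \<nu> h x) s \<partial>lebesgue)
    \<le> ennreal (3 ^ CARD('n) * 2 powr (2 * s) / (1 - 2 powr (- (s - 1)))) * (\<integral>\<^sup>+x. epowr (h x) s \<partial>lebesgue)"
proof -
  define A where "A k = {x \<in> space lebesgue. ennreal (2 powr (real_of_int k + 1)) < dmax \<nu> h x}" for k :: int
  define B where "B k = {x \<in> space lebesgue. ennreal (2 powr real_of_int k) < h x}" for k :: int
  have [measurable]: "A k \<in> sets lebesgue" "B k \<in> sets lebesgue" for k :: int
    unfolding A_def B_def by measurable
  have AB: "emeasure lebesgue (A k) \<le> 3 ^ CARD('n) * ennreal (2 powr (- real_of_int k)) * (\<integral>\<^sup>+x\<in>B k. h x \<partial>lebesgue)" for k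
  proof -
    let ?c = "ennreal (2 powr real_of_int k)"
    let ?h = "\<lambda>x. h x * indicator (B k) x"
    \<comment> \<open>Off \<open>B k\<close> the function is at most 2^k, so that part adds at most
      2^k to every average. Where the maximal function exceeds 2^(k+1), the part on
      \<open>B k\<close> must therefore account for more than 2^k.\<close>
    have "avgop j \<nu> h x \<le> avgop j \<nu> ?h x + ?c" for j x
    proof -
      have "davg (j, cell j x + \<nu>) h \<le> davg (j, cell j x + \<nu>) (\<lambda>x. ?h x + ?c)"
        by (rule davg_mono) (auto simp: B_def indicator_def)
      also have "\<dots> = davg (j, cell j x + \<nu>) ?h + ?c"
        by (subst davg_add) (auto simp: davg_const)
      finally show ?thesis by (simp add: avgop_def)
    qed
    moreover have "avgop j \<nu> ?h x \<le> dmax \<nu> ?h x" for j x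
      unfolding dmax_def by (rule SUP_upper) simp
    ultimately have "avgop j \<nu> h x \<le> dmax \<nu> ?h x + ?c" for j x
      by (meson add_right_mono order_trans)
    then have le: "dmax \<nu> h x \<le> dmax \<nu> ?h x + ?c" for x
      unfolding dmax_def[of \<nu> h] by (intro SUP_least)
    have "A k \<subseteq> {x. ?c < dmax \<nu> ?h x}"
    proof
      fix x assume "x \<in> A k"
      then have "ennreal (2 powr (real_of_int k + 1)) < dmax \<nu> h x" by (simp add: A_def)
      then have "ennreal (2 powr (real_of_int k + 1)) < dmax \<nu> ?h x + ?c" by (rule less_le_trans[OF _ le])
      moreover have "ennreal (2 powr (real_of_int k + 1)) = ?c + ?c"
        by (simp add: powr_add flip: ennreal_plus)
      ultimately have *: "?c + ?c < dmax \<nu> ?h x + ?c" by (simp only:)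
      have "?c < dmax \<nu> ?h x"
      proof (rule ccontr)
        assume "\<not> ?c < dmax \<nu> ?h x"
        then have "dmax \<nu> ?h x + ?c \<le> ?c + ?c" unfolding not_less by (rule add_right_mono)
        with * show False by (meson leD)
      qed
      then show "x \<in> {x. ?c < dmax \<nu> ?h x}" by (rule CollectI)
    qed
    then have "emeasure lebesgue (A k) \<le> emeasure lebesgue {x. ?c < dmax \<nu> ?h x}"
      by (rule emeasure_mono[OF _ dmax_level_set_measurable])
    also have "\<dots> \<le> 3 ^ CARD('n) * inverse ?c * (\<integral>\<^sup>+x. ?h x \<partial>lebesgue)"
      by (rule weak_type[OF \<nu>]) simp_all
    also have "inverse ?c = ennreal (2 powr (- real_of_int k))" by (simp add: inverse_ennreal powr_minus)
    finally show ?thesis by simp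
  qed
  have "(\<integral>\<^sup>+x. epowr (dmax \<nu> h x) s \<partial>lebesgue)
      \<le> (\<integral>\<^sup>+x. csum (\<lambda>k::int. ennreal (2 powr (s * (real_of_int k + 2))) * indicator (A k) x) \<partial>lebesgue)"
    using s layer_cake_upper[of s] by (intro nn_integral_mono) (auto simp: A_def indicator_def)
  also have "\<dots> = csum (\<lambda>k::int. ennreal (2 powr (s * (real_of_int k + 2))) * emeasure lebesgue (A k))"
    by (subst nn_integral_csum) (auto simp: nn_integral_cmult_indicator)
  also have "\<dots> \<le> csum (\<lambda>k::int. ennreal (2 powr (s * (real_of_int k + 2))) *
      (3 ^ CARD('n) * ennreal (2 powr (- real_of_int k)) * (\<integral>\<^sup>+x\<in>B k. h x \<partial>lebesgue)))"
    by (intro csum_mono mult_left_mono AB) simp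
  also have "\<dots> = csum (\<lambda>k::int. \<integral>\<^sup>+x. (3 ^ CARD('n) * ennreal (2 powr (2 * s))) *
      (h x * (ennreal (2 powr ((s - 1) * real_of_int k)) * indicator (B k) x)) \<partial>lebesgue)"
  proof (rule nn_integral_cong)
    fix k :: int
    have "(2::real) powr (s * (real_of_int k + 2)) * 2 powr (- real_of_int k) = 2 powr (2 * s) * 2 powr ((s - 1) * real_of_int k)"
      by (simp add: powr_add[symmetric] algebra_simps)
    then have "ennreal (2 powr (s * (real_of_int k + 2))) * ennreal (2 powr (- real_of_int k)) = ennreal (2 powr (2 * s)) * ennreal (2 powr ((s - 1) * real_of_int k))"
      by (simp add: ennreal_mult[symmetric])
    then have "ennreal (2 powr (s * (real_of_int k + 2))) * (3 ^ CARD('n) * ennreal (2 powr (- real_of_int k)) * (\<integral>\<^sup>+x\<in>B k. h x \<partial>lebesgue))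
        = (3 ^ CARD('n) * ennreal (2 powr (2 * s))) * (ennreal (2 powr ((s - 1) * real_of_int k)) * (\<integral>\<^sup>+x\<in>B k. h x \<partial>lebesgue))"
    proof -
      have "ennreal (2 powr (s * (real_of_int k + 2))) * (3 ^ CARD('n) * ennreal (2 powr (- real_of_int k)) * (\<integral>\<^sup>+x\<in>B k. h x \<partial>lebesgue))
        = 3 ^ CARD('n) * (ennreal (2 powr (s * (real_of_int k + 2))) * ennreal (2 powr (- real_of_int k))) * (\<integral>\<^sup>+x\<in>B k. h x \<partial>lebesgue)"
        by (simp only: ac_simps)
      also have "\<dots> = (3 ^ CARD('n) * ennreal (2 powr (2 * s))) * (ennreal (2 powr ((s - 1) * real_of_int k)) * (\<integral>\<^sup>+x\<in>B k. h x \<partial>lebesgue))"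
        unfolding \<open>ennreal (2 powr (s * (real_of_int k + 2))) * ennreal (2 powr (- real_of_int k)) = _\<close> by (simp only: ac_simps)
      finally show ?thesis .
    qed
    also have "\<dots> = (\<integral>\<^sup>+x. (3 ^ CARD('n) * ennreal (2 powr (2 * s))) *
      (ennreal (2 powr ((s - 1) * real_of_int k)) * (h x * indicator (B k) x)) \<partial>lebesgue)"
      by (simp add: nn_integral_cmult)
    finally show "ennreal (2 powr (s * (real_of_int k + 2))) * (3 ^ CARD('n) * ennreal (2 powr (- real_of_int k)) * (\<integral>\<^sup>+x\<in>B k. h x \<partial>lebesgue))
        = (\<integral>\<^sup>+x. (3 ^ CARD('n) * ennreal (2 powr (2 * s))) *
      (h x * (ennreal (2 powr ((s - 1) * real_of_int k)) * indicator (B k) x)) \<partial>lebesgue)"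
      by (simp add: ac_simps)
  qed
  also have "\<dots> = (\<integral>\<^sup>+x. (3 ^ CARD('n) * ennreal (2 powr (2 * s))) *
      (h x * csum (\<lambda>k::int. ennreal (2 powr ((s - 1) * real_of_int k)) * indicator (B k) x)) \<partial>lebesgue)"
    by (subst nn_integral_csum[symmetric]) (auto simp: csum_cmult)
  also have "\<dots> \<le> (\<integral>\<^sup>+x. (3 ^ CARD('n) * ennreal (2 powr (2 * s))) *
      (h x * (ennreal (1 / (1 - 2 powr (- (s - 1)))) * epowr (h x) (s - 1))) \<partial>lebesgue)"
    using s layer_cake_lower[of "s - 1"]
    by (intro nn_integral_mono mult_left_mono) (auto simp: B_def indicator_def)
  also have "\<dots> = (\<integral>\<^sup>+x. (3 ^ CARD('n) * ennreal (2 powr (2 * s)) * ennreal (1 / (1 - 2 powr (- (s - 1))))) *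
      epowr (h x) s \<partial>lebesgue)"
  proof (rule nn_integral_cong)
    fix x
    have "h x * epowr (h x) (s - 1) = epowr (h x) s" using epowr_add[of "h x" 1 "s - 1"] by simp
    then show "(3 ^ CARD('n) * ennreal (2 powr (2 * s))) *
      (h x * (ennreal (1 / (1 - 2 powr (- (s - 1)))) * epowr (h x) (s - 1)))
      = (3 ^ CARD('n) * ennreal (2 powr (2 * s)) * ennreal (1 / (1 - 2 powr (- (s - 1))))) * epowr (h x) s"
      unfolding \<open>h x * _ = _\<close>[symmetric] by (simp only: ac_simps)
  qed
  also have "\<dots> = (3 ^ CARD('n) * ennreal (2 powr (2 * s)) * ennreal (1 / (1 - 2 powr (- (s - 1))))) *
      (\<integral>\<^sup>+x. epowr (h x) s \<partial>lebesgue)"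
    by (rule nn_integral_cmult) simp
  also have "3 ^ CARD('n) * ennreal (2 powr (2 * s)) * ennreal (1 / (1 - 2 powr (- (s - 1))))
      = ennreal (3 ^ CARD('n) * 2 powr (2 * s) / (1 - 2 powr (- (s - 1))))"
  proof -
    have "(3::ennreal) ^ CARD('n) = ennreal (3 ^ CARD('n))" using ennreal_power[of 3 "CARD('n)"] by simp
    moreover have "0 \<le> 1 - 2 powr (- (s - 1))" using s powr_less_one[of 2 "- (s - 1)"] by simp
    ultimately show ?thesis by (simp only: ennreal_mult[symmetric] mult_nonneg_nonneg
        zero_le_power zero_le_numeral powr_ge_zero zero_le_divide_1_iff times_divide_eq_right mult_1_right)
  qed
  finally show ?thesis .
qed

section \<open>A vector-valued averaging inequality\<close>

lemma avgop_le_dmax: "avgop j \<nu> g x \<le> dmax \<nu> g x"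
  unfolding dmax_def by (rule SUP_upper) simp

text \<open>With equal exponents the components decouple. Each average is a contraction, by Jensen's
  inequality and because averaging preserves integrals.\<close>

lemma avgop_mix_diagonal:
  fixes f :: "'i::countable \<Rightarrow> real ^ 'n \<Rightarrow> ennreal"
  assumes P: "1 \<le> P" and f [measurable]: "\<And>i. f i \<in> borel_measurable lebesgue"
  shows "mix lebesgue P P (\<lambda>i. avgop (c i) \<nu> (f i)) \<le> mix lebesgue P P f"
proof -
  have eq: "mix lebesgue P P g = epowr (csum (\<lambda>i. \<integral>\<^sup>+x. epowr (g i x) P \<partial>lebesgue)) (1 / P)"
    if "\<And>i. g i \<in> borel_measurable lebesgue" for g :: "'i \<Rightarrow> real ^ 'n \<Rightarrow> ennreal"
    unfolding mix_def using P that by (simp add: nn_integral_csum[symmetric])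
  have "(\<integral>\<^sup>+x. epowr (avgop (c i) \<nu> (f i) x) P \<partial>lebesgue) \<le> (\<integral>\<^sup>+x. epowr (f i x) P \<partial>lebesgue)" for i
  proof -
    have "(\<integral>\<^sup>+x. epowr (avgop (c i) \<nu> (f i) x) P \<partial>lebesgue)
        \<le> (\<integral>\<^sup>+x. avgop (c i) \<nu> (\<lambda>x. epowr (f i x) P) x \<partial>lebesgue)"
      by (intro nn_integral_mono avgop_Jensen P f)
    also have "\<dots> = (\<integral>\<^sup>+x. epowr (f i x) P \<partial>lebesgue)" by (rule nn_integral_avgop) simp
    finally show ?thesis .
  qed
  then show ?thesis using P by (simp add: eq f borel_measurable_avgop epowr_mono csum_mono)
qed

lemma mix_unit:
  assumes "0 < a"
  shows "mix M a a (\<lambda>_::unit. g) = epowr (\<integral>\<^sup>+x. epowr (g x) a \<partial>M) (1 / a)"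
  using assms by (subst mix_single[of _ _ "()"]) auto

text \<open>The Q-th power of the norm is the norm in L^(P/Q) of \<Sum> (T_i f_i)^Q. When this is
  paired with H, Jensen's inequality moves the power inside the average and the adjoint moves the
  average onto H, where a single maximal function serves all indices i whatever the levels
  \<open>c i\<close> are.\<close>

lemma avgop_mix_above_diagonal:
  fixes f :: "'i::countable \<Rightarrow> real ^ 'n \<Rightarrow> ennreal"
  assumes \<nu>: "\<nu> \<in> nbrs" and Q: "1 < Q" and PQ: "Q < P"
  shows "\<exists>C::real. 0 < C \<and> (\<forall>c (f :: 'i \<Rightarrow> real ^ 'n \<Rightarrow> ennreal). (\<forall>i. f i \<in> borel_measurable lebesgue) \<longrightarrow>
    mix lebesgue P Q (\<lambda>i. avgop (c i) \<nu> (f i)) \<le> ennreal C * mix lebesgue P Q f)"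
proof -
  define a where "a = P / Q"
  define a' where "a' = a / (a - 1)"
  have a: "1 < a" using Q PQ by (simp add: a_def)
  have a': "1 < a'" "1 / a + 1 / a' = 1" using conjugate_exponent[OF a] by (auto simp: a'_def)
  define C0 :: real where "C0 = 3 ^ CARD('n) * 2 powr (2 * a') / (1 - 2 powr (- (a' - 1)))"
  have C0: "0 < C0" unfolding C0_def using a' powr_less_one[of 2 "- (a' - 1)"] by simp
  define C where "C = (C0 powr (1 / a')) powr (1 / Q)"
  have "0 < C" using C0 by (simp add: C_def)
  moreover have "mix lebesgue P Q (\<lambda>i. avgop (c i) \<nu> (f i)) \<le> ennreal C * mix lebesgue P Q f"
    if f [measurable]: "\<And>i. f i \<in> borel_measurable lebesgue" for c and f :: "'i \<Rightarrow> real ^ 'n \<Rightarrow> ennreal"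
  proof -
    let ?T = "\<lambda>i. avgop (c i) \<nu> (f i)"
    define \<Phi> where "\<Phi> x = csum (\<lambda>i. epowr (?T i x) Q)" for x
    define F where "F x = csum (\<lambda>i. epowr (f i x) Q)" for x
    have [measurable]: "\<Phi> \<in> borel_measurable lebesgue" "F \<in> borel_measurable lebesgue"
      unfolding \<Phi>_def F_def by (intro borel_measurable_csum borel_measurable_epowr borel_measurable_avgop f)+
    have "mix lebesgue a a (\<lambda>_::unit. \<Phi>) \<le> ennreal (C0 powr (1 / a')) * mix lebesgue a a (\<lambda>_::unit. F)"
    proof (rule mix_le_of_dual[OF sigma_finite_lebesgue a a' a a'])
      fix h :: "unit \<Rightarrow> real ^ 'n \<Rightarrow> ennreal" assume h: "\<And>i. h i \<in> borel_measurable lebesgue"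
      define H where "H = h ()"
      have [measurable]: "H \<in> borel_measurable lebesgue" using h by (simp add: H_def)
      have hH: "h = (\<lambda>_. H)" by (auto simp: H_def fun_eq_iff)
      have "csum (\<lambda>i::unit. \<integral>\<^sup>+x. \<Phi> x * h i x \<partial>lebesgue) = (\<integral>\<^sup>+x. \<Phi> x * H x \<partial>lebesgue)"
        by (subst csum_single[of "()"]) (auto simp: H_def)
      also have "\<dots> = csum (\<lambda>i. \<integral>\<^sup>+x. epowr (?T i x) Q * H x \<partial>lebesgue)"
        unfolding \<Phi>_def csum_multc[symmetric] by (rule nn_integral_csum) simp
      also have "\<dots> \<le> csum (\<lambda>i. \<integral>\<^sup>+x. epowr (f i x) Q * dmax (- \<nu>) H x \<partial>lebesgue)"
      proof (rule csum_mono)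
        fix i
        have "(\<integral>\<^sup>+x. epowr (?T i x) Q * H x \<partial>lebesgue)
            \<le> (\<integral>\<^sup>+x. avgop (c i) \<nu> (\<lambda>x. epowr (f i x) Q) x * H x \<partial>lebesgue)"
          using Q by (intro nn_integral_mono mult_right_mono avgop_Jensen f) auto
        also have "\<dots> = (\<integral>\<^sup>+x. epowr (f i x) Q * avgop (c i) (- \<nu>) H x \<partial>lebesgue)"
          by (rule avgop_dual) auto
        also have "\<dots> \<le> (\<integral>\<^sup>+x. epowr (f i x) Q * dmax (- \<nu>) H x \<partial>lebesgue)"
          by (intro nn_integral_mono mult_left_mono avgop_le_dmax) simp
        finally show "(\<integral>\<^sup>+x. epowr (?T i x) Q * H x \<partial>lebesgue)
          \<le> (\<integral>\<^sup>+x. epowr (f i x) Q * dmax (- \<nu>) H x \<partial>lebesgue)" .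
      qed
      also have "\<dots> = (\<integral>\<^sup>+x. F x * dmax (- \<nu>) H x \<partial>lebesgue)"
        unfolding F_def csum_multc[symmetric] by (rule nn_integral_csum[symmetric]) simp
      also have "\<dots> \<le> mix lebesgue a a (\<lambda>_::unit. F) * epowr (\<integral>\<^sup>+x. epowr (dmax (- \<nu>) H x) a' \<partial>lebesgue) (1 / a')"
        using Hoelder_nn_integral[OF a a', of F lebesgue "dmax (- \<nu>) H"] a by (simp add: mix_unit)
      also have "\<dots> \<le> mix lebesgue a a (\<lambda>_::unit. F) *
          epowr (ennreal C0 * (\<integral>\<^sup>+x. epowr (H x) a' \<partial>lebesgue)) (1 / a')"
        using a' maximal_strong_type[of "- \<nu>" a' H] \<nu>
        by (intro mult_left_mono epowr_mono) (auto simp: C0_def)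
      also have "\<dots> = ennreal (C0 powr (1 / a')) * mix lebesgue a a (\<lambda>_::unit. F) * mix lebesgue a' a' h"
        using a' C0 by (simp add: epowr_mult epowr_ennreal hH mix_unit ac_simps)
      finally show "csum (\<lambda>i::unit. \<integral>\<^sup>+x. \<Phi> x * h i x \<partial>lebesgue)
        \<le> ennreal (C0 powr (1 / a')) * mix lebesgue a a (\<lambda>_::unit. F) * mix lebesgue a' a' h" .
    qed simp
    moreover have "mix lebesgue P Q g = epowr (mix lebesgue a a (\<lambda>_::unit. \<lambda>x. csum (\<lambda>i. epowr (g i x) Q))) (1 / Q)"
      for g :: "'i \<Rightarrow> real ^ 'n \<Rightarrow> ennreal"
      using a Q PQ by (simp add: mix_unit mix_def epowr_epowr) (simp add: a_def)
    ultimately have "mix lebesgue P Q ?T \<le> epowr (ennreal (C0 powr (1 / a')) * mix lebesgue a a (\<lambda>_::unit. F)) (1 / Q)"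
      and "mix lebesgue P Q f = epowr (mix lebesgue a a (\<lambda>_::unit. F)) (1 / Q)"
      using Q by (auto intro!: epowr_mono simp: \<Phi>_def[abs_def] F_def[abs_def])
    then show ?thesis by (simp add: epowr_mult epowr_ennreal C_def)
  qed
  ultimately show ?thesis by blast
qed

text \<open>Conjugation reverses the order of the exponents, and the adjoints are again averages,
  with offset - \<nu>. So P < Q is dual to the case Q' < P'.\<close>

lemma avgop_mix:
  assumes \<nu>: "\<nu> \<in> nbrs" and P: "1 < P" and Q: "1 < Q"
  shows "\<exists>C::real. 0 < C \<and> (\<forall>c (f :: 'i::countable \<Rightarrow> real ^ 'n \<Rightarrow> ennreal). (\<forall>i. f i \<in> borel_measurable lebesgue) \<longrightarrow>
    mix lebesgue P Q (\<lambda>i. avgop (c i) \<nu> (f i)) \<le> ennreal C * mix lebesgue P Q f)"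
proof -
  consider "Q < P" | "P = Q" | "P < Q" by linarith
  then show ?thesis
  proof cases
    case 1
    then show ?thesis using avgop_mix_above_diagonal[OF \<nu> Q 1] by blast
  next
    case 2
    then show ?thesis using avgop_mix_diagonal[of P] P by (intro exI[of _ 1]) auto
  next
    case 3
    define P' where "P' = P / (P - 1)"
    define Q' where "Q' = Q / (Q - 1)"
    have P': "1 < P'" "1 / P + 1 / P' = 1" and Q': "1 < Q'" "1 / Q + 1 / Q' = 1"
      using conjugate_exponent[OF P] conjugate_exponent[OF Q] by (auto simp: P'_def Q'_def)
    have "Q' < P'" using 3 P Q by (simp add: P'_def Q'_def field_simps)
    then obtain C :: real where C: "0 < C" "\<And>c (f :: 'i \<Rightarrow> real ^ 'n \<Rightarrow> ennreal). (\<And>i. f i \<in> borel_measurable lebesgue) \<Longrightarrow>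
        mix lebesgue P' Q' (\<lambda>i. avgop (c i) (- \<nu>) (f i)) \<le> ennreal C * mix lebesgue P' Q' f"
      using avgop_mix_above_diagonal[OF uminus_nbrs[OF \<nu>] Q'(1), of P'] by blast
    have "mix lebesgue P Q (\<lambda>i. avgop (c i) \<nu> (f i)) \<le> ennreal C * mix lebesgue P Q f"
      if f: "\<And>i. f i \<in> borel_measurable lebesgue" for c and f :: "'i \<Rightarrow> real ^ 'n \<Rightarrow> ennreal"
    proof (rule mix_le_of_dual[OF sigma_finite_lebesgue P P' Q Q'])
      fix h :: "'i \<Rightarrow> real ^ 'n \<Rightarrow> ennreal" assume h: "\<And>i. h i \<in> borel_measurable lebesgue"
      have "csum (\<lambda>i. \<integral>\<^sup>+x. avgop (c i) \<nu> (f i) x * h i x \<partial>lebesgue)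
          = csum (\<lambda>i. \<integral>\<^sup>+x. f i x * avgop (c i) (- \<nu>) (h i) x \<partial>lebesgue)"
        by (simp add: avgop_dual f h)
      also have "\<dots> \<le> mix lebesgue P Q f * mix lebesgue P' Q' (\<lambda>i. avgop (c i) (- \<nu>) (h i))"
        by (intro mix_Hoelder P P' Q Q' f borel_measurable_avgop)
      also have "\<dots> \<le> mix lebesgue P Q f * (ennreal C * mix lebesgue P' Q' h)"
        by (intro mult_left_mono C h) simp
      finally show "csum (\<lambda>i. \<integral>\<^sup>+x. avgop (c i) \<nu> (f i) x * h i x \<partial>lebesgue)
        \<le> ennreal C * mix lebesgue P Q f * mix lebesgue P' Q' h" by (simp add: ac_simps)
    qed (rule borel_measurable_avgop)
    with C(1) show ?thesis by blast
  qed
qed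

section \<open>The Hahn--Banach theorem for seminorms\<close>

definition sublinear :: "('a::real_vector \<Rightarrow> real) \<Rightarrow> bool" where
  "sublinear p \<longleftrightarrow> (\<forall>x y. p (x + y) \<le> p x + p y) \<and> (\<forall>x. \<forall>a\<ge>0. p (a *\<^sub>R x) = a * p x)"

lemma sublinear_0: "sublinear p \<Longrightarrow> p 0 = 0"
  unfolding sublinear_def by (metis mult_zero_left order_refl scale_zero_left)

lemma sublinear_minus: "sublinear p \<Longrightarrow> - p (- x) \<le> p x"
  using sublinear_0[of p] unfolding sublinear_def by (smt (verit) add.right_inverse)

text \<open>The infimum of p(x + t y) - t p(y) over t \<ge> 0 is sublinear; t = 0 shows that it lies
  below p, and t = 1 at x = -y gives the value -p(y). It is finite because -p(-x) is a lower
  bound.\<close>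

lemma sublinear_reduce:
  assumes p: "sublinear p"
  shows "\<exists>q. sublinear q \<and> q \<le> p \<and> q (- y) \<le> - p y"
proof -
  define q where "q x = (INF t\<in>{0..}. p (x + t *\<^sub>R y) - t * p y)" for x
  have add: "p (x + x') \<le> p x + p x'" for x x' using p by (simp add: sublinear_def)
  have scale: "0 \<le> a \<Longrightarrow> p (a *\<^sub>R x) = a * p x" for a x using p by (simp add: sublinear_def)
  have low: "- p (- x) \<le> p (x + t *\<^sub>R y) - t * p y" if "0 \<le> t" for x t
    using add[of "x + t *\<^sub>R y" "- x"] scale[OF that, of y] by simp
  have bdd: "bdd_below ((\<lambda>t. p (x + t *\<^sub>R y) - t * p y) ` {0..})" for x
    using low by (intro bdd_belowI2[of _ "- p (- x)"]) auto
  have q_le: "q x \<le> p (x + t *\<^sub>R y) - t * p y" if "0 \<le> t" for x t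
    unfolding q_def by (rule cINF_lower[OF bdd]) (use that in simp)
  have q_ge: "c \<le> q x" if "\<And>t. 0 \<le> t \<Longrightarrow> c \<le> p (x + t *\<^sub>R y) - t * p y" for c x
    unfolding q_def by (rule cINF_greatest) (use that in auto)
  have "q (x + x') \<le> q x + q x'" for x x'
  proof -
    have "q (x + x') - (p (x' + t' *\<^sub>R y) - t' * p y) \<le> q x" if t': "0 \<le> t'" for t'
    proof (rule q_ge)
      fix t :: real assume t: "0 \<le> t"
      have "q (x + x') \<le> p (x + x' + (t + t') *\<^sub>R y) - (t + t') * p y" using t t' by (intro q_le) simp
      also have "x + x' + (t + t') *\<^sub>R y = (x + t *\<^sub>R y) + (x' + t' *\<^sub>R y)" by (simp add: algebra_simps)
      finally show "q (x + x') - (p (x' + t' *\<^sub>R y) - t' * p y) \<le> p (x + t *\<^sub>R y) - t * p y"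
        using add[of "x + t *\<^sub>R y" "x' + t' *\<^sub>R y"] by (simp add: algebra_simps)
    qed
    then have "q (x + x') - q x \<le> q x'" by (intro q_ge) (smt (verit))
    then show ?thesis by simp
  qed
  moreover have "q (a *\<^sub>R x) = a * q x" if a: "0 \<le> a" for a x
  proof (cases "a = 0")
    case True
    have "q 0 \<le> 0" using q_le[of 0 0] sublinear_0[OF p] by simp
    moreover have "0 \<le> q 0" using scale[of _ y] by (intro q_ge) simp
    ultimately show ?thesis using True by simp
  next
    case False
    have half: "b * q z \<le> q (b *\<^sub>R z)" if b: "0 < b" for b z
    proof (rule q_ge)
      fix t :: real assume t: "0 \<le> t"
      have "b * q z \<le> b * (p (z + (t / b) *\<^sub>R y) - t / b * p y)"
        using b t by (intro mult_left_mono q_le) auto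
      also have "\<dots> = p (b *\<^sub>R (z + (t / b) *\<^sub>R y)) - t * p y"
        using b scale[of b "z + (t / b) *\<^sub>R y"] by (simp add: right_diff_distrib)
      also have "b *\<^sub>R (z + (t / b) *\<^sub>R y) = b *\<^sub>R z + t *\<^sub>R y" using b by (simp add: scaleR_add_right)
      finally show "b * q z \<le> p (b *\<^sub>R z + t *\<^sub>R y) - t * p y" .
    qed
    have "inverse a * q (a *\<^sub>R x) \<le> q x" using half[of "inverse a" "a *\<^sub>R x"] False a by simp
    then have "q (a *\<^sub>R x) \<le> a * q x" using False a by (simp add: field_simps)
    with half[of a x] show ?thesis using False a by simp
  qed
  ultimately have "sublinear q" by (simp add: sublinear_def)
  moreover have "q \<le> p" using q_le[of 0] by (auto simp: le_fun_def)
  moreover have "q (- y) \<le> - p y" using q_le[of 1 "- y"] sublinear_0[OF p] by simp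
  ultimately show ?thesis by blast
qed

text \<open>The infimum is taken pointwise. In a chain, the smaller of two members serves both sides
  of the subadditivity, and -\<rho>(-x) bounds all members from below.\<close>

lemma sublinear_Inf_chain:
  assumes "C \<noteq> {}" and C: "\<And>p. p \<in> C \<Longrightarrow> sublinear p \<and> p \<le> \<rho>"
    and chain: "\<And>p q. p \<in> C \<Longrightarrow> q \<in> C \<Longrightarrow> p \<le> q \<or> q \<le> p"
  shows "\<exists>u. sublinear u \<and> (\<forall>p\<in>C. u \<le> p)"
proof -
  define u where "u x = (INF p\<in>C. p x)" for x
  have low: "- \<rho> (- x) \<le> p x" if "p \<in> C" for p x
    using sublinear_minus[of p x] C[OF that] by (auto simp: le_fun_def) (smt (verit))
  have bdd: "bdd_below ((\<lambda>p. p x) ` C)" for x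
    using low by (intro bdd_belowI2[of _ "- \<rho> (- x)"]) auto
  have u_le: "u x \<le> p x" if "p \<in> C" for p x
    unfolding u_def by (rule cINF_lower[OF bdd that])
  have u_ge: "c \<le> u x" if "\<And>p. p \<in> C \<Longrightarrow> c \<le> p x" for c x
    unfolding u_def by (rule cINF_greatest) (use that assms(1) in auto)
  have "u (x + y) \<le> u x + u y" for x y
  proof -
    have "u (x + y) - q y \<le> u x" if q: "q \<in> C" for q
    proof (rule u_ge)
      fix p assume p: "p \<in> C"
      from chain[OF p q] obtain m where m: "m \<in> C" "m \<le> p" "m \<le> q" using p q by auto
      have "u (x + y) \<le> m (x + y)" by (rule u_le[OF m(1)])
      also have "\<dots> \<le> m x + m y" using C[OF m(1)] by (simp add: sublinear_def)
      also have "\<dots> \<le> p x + q y" using m by (auto simp: le_fun_def intro!: add_mono)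
      finally show "u (x + y) - q y \<le> p x" by simp
    qed
    then have "u (x + y) - u x \<le> u y" by (intro u_ge) (smt (verit))
    then show ?thesis by simp
  qed
  moreover have "u (a *\<^sub>R x) = a * u x" if a: "0 \<le> a" for a x
  proof (cases "a = 0")
    case True
    have "p 0 = 0" if "p \<in> C" for p using C[OF that] by (simp add: sublinear_0)
    then have "(\<lambda>p. p 0) ` C = (\<lambda>_. 0) ` C" by (intro image_cong) auto
    then have "(\<lambda>p. p 0) ` C = {0}" using assms(1) by (simp add: image_constant_conv)
    then have "u 0 = 0" unfolding u_def by simp
    then show ?thesis using True by simp
  next
    case False
    have half: "b * u z \<le> u (b *\<^sub>R z)" if b: "0 < b" for b z
    proof (rule u_ge)
      fix p assume p: "p \<in> C"
      have "b * u z \<le> b * p z" using b u_le[OF p] by simp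
      then show "b * u z \<le> p (b *\<^sub>R z)" using C[OF p] b by (simp add: sublinear_def)
    qed
    have "inverse a * u (a *\<^sub>R x) \<le> u x" using half[of "inverse a" "a *\<^sub>R x"] False a by simp
    then have "u (a *\<^sub>R x) \<le> a * u x" using False a by (simp add: field_simps)
    with half[of a x] show ?thesis using False a by simp
  qed
  ultimately have "sublinear u" by (simp add: sublinear_def)
  then show ?thesis using u_le by (auto simp: le_fun_def)
qed

text \<open>A minimal sublinear functional below \<open>\<rho>\<close> is linear, because it coincides with its
  reductions in all directions.\<close>

lemma Hahn_Banach_sublinear:
  assumes "sublinear \<rho>"
  shows "\<exists>f. linear f \<and> (\<forall>x. f x \<le> \<rho> x) \<and> f e = \<rho> e"
proof -
  \<comment> \<open>Reducing in the direction e beforehand forces f(-e) \<le> -\<rho>(e) for every f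
    below p0, so a linear f has the value \<rho>(e) at e.\<close>
  obtain p0 where p0: "sublinear p0" "p0 \<le> \<rho>" "p0 (- e) \<le> - \<rho> e"
    using sublinear_reduce[OF assms] by blast
  define A where "A = {p. sublinear p \<and> p \<le> p0}"
  have "\<exists>m\<in>A. \<forall>a\<in>A. m \<ge> a \<longrightarrow> a = m"
  proof (rule predicate_Zorn)
    show "partial_order_on A (relation_of (\<ge>) A)"
      by (rule partial_order_on_relation_ofI) auto
    fix C assume Ch: "C \<in> Chains (relation_of (\<ge>) A)"
    have CA: "sublinear p \<and> p \<le> p0" if "p \<in> C" for p
      using that Ch by (auto simp: Chains_def relation_of_def A_def)
    have chain: "p \<le> q \<or> q \<le> p" if "p \<in> C" "q \<in> C" for p q
      using that Ch by (auto simp: Chains_def relation_of_def)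
    show "\<exists>u\<in>A. \<forall>a\<in>C. a \<ge> u"
    proof (cases "C = {}")
      case True
      then show ?thesis using p0 by (auto simp: A_def)
    next
      case False
      then obtain u where u: "sublinear u" "\<And>p. p \<in> C \<Longrightarrow> u \<le> p"
        using sublinear_Inf_chain[of C p0, OF False CA chain] by blast
      have "u \<le> p0" using False u(2) CA by (meson ex_in_conv order_trans)
      then show ?thesis using u by (auto simp: A_def)
    qed
  qed
  then obtain f where f: "sublinear f" "f \<le> p0" and min: "\<And>q. sublinear q \<Longrightarrow> q \<le> f \<Longrightarrow> q = f"
    by (auto simp: A_def intro: order_trans)
  have neg: "f (- y) = - f y" for y
  proof -
    obtain q where "sublinear q" "q \<le> f" "q (- y) \<le> - f y" using sublinear_reduce[OF f(1)] by blast
    then have "f (- y) \<le> - f y" using min by blast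
    then show ?thesis using sublinear_minus[OF f(1), of y] by simp
  qed
  have add: "f (x + y) = f x + f y" for x y
  proof -
    have le: "f (x' + y') \<le> f x' + f y'" for x' y' using f(1) by (simp add: sublinear_def)
    show ?thesis using le[of x y] le[of "x + y" "- y"] neg[of y] by simp
  qed
  have "f (a *\<^sub>R x) = a * f x" for a x
  proof (cases "0 \<le> a")
    case False
    then have "f ((- a) *\<^sub>R x) = - a * f x" using f(1) unfolding sublinear_def by (metis neg_0_le_iff_le linear)
    then show ?thesis using neg[of "a *\<^sub>R x"] by simp
  qed (use f(1) in \<open>simp add: sublinear_def\<close>)
  with add have "linear f" by (intro linearI) auto
  moreover have le: "f x \<le> \<rho> x" for x using f(2) p0(2) by (meson le_funD order_trans)
  moreover have "f e = \<rho> e" using f(2) p0(3) neg[of e] le[of e] by (smt (verit) le_funD)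
  ultimately show ?thesis by blast
qed

text \<open>Over a general scalar field the functional is only shown to be norming up to a factor \<open>2\<close>;
  this avoids computing the norm of the scalar field on \<open>a + b i\<close>.\<close>

lemma (in normed_space_over) Hahn_Banach_seminorm:
  fixes \<rho> :: "'a \<Rightarrow> real"
  assumes add: "\<And>x y. \<rho> (x + y) \<le> \<rho> x + \<rho> y"
    and scale: "\<And>c x. \<rho> (smul c x) = norm c * \<rho> x"
    and bound: "\<And>x. \<rho> x \<le> M * norm x"
  shows "\<exists>\<phi>\<in>dual_space smul. (\<forall>x. norm (blinfun_apply \<phi> x) \<le> \<rho> x) \<and> \<rho> e \<le> 2 * norm (blinfun_apply \<phi> e)"
proof -
  have scaleR: "\<rho> (a *\<^sub>R x) = \<bar>a\<bar> * \<rho> x" for a x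
    using scale[of "of_real a" x] by (simp add: scale_of_real)
  have \<rho>_nonneg: "0 \<le> \<rho> x" for x
    using add[of x "- x"] scaleR[of 0 x] scaleR[of "-1" x] by simp
  have "sublinear \<rho>" using add scaleR by (simp add: sublinear_def)
  then obtain f where f: "linear f" "\<And>x. f x \<le> \<rho> x" "f e = \<rho> e"
    using Hahn_Banach_sublinear by blast
  have f_abs: "\<bar>f x\<bar> \<le> \<rho> x" for x
    using f(2)[of x] f(2)[of "- x"] scaleR[of "-1" x] linear_neg[OF f(1), of x] by simp
  have f_scale: "f (a *\<^sub>R x) = a * f x" for a x using f(1) by (simp add: linear_cmul)
  have f_add: "f (x + y) = f x + f y" for x y using f(1) by (simp add: linear_add)
  have smul_scaleR: "smul c (a *\<^sub>R x) = a *\<^sub>R smul c x" for c a x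
    by (metis scale_left_commute scale_of_real)
  have mk: "\<exists>\<phi>\<in>dual_space smul. blinfun_apply \<phi> = g"
    if g: "\<And>x y. g (x + y) = g x + g y" "\<And>c x. g (smul c x) = c * g x" "\<And>x. norm (g x) \<le> K * norm x" for g :: "'a \<Rightarrow> 'k" and K
  proof -
    have "bounded_linear g"
    proof (rule bounded_linear_intro[of _ K])
      fix a x show "g (a *\<^sub>R x) = a *\<^sub>R g x"
        using g(2)[of "of_real a" x] by (simp add: scale_of_real scaleR_conv_of_real)
    qed (use g in \<open>auto simp: mult.commute\<close>)
    then have "blinfun_apply (Blinfun g) = g" by (rule bounded_linear_Blinfun_apply)
    then show ?thesis using g(2) by (intro bexI[of _ "Blinfun g"]) (auto simp: dual_space_def)
  qed
  consider "\<forall>z::'k. \<exists>a. z = a *\<^sub>R 1"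
    | i :: 'k where "i * i = - 1" "\<forall>z::'k. \<exists>a b. z = a *\<^sub>R 1 + b *\<^sub>R i"
    using real_or_complex by blast
  then show ?thesis
  proof cases
    case 1
    define g where "g x = (of_real (f x) :: 'k)" for x
    have ng: "norm (g x) \<le> \<rho> x" for x using f_abs by (simp add: g_def)
    have "g (smul c x) = c * g x" for c x
    proof -
      obtain a where "c = of_real a" using 1 by (metis of_real_def)
      then show ?thesis by (simp add: g_def scale_of_real f_scale)
    qed
    then obtain \<phi> where "\<phi> \<in> dual_space smul" "blinfun_apply \<phi> = g"
      using mk[of g M] ng bound by (metis (no_types, lifting) f_add g_def of_real_add order_trans)
    moreover have "\<rho> e \<le> 2 * norm (g e)" using f(3) \<rho>_nonneg[of e] by (simp add: g_def)
    ultimately show ?thesis using ng by auto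
  next
    case (2 i)
    \<comment> \<open>The functional whose real part is f and which commutes with i.\<close>
    define g where "g x = of_real (f x) - i * of_real (f (smul i x))" for x
    have "norm i * norm i = 1" using 2(1) by (metis norm_minus_cancel norm_mult norm_one)
    then have norm_i: "norm i = 1" by (metis abs_norm_cancel real_sqrt_abs2 real_sqrt_one)
    have smul_ii: "smul i (smul i x) = - x" for x
      using scale_scale[of i i x] by (simp add: 2(1))
    have g_add: "g (x + y) = g x + g y" for x y
      by (simp add: g_def f_add scale_right_distrib algebra_simps)
    have g_real: "g (a *\<^sub>R x) = of_real a * g x" for a x
      by (simp add: g_def f_scale smul_scaleR algebra_simps)
    have g_i: "g (smul i x) = i * g x" for x
    proof -
      have "g (smul i x) = of_real (f (smul i x)) + i * of_real (f x)"
        using f_scale[of "-1" x] by (simp add: g_def smul_ii del: scale_scale)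
      also have "\<dots> = i * g x"
        using 2(1) by (simp add: g_def right_diff_distrib mult.assoc[symmetric])
      finally show ?thesis .
    qed
    have g_smul: "g (smul c x) = c * g x" for c x
    proof -
      obtain a b where c: "c = of_real a + of_real b * i"
        using 2(2) by (metis mult_scaleR_left mult_1 of_real_def)
      have "smul c x = a *\<^sub>R x + b *\<^sub>R smul i x"
        unfolding c scale_left_distrib by (simp add: scale_of_real scale_scale[symmetric] del: scale_scale)
      then show ?thesis by (simp add: g_add g_real g_i c algebra_simps)
    qed
    \<comment> \<open>Otherwise i would be a real multiple of 1, and a real square would equal
      -1.\<close>
    have real_eq: "t = u" if eq: "of_real t = of_real u - i * of_real v" for t u v :: real
    proof (cases "v = 0")
      case False
      then have "i = of_real ((u - t) / v)" using eq by (simp add: field_simps)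
      then have "of_real (((u - t) / v) * ((u - t) / v)) = (of_real (- 1) :: 'k)" using 2(1) by simp
      then have "((u - t) / v) * ((u - t) / v) = - 1" unfolding of_real_eq_iff .
      then show ?thesis using zero_le_square[of "(u - t) / v"] by linarith
    qed (use eq in simp)
    have ng: "norm (g x) \<le> \<rho> x" for x
    proof (cases "g x = 0")
      case False
      \<comment> \<open>A scalar of norm 1 that rotates g x onto the nonnegative reals; there g
        coincides with f, and f is bounded by \<rho>.\<close>
      define c where "c = of_real (norm (g x)) / g x"
      have nc: "norm c = 1" using False by (simp add: c_def norm_divide)
      have "g (smul c x) = of_real (norm (g x))" using False by (simp add: g_smul c_def)
      then have "norm (g x) = f (smul c x)" unfolding g_def[of "smul c x"] by (metis real_eq)
      also have "\<dots> \<le> \<rho> x" using f(2)[of "smul c x"] scale[of c x] nc by simp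
      finally show ?thesis .
    qed (simp add: \<rho>_nonneg)
    obtain \<phi> where \<phi>: "\<phi> \<in> dual_space smul" "blinfun_apply \<phi> = g"
      using mk[of g M, OF g_add g_smul] ng bound order_trans by blast
    have "\<rho> e \<le> 2 * norm (g e)"
    proof (cases "\<rho> e = 0")
      case False
      define \<tau> where "\<tau> = f (smul i e) / \<rho> e"
      have \<rho>e: "0 < \<rho> e" using False \<rho>_nonneg[of e] by simp
      have "\<bar>f (smul i e)\<bar> \<le> \<rho> e" using f_abs[of "smul i e"] scale[of i e] norm_i by simp
      then have \<tau>: "\<bar>\<tau>\<bar> \<le> 1" using \<rho>e by (simp add: \<tau>_def abs_divide)
      have ge: "g e = of_real (\<rho> e) * (1 - i * of_real \<tau>)"
        using \<rho>e f(3) by (simp add: g_def \<tau>_def right_diff_distrib)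
      \<comment> \<open>The product is at least 1, and the second factor has norm at most 2. So the
        first has norm at least 1/2, which is the origin of the factor 2.\<close>
      have "(1 - i * of_real \<tau>) * (1 + i * of_real \<tau>) = of_real (1 + \<tau> * \<tau>)"
      proof -
        have "(1 - i * of_real \<tau>) * (1 + i * of_real \<tau>) = 1 - (i * i) * (of_real \<tau> * of_real \<tau>)"
          by (simp add: algebra_simps)
        then show ?thesis using 2(1) by simp
      qed
      then have "norm (1 - i * of_real \<tau>) * norm (1 + i * of_real \<tau>) = norm (of_real (1 + \<tau> * \<tau>) :: 'k)"
        by (metis norm_mult)
      also have "\<dots> = 1 + \<tau> * \<tau>" unfolding norm_of_real by (simp add: abs_of_nonneg)
      finally have prod: "norm (1 - i * of_real \<tau>) * norm (1 + i * of_real \<tau>) = 1 + \<tau> * \<tau>" .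
      have "norm (1 + i * of_real \<tau>) \<le> norm (1::'k) + norm (i * of_real \<tau>)" by (rule norm_triangle_ineq)
      then have "norm (1 + i * of_real \<tau>) \<le> 2" using \<tau> norm_i by (simp add: norm_mult)
      then have "1 + \<tau> * \<tau> \<le> norm (1 - i * of_real \<tau>) * 2"
        unfolding prod[symmetric] by (rule mult_left_mono) simp
      then have "1 \<le> 2 * norm (1 - i * of_real \<tau>)" using zero_le_square[of \<tau>] by linarith
      then have "\<rho> e * 1 \<le> \<rho> e * (2 * norm (1 - i * of_real \<tau>))" by (rule mult_left_mono) (rule \<rho>_nonneg)
      then show ?thesis using \<rho>e by (simp add: ge norm_mult)
    qed simp
    with \<phi> ng show ?thesis by auto
  qed
qed

section \<open>The weight condition on large subsets of a cube\<close>

definition wint :: "(real ^ 'n \<Rightarrow> 'b::real_normed_vector \<Rightarrow>\<^sub>L 'b) \<Rightarrow> real \<Rightarrow> 'b \<Rightarrow> (real ^ 'n) set \<Rightarrow> ennreal" where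
  "wint V r e E = (\<integral>\<^sup>+x\<in>E. ennreal (norm (blinfun_apply (V x) e) powr r) \<partial>lebesgue)"

lemma epowr_rho: "0 < r \<Longrightarrow> epowr (rho V r Q e) r = wint V r e Q / emeasure lebesgue Q"
  by (simp add: rho_def wint_def epowr_epowr)

lemma rho_eq_epowr: "rho V r Q e = epowr (wint V r e Q / emeasure lebesgue Q) (1 / r)"
  by (simp add: rho_def wint_def)

lemma strongly_measurable_norm:
  assumes "strongly_measurable E f"
  shows "(\<lambda>x. norm (f x)) \<in> borel_measurable lebesgue"
proof -
  obtain F where F: "\<And>i. simple_function lebesgue (F i)" "\<And>x. (\<lambda>i. F i x) \<longlonglongrightarrow> f x"
    using assms by (auto simp: strongly_measurable_def)
  show ?thesis
  proof (rule borel_measurable_LIMSEQ_real)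
    show "(\<lambda>i. norm (F i x)) \<longlonglongrightarrow> norm (f x)" for x by (intro tendsto_norm F)
    show "(\<lambda>x. norm (F i x)) \<in> borel_measurable lebesgue" for i
      by (rule borel_measurable_simple_function) (rule simple_function_compose1[OF F(1)])
  qed
qed

lemma weight_norm_measurable:
  assumes "weight smul E V" "e \<in> E"
  shows "(\<lambda>x. norm (blinfun_apply (V x) e)) \<in> borel_measurable lebesgue"
  using assms by (intro strongly_measurable_norm[of E]) (simp add: weight_def)

lemma weight_powr_measurable:
  assumes "weight smul E V" "e \<in> E"
  shows "(\<lambda>x. ennreal (norm (blinfun_apply (V x) e) powr r)) \<in> borel_measurable lebesgue"
  using weight_norm_measurable[OF assms] by measurable

lemma wint_lsc:
  assumes V: "weight smul UNIV V" and r: "0 < r" and [measurable]: "E \<in> sets lebesgue"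
    and lim: "u \<longlonglongrightarrow> e" and le: "\<And>m. wint V r (u m) E \<le> c"
  shows "wint V r e E \<le> c"
proof -
  have [measurable]: "(\<lambda>x. ennreal (norm (blinfun_apply (V x) d) powr r)) \<in> borel_measurable lebesgue" for d
    by (rule weight_powr_measurable[OF V]) simp
  have "(\<lambda>m. norm (blinfun_apply (V x) (u m)) powr r) \<longlonglongrightarrow> norm (blinfun_apply (V x) e) powr r" for x
    using r by (intro tendsto_powr2 tendsto_norm blinfun.tendsto lim tendsto_const) auto
  then have l: "(\<lambda>m. ennreal (norm (blinfun_apply (V x) (u m)) powr r) * indicator E x)
      \<longlonglongrightarrow> ennreal (norm (blinfun_apply (V x) e) powr r) * indicator E x" for x
    by (cases "x \<in> E") auto
  have "wint V r e E = (\<integral>\<^sup>+x. liminf (\<lambda>m. ennreal (norm (blinfun_apply (V x) (u m)) powr r) * indicator E x) \<partial>lebesgue)"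
    unfolding wint_def by (intro nn_integral_cong) (simp add: lim_imp_Liminf[OF _ l])
  also have "\<dots> \<le> liminf (\<lambda>m. wint V r (u m) E)"
    unfolding wint_def by (rule nn_integral_liminf) simp
  also have "\<dots> \<le> liminf (\<lambda>m. c)" by (intro Liminf_mono) (simp add: le)
  finally show ?thesis by (simp add: Liminf_const)
qed

lemma rho_le_iff:
  assumes "0 < r" "emeasure lebesgue Q \<noteq> 0" "emeasure lebesgue Q \<noteq> top"
  shows "rho V r Q e \<le> c \<longleftrightarrow> wint V r e Q \<le> epowr c r * emeasure lebesgue Q"
proof -
  let ?v = "emeasure lebesgue Q"
  have "rho V r Q e \<le> c \<longleftrightarrow> wint V r e Q / ?v \<le> epowr c r"
    using assms(1) by (simp add: rho_eq_epowr epowr_le_swap)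
  also have "\<dots> \<longleftrightarrow> wint V r e Q \<le> epowr c r * ?v"
  proof
    assume "wint V r e Q / ?v \<le> epowr c r"
    then have "wint V r e Q / ?v * ?v \<le> epowr c r * ?v" by (rule mult_right_mono) simp
    then show "wint V r e Q \<le> epowr c r * ?v" by (simp add: ennreal_divide_times assms)
  next
    assume "wint V r e Q \<le> epowr c r * ?v"
    then have "wint V r e Q / ?v \<le> epowr c r * ?v / ?v" by (rule divide_right_mono_ennreal)
    then show "wint V r e Q / ?v \<le> epowr c r"
      by (simp add: divide_ennreal_def mult.assoc ennreal_cancel assms)
  qed
  finally show ?thesis .
qed

lemma rho_lsc:
  assumes V: "weight smul UNIV V" and r: "0 < r" and Q: "Q \<in> sets lebesgue" "emeasure lebesgue Q \<noteq> 0" "emeasure lebesgue Q \<noteq> top"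
    and lim: "u \<longlonglongrightarrow> e" and le: "\<And>m. rho V r Q (u m) \<le> c"
  shows "rho V r Q e \<le> c"
  using le wint_lsc[OF V r Q(1) lim] unfolding rho_le_iff[OF r Q(2,3)] by blast

lemma rho_lsc_le:
  assumes V: "weight smul UNIV V" and r: "0 < r" and Q: "Q \<in> sets lebesgue" "emeasure lebesgue Q \<noteq> 0" "emeasure lebesgue Q \<noteq> top"
    and lim: "u \<longlonglongrightarrow> e" and le: "\<And>m. rho V r Q (u m) \<le> ennreal (b m)" and b: "b \<longlonglongrightarrow> c"
  shows "rho V r Q e \<le> ennreal c"
proof (rule ennreal_le_epsilon)
  fix \<epsilon> :: real assume \<epsilon>: "0 < \<epsilon>"
  obtain N where N: "\<And>m. N \<le> m \<Longrightarrow> b m < c + \<epsilon>"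
    using order_tendstoD(2)[OF b, of "c + \<epsilon>"] \<epsilon> by (auto simp: eventually_sequentially)
  show "rho V r Q e \<le> ennreal c + ennreal \<epsilon>"
  proof (rule rho_lsc[OF V r Q])
    show "(\<lambda>m. u (m + N)) \<longlonglongrightarrow> e" by (rule LIMSEQ_ignore_initial_segment[OF lim])
    fix m
    have "rho V r Q (u (m + N)) \<le> ennreal (c + \<epsilon>)"
      using le[of "m + N"] N[of "m + N"] by (meson ennreal_leI le_add2 less_imp_le order_trans)
    also have "\<dots> \<le> ennreal c + ennreal \<epsilon>"
    proof (cases "0 \<le> c")
      case False
      then show ?thesis using \<epsilon> by (simp add: ennreal_neg ennreal_leI)
    qed (use \<epsilon> in simp)
    finally show "rho V r Q (u (m + N)) \<le> ennreal c + ennreal \<epsilon>" .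
  qed
qed

lemma p_weightD:
  assumes "p_weight smul UNIV r V"
  shows "weight smul UNIV V" "0 < l \<Longrightarrow> wint V r e (cube a l) < top"
  using assms by (auto simp: p_weight_def wint_def)

lemma wint_dcube_less_top: "p_weight smul UNIV r V \<Longrightarrow> wint V r e (dcube Q) < top"
  by (simp add: dcube_def p_weightD(2))

lemma is_inverse_op_inverse:
  "invertible_op smul E T \<Longrightarrow> is_inverse_op smul E T (inverse_op smul E T)"
  unfolding inverse_op_def invertible_op_def by (simp add: someI_ex)

section \<open>Inverses, adjoints and the seminorms given by averages\<close>

lemma adjoint_op_apply:
  fixes \<phi> :: "'a::real_normed_vector \<Rightarrow>\<^sub>L 'k::real_or_complex"
  shows "blinfun_apply (adjoint_op T) \<phi> = \<phi> o\<^sub>L T"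
proof -
  have "bounded_linear (\<lambda>\<phi> :: 'a \<Rightarrow>\<^sub>L 'k. \<phi> o\<^sub>L T)"
    by (rule bounded_bilinear.bounded_linear_left[OF bounded_bilinear_blinfun_compose])
  then show ?thesis by (simp add: adjoint_op_def bounded_linear_Blinfun_apply)
qed

lemma norm_apply_le_inverse_adjoint:
  fixes V :: "'x \<Rightarrow> 'a::real_normed_vector \<Rightarrow>\<^sub>L 'a"
  assumes "invertible_op smul UNIV (V x)"
  shows "norm (blinfun_apply \<phi> e) \<le>
    norm (blinfun_apply (inverse_adjoint smul V x) \<phi>) * norm (blinfun_apply (V x) e)"
proof -
  let ?S = "inverse_op smul UNIV (V x)"
  have "blinfun_apply ?S (blinfun_apply (V x) e) = e"
    using is_inverse_op_inverse[OF assms] by (simp add: is_inverse_op_def)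
  then have "blinfun_apply \<phi> e = blinfun_apply (\<phi> o\<^sub>L ?S) (blinfun_apply (V x) e)" by simp
  also have "norm \<dots> \<le> norm (\<phi> o\<^sub>L ?S) * norm (blinfun_apply (V x) e)" by (rule norm_blinfun)
  finally show ?thesis by (simp add: inverse_adjoint_def adjoint_op_apply)
qed

context
  fixes smul :: "'k::real_or_complex \<Rightarrow> 'a::banach \<Rightarrow> 'a" and V :: "real ^ 'n \<Rightarrow> 'a \<Rightarrow>\<^sub>L 'a"
  assumes smul: "normed_space_over smul"
begin

interpretation normed_space_over smul by (rule smul)

lemma rho_smul:
  assumes "p_weight smul UNIV r V" "0 < r" and [measurable]: "Q \<in> sets lebesgue"
  shows "rho V r Q (smul c e) = ennreal (norm c) * rho V r Q e"
proof -
  note [measurable] = weight_powr_measurable[OF p_weightD(1)[OF assms(1)] UNIV_I]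
  have "norm (blinfun_apply (V x) (smul c e)) = norm c * norm (blinfun_apply (V x) e)" for x
    using p_weightD(1)[OF assms(1)] by (simp add: weight_def operators_def norm_scale)
  then have "rho V r Q (smul c e) = epowr ((\<integral>\<^sup>+x. ennreal (norm c powr r) *
      (ennreal (norm (blinfun_apply (V x) e) powr r) * indicator Q x) \<partial>lebesgue) / emeasure lebesgue Q) (1 / r)"
    unfolding rho_def by (simp add: powr_mult ennreal_mult mult.assoc)
  also have "\<dots> = epowr (epowr (ennreal (norm c)) r * (wint V r e Q / emeasure lebesgue Q)) (1 / r)"
    by (simp add: nn_integral_cmult wint_def divide_ennreal_def mult.assoc epowr_ennreal)
  also have "\<dots> = ennreal (norm c) * rho V r Q e"
    using assms(2) by (simp add: epowr_mult epowr_epowr rho_eq_epowr)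
  finally show ?thesis .
qed

text \<open>Minkowski's inequality for mixed norms, with the two summands indexed by
  \<open>bool\<close> and a one-point index set for the components.\<close>

lemma rho_triangle:
  assumes V: "p_weight smul UNIV r V" and r: "1 < r" and [measurable]: "Q \<in> sets lebesgue"
  shows "rho V r Q (e + e') \<le> rho V r Q e + rho V r Q e'"
proof -
  note weight_norm_measurable[OF p_weightD(1)[OF V] UNIV_I, measurable]
  let ?g = "\<lambda>d x. ennreal (norm (blinfun_apply (V x) d)) * indicator Q x"
  have N: "rho V r Q d = epowr (inverse (emeasure lebesgue Q)) (1 / r) * mix lebesgue r r (\<lambda>_::unit. ?g d)" for d
  proof -
    have "wint V r d Q = (\<integral>\<^sup>+x. epowr (?g d x) r \<partial>lebesgue)"
      unfolding wint_def by (intro nn_integral_cong) (simp add: epowr_mult epowr_ennreal indicator_def)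
    then show ?thesis using r
      by (simp add: rho_eq_epowr mix_unit divide_ennreal_def epowr_mult mult.commute)
  qed
  have two: "csum (\<lambda>l::bool. h l) = h True + h False" for h :: "bool \<Rightarrow> ennreal"
    by (simp add: nn_integral_count_space_finite UNIV_bool)
  have "mix lebesgue r r (\<lambda>_::unit. ?g (e + e'))
      \<le> mix lebesgue r r (\<lambda>(_::unit) x. csum (\<lambda>l::bool. ?g (if l then e else e') x))"
    using r by (intro mix_mono)
      (auto simp: two blinfun.add_right norm_triangle_ineq distrib_right[symmetric] ennreal_plus[symmetric]
        simp del: ennreal_plus intro!: mult_right_mono ennreal_leI)
  also have "\<dots> \<le> csum (\<lambda>l::bool. mix lebesgue r r (\<lambda>_::unit. ?g (if l then e else e')))"
    by (rule mix_csum_le[OF sigma_finite_lebesgue r r, where g = "\<lambda>(l::bool) (_::unit). ?g (if l then e else e')"]) simp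
  also have "\<dots> = mix lebesgue r r (\<lambda>_::unit. ?g e) + mix lebesgue r r (\<lambda>_::unit. ?g e')"
    by (simp add: two)
  finally show ?thesis unfolding N distrib_left[symmetric] by (rule mult_left_mono) simp
qed

lemma rho_finite: "p_weight smul UNIV r V \<Longrightarrow> 0 < r \<Longrightarrow> rho V r (dcube Q) e < top"
  by (simp add: rho_eq_epowr wint_dcube_less_top divide_ennreal_def ennreal_mult_less_top
    emeasure_dcube_dvol inverse_ennreal less_top)

text \<open>By Baire's theorem, the finite lower semicontinuous seminorm \<open>\<rho>\<close> is continuous.\<close>

lemma rho_bounded:
  assumes V: "p_weight smul UNIV r V" and r: "1 < r"
  shows "\<exists>M. \<forall>e. enn2real (rho V r (dcube Q) e) \<le> M * norm e"
proof -
  let ?\<rho> = "\<lambda>e. enn2real (rho V r (dcube Q) e)"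
  have fin: "rho V r (dcube Q) e < top" for e using rho_finite[OF V] r by simp
  have conv: "rho V r (dcube Q) e \<le> ennreal c \<longleftrightarrow> ?\<rho> e \<le> c" if "0 \<le> c" for e c
    using fin[of e] that by (metis enn2real_leI ennreal_enn2real ennreal_leI less_le)
  define S where "S m = {e. rho V r (dcube Q) e \<le> ennreal (real m)}" for m :: nat
  have closed: "closed (S m)" for m
    unfolding closed_sequential_limits S_def
    using rho_lsc[OF p_weightD(1)[OF V], of r "dcube Q"] r by fastforce
  have "\<exists>m. e \<in> S m" for e
    using real_arch_simple[of "?\<rho> e"] by (auto simp: S_def conv)
  then have "(\<Union>m. S m) = UNIV" by auto
  have "\<exists>m. interior (S m) \<noteq> {}"
  proof (rule ccontr)
    assume "\<not> ?thesis"
    then have "euclidean interior_of \<Union>(range S) = {}"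
      using closed by (intro Baire_category_alt)
        (auto simp: completely_metrizable_space_euclidean simp flip: closed_closedin)
    then show False using \<open>(\<Union>m. S m) = UNIV\<close> by simp
  qed
  then obtain m x0 where "x0 \<in> interior (S m)" by blast
  then obtain d where d: "0 < d" "cball x0 d \<subseteq> S m"
    by (meson open_contains_cball open_interior interior_subset order_trans)
  have sc: "?\<rho> (a *\<^sub>R e) = \<bar>a\<bar> * ?\<rho> e" for a e
    using rho_smul[OF V, of "dcube Q" "of_real a" e] r by (simp add: scale_of_real enn2real_mult)
  have tri: "?\<rho> (e + e') \<le> ?\<rho> e + ?\<rho> e'" for e e'
  proof -
    have eq: "rho V r (dcube Q) d = ennreal (?\<rho> d)" for d using fin by (simp add: ennreal_enn2real)
    have "rho V r (dcube Q) (e + e') \<le> ennreal (?\<rho> e) + ennreal (?\<rho> e')"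
      unfolding eq[symmetric] by (rule rho_triangle[OF V r]) simp
    then have "rho V r (dcube Q) (e + e') \<le> ennreal (?\<rho> e + ?\<rho> e')" by simp
    moreover have "0 \<le> ?\<rho> e + ?\<rho> e'" by simp
    ultimately show ?thesis using conv by blast
  qed
  have small: "?\<rho> v \<le> 2 * m" if "norm v \<le> d" for v
  proof -
    have "x0 + v \<in> S m" "x0 \<in> S m" using d that by (auto simp: dist_norm subset_iff)
    then have "?\<rho> (x0 + v) \<le> m" "?\<rho> x0 \<le> m" by (auto simp: S_def conv)
    moreover have "?\<rho> (- x0) = ?\<rho> x0" using sc[of "-1" x0] by simp
    ultimately show ?thesis using tri[of "x0 + v" "- x0"] by simp
  qed
  have "?\<rho> e \<le> (2 * m / d) * norm e" for e
  proof (cases "e = 0")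
    case True
    then show ?thesis using sc[of 0 e] by simp
  next
    case False
    have "?\<rho> ((d / norm e) *\<^sub>R e) \<le> 2 * m" using False d by (intro small) simp
    then have "(d / norm e) * ?\<rho> e \<le> 2 * m" using d by (simp add: sc)
    then show ?thesis using False d by (simp add: field_simps)
  qed
  then show ?thesis by blast
qed

lemma Ap_lower_large:
  assumes Ap: "Ap_weight smul r V" and r: "1 < r"
  shows "\<exists>K\<ge>1. \<forall>Q e E. E \<in> sets lebesgue \<longrightarrow> E \<subseteq> dcube Q \<longrightarrow>
    emeasure lebesgue (dcube Q) \<le> 2 * emeasure lebesgue E \<longrightarrow> wint V r e (dcube Q) \<le> ennreal K * wint V r e E"
proof -
  define r' where "r' = r / (r - 1)"
  have r': "1 < r'" "1 / r + 1 / r' = 1" using conjugate_exponent[OF r] by (auto simp: r'_def)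
  have V: "p_weight smul UNIV r V" using Ap by (simp add: Ap_weight_def)
  let ?W = "inverse_adjoint smul V"
  have W: "p_weight dual_scale (dual_space smul) r' ?W" using Ap r by (simp add: Ap_weight_def r'_def)
  obtain C0 :: real where C0: "\<And>a l \<phi>. 0 < l \<Longrightarrow> \<phi> \<in> dual_space smul \<Longrightarrow>
      rho ?W r' (cube a l) \<phi> \<le> ennreal C0 * rho_star (rho V r (cube a l)) \<phi>"
    using Ap r by (auto simp: Ap_weight_def r'_def)
  define C where "C = max C0 1"
  \<comment> \<open>One factor 2 is the loss in norming e, the other is |Q| \<le> 2 |E|.\<close>
  define K where "K = (4 * C) powr r"
  have "1 \<le> K" unfolding K_def C_def using r by (intro ge_one_powr_ge_zero) auto
  moreover have "wint V r e (dcube Q) \<le> ennreal K * wint V r e E"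
    if E [measurable]: "E \<in> sets lebesgue" "E \<subseteq> dcube Q" and large: "emeasure lebesgue (dcube Q) \<le> 2 * emeasure lebesgue E"
    for Q e E
  proof -
    let ?v = "emeasure lebesgue (dcube Q)"
    let ?\<rho> = "\<lambda>e. enn2real (rho V r (dcube Q) e)"
    have fin: "rho V r (dcube Q) e < top" for e using rho_finite[OF V] r by simp
    then have real: "rho V r (dcube Q) e = ennreal (?\<rho> e)" for e by (simp add: ennreal_enn2real)
    obtain M where M: "\<And>e. ?\<rho> e \<le> M * norm e" using rho_bounded[OF V r] by blast
    have "\<exists>\<phi>\<in>dual_space smul. (\<forall>x. norm (blinfun_apply \<phi> x) \<le> ?\<rho> x) \<and> ?\<rho> e \<le> 2 * norm (blinfun_apply \<phi> e)"
    proof (rule Hahn_Banach_seminorm[OF _ _ M])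
      fix x y :: 'a and c :: 'k
      have "ennreal (?\<rho> (x + y)) \<le> ennreal (?\<rho> x + ?\<rho> y)"
        using rho_triangle[OF V r, of "dcube Q" x y] by (simp add: real[symmetric])
      then show "?\<rho> (x + y) \<le> ?\<rho> x + ?\<rho> y" by (subst (asm) ennreal_le_iff) auto
      show "?\<rho> (smul c x) = norm c * ?\<rho> x"
        using rho_smul[OF V, of "dcube Q" c x] r by (simp add: enn2real_mult)
    qed
    then obtain \<phi> where \<phi>: "\<phi> \<in> dual_space smul" "\<And>x. norm (blinfun_apply \<phi> x) \<le> ?\<rho> x"
      "?\<rho> e \<le> 2 * norm (blinfun_apply \<phi> e)" by blast
    have star: "rho_star (rho V r (dcube Q)) \<phi> \<le> 1"
      unfolding rho_star_def
    proof (rule SUP_least)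
      fix d :: 'a
      show "ennreal (norm (blinfun_apply \<phi> d)) / rho V r (dcube Q) d \<le> 1"
      proof (cases "?\<rho> d = 0")
        case True
        then show ?thesis using \<phi>(2)[of d] by simp
      next
        case False
        then have pos: "0 < ?\<rho> d" using enn2real_nonneg[of "rho V r (dcube Q) d"] by linarith
        have "ennreal (norm (blinfun_apply \<phi> d)) / ennreal (?\<rho> d) \<le> 1"
          using \<phi>(2)[of d] pos by (subst divide_ennreal) auto
        then show ?thesis by (simp only: real[of d, symmetric])
      qed
    qed
    define A where "A = wint ?W r' \<phi> (dcube Q)"
    have "rho ?W r' (dcube Q) \<phi> \<le> ennreal C0 * rho_star (rho V r (dcube Q)) \<phi>"
      unfolding dcube_def by (rule C0) (use \<phi> in auto)
    also have "\<dots> \<le> ennreal C * 1" using star by (intro mult_mono) (auto simp: C_def intro: ennreal_leI)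
    finally have "A \<le> epowr (ennreal C) r' * ?v"
      unfolding A_def using r' by (simp add: rho_le_iff)
    then have "epowr A (1 / r') \<le> epowr (epowr (ennreal C) r' * ?v) (1 / r')" using r' by (intro epowr_mono) auto
    then have A: "epowr A (1 / r') \<le> ennreal C * epowr ?v (1 / r')" using r' by (simp add: epowr_mult epowr_epowr)
    note [measurable] = weight_norm_measurable[OF p_weightD(1)[OF V] UNIV_I]
    have [measurable]: "(\<lambda>x. norm (blinfun_apply (?W x) \<phi>)) \<in> borel_measurable lebesgue"
      by (rule weight_norm_measurable[of dual_scale "dual_space smul"]) (use W \<phi> in \<open>auto simp: p_weight_def\<close>)
    have "ennreal (norm (blinfun_apply \<phi> e)) * emeasure lebesgue E
        = (\<integral>\<^sup>+x. ennreal (norm (blinfun_apply \<phi> e)) * indicator E x \<partial>lebesgue)"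
      by (simp add: nn_integral_cmult_indicator)
    also have "\<dots> \<le> (\<integral>\<^sup>+x. (ennreal (norm (blinfun_apply (V x) e)) * indicator E x)
        * (ennreal (norm (blinfun_apply (?W x) \<phi>)) * indicator (dcube Q) x) \<partial>lebesgue)"
    proof (rule nn_integral_mono_AE)
      have "AE x in lebesgue. invertible_op smul UNIV (V x)"
        using p_weightD(1)[OF V] by (simp add: weight_def)
      then show "AE x in lebesgue. ennreal (norm (blinfun_apply \<phi> e)) * indicator E x
        \<le> (ennreal (norm (blinfun_apply (V x) e)) * indicator E x)
        * (ennreal (norm (blinfun_apply (?W x) \<phi>)) * indicator (dcube Q) x)"
      proof (rule AE_mp, intro AE_I2 impI)
        fix x assume "invertible_op smul UNIV (V x)"
        note le = norm_apply_le_inverse_adjoint[of smul V x \<phi> e, OF this]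
        show "ennreal (norm (blinfun_apply \<phi> e)) * indicator E x
        \<le> (ennreal (norm (blinfun_apply (V x) e)) * indicator E x)
        * (ennreal (norm (blinfun_apply (?W x) \<phi>)) * indicator (dcube Q) x)"
        proof (cases "x \<in> E")
          case True
          with E(2) have "x \<in> dcube Q" by blast
          with True show ?thesis using le
            by (simp add: ennreal_mult[symmetric] mult.commute[of "norm (blinfun_apply (V x) e)"] ennreal_leI)
        qed simp
      qed
    qed
    also have "\<dots> \<le> epowr (wint V r e E) (1 / r) * epowr A (1 / r')"
    proof -
      have "(\<integral>\<^sup>+x. epowr (ennreal (norm (blinfun_apply (V x) e)) * indicator E x) r \<partial>lebesgue) = wint V r e E"
        "(\<integral>\<^sup>+x. epowr (ennreal (norm (blinfun_apply (?W x) \<phi>)) * indicator (dcube Q) x) r' \<partial>lebesgue) = A"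
        unfolding wint_def A_def by (intro nn_integral_cong; simp add: epowr_ennreal indicator_def)+
      then show ?thesis
        using Hoelder_nn_integral[OF r r', of "\<lambda>x. ennreal (norm (blinfun_apply (V x) e)) * indicator E x" lebesgue
          "\<lambda>x. ennreal (norm (blinfun_apply (?W x) \<phi>)) * indicator (dcube Q) x"] by simp
    qed
    also have "\<dots> \<le> epowr (wint V r e E) (1 / r) * (ennreal C * epowr ?v (1 / r'))"
      by (rule mult_left_mono[OF A]) simp
    finally have main: "ennreal (norm (blinfun_apply \<phi> e)) * emeasure lebesgue E
      \<le> epowr (wint V r e E) (1 / r) * (ennreal C * epowr ?v (1 / r'))" .
    have "rho V r (dcube Q) e \<le> ennreal (2 * norm (blinfun_apply \<phi> e))"
      by (subst real) (intro ennreal_leI \<phi>(3))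
    then have "rho V r (dcube Q) e * ?v \<le> ennreal (2 * norm (blinfun_apply \<phi> e)) * (2 * emeasure lebesgue E)"
      using large by (intro mult_mono) auto
    also have "\<dots> = 4 * (ennreal (norm (blinfun_apply \<phi> e)) * emeasure lebesgue E)"
    proof -
      have "(2 * a) * (2 * b) = 4 * (a * b)" for a b :: ennreal
      proof -
        have "(2 * a) * (2 * b) = (2 * 2) * (a * b)" by (simp only: ac_simps)
        then show ?thesis by simp
      qed
      then show ?thesis by (simp add: ennreal_mult)
    qed
    also have "\<dots> \<le> 4 * (epowr (wint V r e E) (1 / r) * (ennreal C * epowr ?v (1 / r')))"
      by (rule mult_left_mono[OF main]) simp
    finally have le: "rho V r (dcube Q) e * ?v \<le> 4 * (epowr (wint V r e E) (1 / r) * (ennreal C * epowr ?v (1 / r')))" .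
    have "rho V r (dcube Q) e * ?v = epowr (wint V r e (dcube Q)) (1 / r) * epowr ?v (1 / r')"
    proof -
      have "?v = epowr ?v (1 / r) * epowr ?v (1 / r')" using r' by (simp add: epowr_add)
      then have "rho V r (dcube Q) e * ?v
          = epowr (wint V r e (dcube Q)) (1 / r) * (epowr (inverse ?v) (1 / r) * epowr ?v (1 / r)) * epowr ?v (1 / r')"
        by (simp add: rho_eq_epowr divide_ennreal_def epowr_mult mult.assoc)
      moreover have "epowr (inverse ?v) (1 / r) * epowr ?v (1 / r) = 1"
        by (simp add: epowr_mult[symmetric] mult.commute[of "inverse ?v"] ennreal_cancel)
      ultimately show ?thesis by simp
    qed
    with le have "epowr (wint V r e (dcube Q)) (1 / r) * epowr ?v (1 / r')
        \<le> 4 * (epowr (wint V r e E) (1 / r) * (ennreal C * epowr ?v (1 / r')))" by simp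
    then have "epowr ?v (1 / r') * epowr (wint V r e (dcube Q)) (1 / r)
        \<le> epowr ?v (1 / r') * (4 * ennreal C * epowr (wint V r e E) (1 / r))"
      by (simp only: ac_simps)
    then have "epowr (wint V r e (dcube Q)) (1 / r) \<le> 4 * ennreal C * epowr (wint V r e E) (1 / r)"
      by (simp add: ennreal_mult_le_mult_iff)
    also have "4 * ennreal C = ennreal (4 * C)" by (simp add: ennreal_mult C_def)
    also have "ennreal (4 * C) * epowr (wint V r e E) (1 / r) = epowr (ennreal K * wint V r e E) (1 / r)"
      using r by (simp add: epowr_mult epowr_ennreal K_def powr_powr C_def)
    finally show ?thesis using r by (simp add: epowr_le_iff)
  qed
  ultimately show ?thesis by blast
qed

text \<open>The condition with the vector V(y) e in place of e would read \<rho>(e) \<le> C |V(y) e|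
  for almost all y in Q, and integration over E finishes the proof. That vector depends on y, while
  the exceptional null set depends on the vector. So V(y) e is approximated by values of simple
  functions, and lower semicontinuity of \<rho> passes to the limit.\<close>

lemma Ap_lower_small:
  assumes Ap: "Ap_weight smul r V" and r: "0 < r" "r \<le> 1"
  shows "\<exists>K\<ge>1. \<forall>Q e E. E \<in> sets lebesgue \<longrightarrow> E \<subseteq> dcube Q \<longrightarrow>
    emeasure lebesgue (dcube Q) \<le> 2 * emeasure lebesgue E \<longrightarrow> wint V r e (dcube Q) \<le> ennreal K * wint V r e E"
proof -
  have V: "p_weight smul UNIV r V" using Ap by (simp add: Ap_weight_def)
  have W: "weight smul UNIV V" by (rule p_weightD(1)[OF V])
  let ?S = "\<lambda>y. inverse_op smul UNIV (V y)"
  obtain C0 :: real where C0: "\<And>a l e. 0 < l \<Longrightarrow>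
      esssup (restrict_space lebesgue (cube a l)) (\<lambda>y. rho V r (cube a l) (blinfun_apply (?S y) e)) \<le> ennreal (C0 * norm e)"
    using Ap r by (auto simp: Ap_weight_def)
  define C where "C = max C0 1"
  define K where "K = max 1 (2 * C powr r)"
  have "1 \<le> K" by (simp add: K_def)
  moreover have "wint V r e (dcube Q) \<le> ennreal K * wint V r e E"
    if E [measurable]: "E \<in> sets lebesgue" "E \<subseteq> dcube Q" and large: "emeasure lebesgue (dcube Q) \<le> 2 * emeasure lebesgue E"
    for Q e E
  proof -
    let ?v = "emeasure lebesgue (dcube Q)"
    have "strongly_measurable UNIV (\<lambda>x. blinfun_apply (V x) e)" using W by (simp add: weight_def)
    then obtain F where F: "\<And>i. simple_function lebesgue (F i)" "\<And>x. (\<lambda>i. F i x) \<longlonglongrightarrow> blinfun_apply (V x) e"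
      unfolding strongly_measurable_def by blast
    \<comment> \<open>Only countably many vectors occur as values of the approximating simple
      functions, hence one null set serves them all.\<close>
    define D where "D = (\<Union>i::nat. range (F i))"
    have "countable D"
      unfolding D_def using F(1) by (auto simp: simple_function_def intro: countable_finite)
    have AE1: "AE y in lebesgue. y \<in> dcube Q \<longrightarrow> rho V r (dcube Q) (blinfun_apply (?S y) d) \<le> ennreal (C * norm d)" for d
    proof -
      have "AE y in restrict_space lebesgue (dcube Q). rho V r (dcube Q) (blinfun_apply (?S y) d)
          \<le> esssup (restrict_space lebesgue (dcube Q)) (\<lambda>y. rho V r (dcube Q) (blinfun_apply (?S y) d))"
        by (rule esssup_AE)
      moreover have "esssup (restrict_space lebesgue (dcube Q)) (\<lambda>y. rho V r (dcube Q) (blinfun_apply (?S y) d))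
          \<le> ennreal (C * norm d)"
        using C0[of "dlen Q" "dvertex Q" d, OF dlen_pos] unfolding dcube_def[symmetric]
        by (rule order_trans) (auto simp: C_def intro!: ennreal_leI mult_right_mono)
      ultimately have "AE y in restrict_space lebesgue (dcube Q). rho V r (dcube Q) (blinfun_apply (?S y) d) \<le> ennreal (C * norm d)"
        by (auto elim!: eventually_mono)
      then show ?thesis by (subst (asm) AE_restrict_space_iff) auto
    qed
    have "AE y in lebesgue. \<forall>d\<in>D. y \<in> dcube Q \<longrightarrow> rho V r (dcube Q) (blinfun_apply (?S y) d) \<le> ennreal (C * norm d)"
      by (subst AE_ball_countable[OF \<open>countable D\<close>]) (use AE1 in blast)
    moreover have "AE y in lebesgue. invertible_op smul UNIV (V y)" using W by (simp add: weight_def)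
    ultimately have AE2: "AE y in lebesgue. y \<in> dcube Q \<longrightarrow> rho V r (dcube Q) e \<le> ennreal (C * norm (blinfun_apply (V y) e))"
    proof (eventually_elim, intro impI)
      fix y assume y: "\<forall>d\<in>D. y \<in> dcube Q \<longrightarrow> rho V r (dcube Q) (blinfun_apply (?S y) d) \<le> ennreal (C * norm d)"
        "invertible_op smul UNIV (V y)" "y \<in> dcube Q"
      have Se: "blinfun_apply (?S y) (blinfun_apply (V y) e) = e"
        using is_inverse_op_inverse[OF y(2)] by (simp add: is_inverse_op_def)
      show "rho V r (dcube Q) e \<le> ennreal (C * norm (blinfun_apply (V y) e))"
      proof (rule rho_lsc_le[OF W r(1)])
        show "(\<lambda>i. blinfun_apply (?S y) (F i y)) \<longlonglongrightarrow> e"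
          using blinfun.tendsto[OF tendsto_const F(2)[of y], of "?S y"] by (simp add: Se)
        show "rho V r (dcube Q) (blinfun_apply (?S y) (F i y)) \<le> ennreal (C * norm (F i y))" for i
          using y by (auto simp: D_def)
        show "(\<lambda>i. C * norm (F i y)) \<longlonglongrightarrow> C * norm (blinfun_apply (V y) e)"
          by (intro tendsto_intros F)
      qed auto
    qed
    note [measurable] = weight_powr_measurable[OF W UNIV_I]
    have "wint V r e (dcube Q) / ?v * emeasure lebesgue E = (\<integral>\<^sup>+x. (wint V r e (dcube Q) / ?v) * indicator E x \<partial>lebesgue)"
      by (simp add: nn_integral_cmult_indicator)
    also have "\<dots> \<le> (\<integral>\<^sup>+x. ennreal (C powr r) * (ennreal (norm (blinfun_apply (V x) e) powr r) * indicator E x) \<partial>lebesgue)"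
    proof (rule nn_integral_mono_AE, rule AE_mp[OF AE2], intro AE_I2 impI)
      fix x assume x: "x \<in> dcube Q \<longrightarrow> rho V r (dcube Q) e \<le> ennreal (C * norm (blinfun_apply (V x) e))"
      show "wint V r e (dcube Q) / ?v * indicator E x
        \<le> ennreal (C powr r) * (ennreal (norm (blinfun_apply (V x) e) powr r) * indicator E x)"
      proof (cases "x \<in> E")
        case True
        then have "epowr (rho V r (dcube Q) e) r \<le> epowr (ennreal (C * norm (blinfun_apply (V x) e))) r"
          using x E(2) r by (intro epowr_mono) auto
        moreover have "0 \<le> C" by (simp add: C_def)
        ultimately show ?thesis using True r
          by (simp add: epowr_rho epowr_ennreal epowr_mult ennreal_mult)
      qed simp
    qed
    also have "\<dots> = ennreal (C powr r) * wint V r e E" by (simp add: nn_integral_cmult wint_def)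
    finally have le: "wint V r e (dcube Q) / ?v * emeasure lebesgue E \<le> ennreal (C powr r) * wint V r e E" .
    have "wint V r e (dcube Q) = wint V r e (dcube Q) / ?v * ?v" by (simp add: ennreal_divide_times)
    also have "\<dots> \<le> wint V r e (dcube Q) / ?v * (2 * emeasure lebesgue E)"
      by (rule mult_left_mono[OF large]) simp
    also have "\<dots> = 2 * (wint V r e (dcube Q) / ?v * emeasure lebesgue E)" by (simp only: ac_simps)
    also have "\<dots> \<le> 2 * (ennreal (C powr r) * wint V r e E)" by (rule mult_left_mono[OF le]) simp
    also have "\<dots> = ennreal (2 * C powr r) * wint V r e E" by (simp add: ennreal_mult mult.assoc)
    also have "\<dots> \<le> ennreal K * wint V r e E" by (intro mult_right_mono ennreal_leI) (auto simp: K_def)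
    finally show ?thesis .
  qed
  ultimately show ?thesis by blast
qed

text \<open>The only form in which the inequalities of the weight condition enter from here on; the
  two ranges of r are no longer distinguished.\<close>

lemma Ap_lower:
  assumes "Ap_weight smul r V"
  obtains K :: real where "1 \<le> K" "\<And>Q e E. E \<in> sets lebesgue \<Longrightarrow> E \<subseteq> dcube Q \<Longrightarrow>
    emeasure lebesgue (dcube Q) \<le> 2 * emeasure lebesgue E \<Longrightarrow> wint V r e (dcube Q) \<le> ennreal K * wint V r e E"
proof (cases "1 < r")
  case True
  then show ?thesis using Ap_lower_large[OF assms] that by meson
next
  case False
  then show ?thesis using Ap_lower_small[OF assms] assms that by (meson Ap_weight_def not_le_imp_less)
qed

end

section \<open>A dyadic reverse Hoelder inequality\<close>

lemma disjoint_family_on_Int: "disjoint_family_on A I \<Longrightarrow> disjoint_family_on (\<lambda>i. A i \<inter> B) I"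
  unfolding disjoint_family_on_def by blast

text \<open>The index set appears as an indicator, so that sums over subfamilies of cubes all run
  over one countable type.\<close>

lemma nn_integral_disjoint_UN:
  fixes A :: "'i::countable \<Rightarrow> 'x set"
  assumes d: "disjoint_family_on A I" and [measurable]: "\<And>i. A i \<in> sets M" "f \<in> borel_measurable M"
  shows "(\<integral>\<^sup>+x\<in>(\<Union>i\<in>I. A i). f x \<partial>M) = csum (\<lambda>i. indicator I i * (\<integral>\<^sup>+x\<in>A i. f x \<partial>M))"
proof -
  have "(\<integral>\<^sup>+x\<in>(\<Union>i\<in>I. A i). f x \<partial>M) = (\<integral>\<^sup>+x. csum (\<lambda>i. indicator I i * (f x * indicator (A i) x)) \<partial>M)"
    unfolding csum_indicator_disjoint[OF d, symmetric] csum_cmult[symmetric]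
    by (simp add: mult.left_commute)
  also have "\<dots> = csum (\<lambda>i. \<integral>\<^sup>+x. indicator I i * (f x * indicator (A i) x) \<partial>M)"
    by (rule nn_integral_csum) simp
  finally show ?thesis by (simp add: nn_integral_cmult)
qed

lemma power_powr_commute: "0 \<le> (x::real) \<Longrightarrow> (x ^ k) powr a = (x powr a) ^ k"
  by (induction k) (simp_all add: powr_mult)

section \<open>Stopping cubes on which the average of a weight is large\<close>

definition subcubes :: "('n::finite) dyadic \<Rightarrow> 'n dyadic set" where
  "subcubes Q0 = {Q. \<exists>l. parent l Q = Q0}"

lemma subcubes_level: "Q \<in> subcubes Q0 \<Longrightarrow> fst Q0 \<le> fst Q"
  by (auto simp: subcubes_def parent_def)

lemma subcubes_subset: "Q \<in> subcubes Q0 \<Longrightarrow> dcube Q \<subseteq> dcube Q0"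
  using dcube_parent unfolding subcubes_def by blast

lemma subcubesI: "x \<in> dcube Q0 \<Longrightarrow> fst Q0 \<le> j \<Longrightarrow> (j, cell j x) \<in> subcubes Q0"
proof -
  assume "x \<in> dcube Q0" "fst Q0 \<le> j"
  moreover have "x \<in> dcube (j, cell j x)" by (simp add: mem_dcube)
  ultimately have "parent (nat (j - fst Q0)) (j, cell j x) = Q0" using dcube_nested by fastforce
  then show ?thesis unfolding subcubes_def by blast
qed

lemma integral_le_of_davg_le:
  assumes "davg Q w \<le> c"
  shows "(\<integral>\<^sup>+x\<in>dcube Q. w x \<partial>lebesgue) \<le> c * emeasure lebesgue (dcube Q)"
  using mult_right_mono[OF assms, of "emeasure lebesgue (dcube Q)"] by (simp add: davg_times)

lemma emeasure_le_of_le_davg: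
  assumes "0 < c" "ennreal c \<le> davg Q w"
  shows "emeasure lebesgue (dcube Q) \<le> ennreal (1 / c) * (\<integral>\<^sup>+x\<in>dcube Q. w x \<partial>lebesgue)"
proof -
  let ?v = "emeasure lebesgue (dcube Q)"
  have le: "ennreal c * ?v \<le> (\<integral>\<^sup>+x\<in>dcube Q. w x \<partial>lebesgue)"
    using mult_right_mono[OF assms(2), of ?v] by (simp add: davg_times)
  have "?v = ennreal (1 / c) * (ennreal c * ?v)"
    using assms(1) by (simp add: mult.assoc[symmetric] ennreal_mult[symmetric])
  also have "\<dots> \<le> ennreal (1 / c) * (\<integral>\<^sup>+x\<in>dcube Q. w x \<partial>lebesgue)" by (rule mult_left_mono[OF le]) simp
  finally show ?thesis .
qed

definition high_cubes :: "(real ^ 'n \<Rightarrow> ennreal) \<Rightarrow> 'n dyadic \<Rightarrow> real \<Rightarrow> 'n dyadic set" where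
  "high_cubes w Q0 c = {Q \<in> subcubes Q0. ennreal c < davg Q w}"

definition high_set :: "(real ^ 'n \<Rightarrow> ennreal) \<Rightarrow> 'n dyadic \<Rightarrow> real \<Rightarrow> (real ^ 'n) set" where
  "high_set w Q0 c = (\<Union>Q\<in>high_cubes w Q0 c. dcube Q)"

lemma high_set_measurable [measurable, simp]: "high_set w Q0 c \<in> sets lebesgue"
  unfolding high_set_def by (intro sets.countable_UN') auto

lemma high_set_eq_maximal: "high_set w Q0 c = (\<Union>Q\<in>maximal_cubes (high_cubes w Q0 c). dcube Q)"
  unfolding high_set_def
  by (rule maximal_cubes_Union[symmetric, of _ "fst Q0"]) (auto simp: high_cubes_def subcubes_level)

lemma high_set_subset: "high_set w Q0 c \<subseteq> dcube Q0"
  by (auto simp: high_set_def high_cubes_def dest: subcubes_subset)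

lemma high_set_antimono: "c \<le> d \<Longrightarrow> high_set w Q0 d \<subseteq> high_set w Q0 c"
  by (auto simp: high_set_def high_cubes_def dest: le_less_trans[OF ennreal_leI])

text \<open>A substitute for Lebesgue's differentiation theorem, by outer regularity: an open set that is
  slightly larger than the exceptional set is covered by dyadic cubes on which the average is small.\<close>

lemma AE_le_off_high_set:
  fixes w :: "real ^ 'n \<Rightarrow> ennreal"
  assumes [measurable]: "w \<in> borel_measurable lebesgue" and c: "0 < c"
  shows "AE x in lebesgue. x \<in> dcube Q0 - high_set w Q0 c \<longrightarrow> w x \<le> ennreal c"
proof -
  have null: "emeasure lebesgue {x \<in> space lebesgue. x \<in> dcube Q0 - high_set w Q0 c \<and> ennreal (c + \<eta>) < w x} = 0"
    if \<eta>: "0 < \<eta>" for \<eta> :: real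
  proof -
    define G where "G = {x \<in> space lebesgue. x \<in> dcube Q0 - high_set w Q0 c \<and> ennreal (c + \<eta>) < w x}"
    have G [measurable]: "G \<in> sets lebesgue" unfolding G_def by measurable
    have "emeasure lebesgue G \<le> emeasure lebesgue (dcube Q0)" by (rule emeasure_mono) (auto simp: G_def)
    then have Gfin: "emeasure lebesgue G < top"
      by (rule le_less_trans) (simp add: emeasure_dcube_dvol)
    define g where "g = enn2real (emeasure lebesgue G)"
    have g: "emeasure lebesgue G = ennreal g" "0 \<le> g" using Gfin by (simp_all add: g_def)
    have "\<eta> * g \<le> c * \<epsilon>" if \<epsilon>: "0 < \<epsilon>" for \<epsilon> :: real
    proof -
      obtain U where U: "open U" "G \<subseteq> U" "U - G \<in> lmeasurable" "emeasure lebesgue (U - G) < ennreal \<epsilon>"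
        by (rule sets_lebesgue_outer_open[OF G \<epsilon>])
      have [measurable]: "U \<in> sets lebesgue" using U(1) by (simp add: borel_open)
      define \<G> where "\<G> = {Q \<in> subcubes Q0. dcube Q \<subseteq> U \<and> dcube Q \<inter> G \<noteq> {}}"
      have lev: "fst Q0 \<le> fst Q" if "Q \<in> \<G>" for Q using that by (auto simp: \<G>_def subcubes_level)
      let ?M = "maximal_cubes \<G>"
      have "G \<subseteq> (\<Union>Q\<in>\<G>. dcube Q)"
      proof
        fix x assume x: "x \<in> G"
        then have "x \<in> U" using U(2) by blast
        then obtain J where J: "\<And>j. J \<le> j \<Longrightarrow> dcube (j, cell j x) \<subseteq> U"
          using dcube_subset_open[OF U(1)] by metis
        let ?j = "max J (fst Q0)"
        have in_cube: "x \<in> dcube (?j, cell ?j x)" by (simp add: mem_dcube)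
        have "x \<in> dcube Q0" using x by (simp add: G_def)
        then have "(?j, cell ?j x) \<in> subcubes Q0" by (rule subcubesI) simp
        moreover have "dcube (?j, cell ?j x) \<subseteq> U" by (rule J) simp
        ultimately have "(?j, cell ?j x) \<in> \<G>"
          unfolding \<G>_def using in_cube x by blast
        then show "x \<in> (\<Union>Q\<in>\<G>. dcube Q)" using in_cube by blast
      qed
      moreover have eq: "(\<Union>Q\<in>?M. dcube Q) = (\<Union>Q\<in>\<G>. dcube Q)" by (rule maximal_cubes_Union[OF lev])
      ultimately have cover: "G \<subseteq> (\<Union>Q\<in>?M. dcube Q)" by (simp only:)
      have inU: "(\<Union>Q\<in>?M. dcube Q) \<subseteq> U" unfolding eq by (auto simp: \<G>_def)
      \<comment> \<open>Each chosen cube is a subcube of Q0 that meets G, and G avoids the high set;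
        so its average cannot exceed c.\<close>
      have low: "davg Q w \<le> ennreal c" if "Q \<in> ?M" for Q
      proof (rule ccontr)
        assume "\<not> ?thesis"
        moreover have "Q \<in> \<G>" using that maximal_cubes_subset by blast
        ultimately have "Q \<in> high_cubes w Q0 c" by (simp add: high_cubes_def \<G>_def)
        then show False using \<open>Q \<in> \<G>\<close> by (auto simp: \<G>_def G_def high_set_def)
      qed
      have [measurable]: "(\<Union>Q\<in>?M. dcube Q) \<in> sets lebesgue" by (intro sets.countable_UN') auto
      have "ennreal (c + \<eta>) * emeasure lebesgue G = (\<integral>\<^sup>+x\<in>G. ennreal (c + \<eta>) \<partial>lebesgue)"
        by (simp add: nn_integral_cmult_indicator)
      also have "\<dots> \<le> (\<integral>\<^sup>+x\<in>(\<Union>Q\<in>?M. dcube Q). w x \<partial>lebesgue)"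
        using cover by (intro nn_integral_mono) (auto simp: indicator_def G_def intro: less_imp_le)
      also have "\<dots> = csum (\<lambda>Q. indicator ?M Q * (\<integral>\<^sup>+x\<in>dcube Q. w x \<partial>lebesgue))"
        by (rule nn_integral_disjoint_UN[OF disjoint_family_maximal_cubes]) auto
      also have "\<dots> \<le> csum (\<lambda>Q. indicator ?M Q * (\<integral>\<^sup>+x\<in>dcube Q. ennreal c \<partial>lebesgue))"
      proof (rule csum_mono)
        fix Q :: "'n dyadic"
        have eq: "(\<integral>\<^sup>+x\<in>dcube Q. ennreal c \<partial>lebesgue) = ennreal c * emeasure lebesgue (dcube Q)"
          by (rule nn_integral_cmult_indicator) simp
        show "indicator ?M Q * (\<integral>\<^sup>+x\<in>dcube Q. w x \<partial>lebesgue) \<le> indicator ?M Q * (\<integral>\<^sup>+x\<in>dcube Q. ennreal c \<partial>lebesgue)"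
        proof (cases "Q \<in> ?M")
          case True
          show ?thesis
            unfolding eq
            by (intro mult_left_mono integral_le_of_davg_le low True) simp
        qed simp
      qed
      also have "\<dots> = (\<integral>\<^sup>+x\<in>(\<Union>Q\<in>?M. dcube Q). ennreal c \<partial>lebesgue)"
        by (rule nn_integral_disjoint_UN[OF disjoint_family_maximal_cubes, symmetric]) auto
      also have "\<dots> = ennreal c * emeasure lebesgue (\<Union>Q\<in>?M. dcube Q)"
        by (rule nn_integral_cmult_indicator) simp
      also have "\<dots> \<le> ennreal c * emeasure lebesgue U"
        by (intro mult_left_mono emeasure_mono inU) auto
      also have "emeasure lebesgue U = emeasure lebesgue G + emeasure lebesgue (U - G)"
        using U(2) by (subst plus_emeasure) (auto simp: Un_absorb1)
      also have "ennreal c * (emeasure lebesgue G + emeasure lebesgue (U - G)) \<le> ennreal c * (ennreal g + ennreal \<epsilon>)"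
        using U(4) by (intro mult_left_mono add_mono) (auto simp: g less_imp_le)
      finally have "ennreal ((c + \<eta>) * g) \<le> ennreal (c * (g + \<epsilon>))"
        using c \<eta> \<epsilon> g by (simp add: ennreal_mult)
      then have "(c + \<eta>) * g \<le> c * (g + \<epsilon>)" using c \<epsilon> g by (subst (asm) ennreal_le_iff) auto
      then show ?thesis by (simp add: algebra_simps)
    qed
    \<comment> \<open>If g > 0, this choice of \<epsilon> gives \<eta> g \<le> \<eta> g / 2, a
      contradiction.\<close>
    from this[of "\<eta> * g / (2 * c)"] have "g = 0"
      using \<eta> g(2) c by (cases "g = 0") (auto simp: field_simps)
    then show ?thesis using g(1) by (simp add: G_def)
  qed
  have AEm: "AE x in lebesgue. \<not> (x \<in> dcube Q0 - high_set w Q0 c \<and> ennreal (c + 1 / real (Suc m)) < w x)" for m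
  proof (rule AE_I)
    show "{x \<in> space lebesgue. \<not> \<not> (x \<in> dcube Q0 - high_set w Q0 c \<and> ennreal (c + 1 / real (Suc m)) < w x)}
      \<subseteq> {x \<in> space lebesgue. x \<in> dcube Q0 - high_set w Q0 c \<and> ennreal (c + 1 / real (Suc m)) < w x}"
      by blast
    show "emeasure lebesgue {x \<in> space lebesgue. x \<in> dcube Q0 - high_set w Q0 c \<and> ennreal (c + 1 / real (Suc m)) < w x} = 0"
      by (rule null) simp
    show "{x \<in> space lebesgue. x \<in> dcube Q0 - high_set w Q0 c \<and> ennreal (c + 1 / real (Suc m)) < w x} \<in> sets lebesgue"
      by measurable
  qed
  have "AE x in lebesgue. \<forall>m. \<not> (x \<in> dcube Q0 - high_set w Q0 c \<and> ennreal (c + 1 / real (Suc m)) < w x)"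
    unfolding AE_all_countable by (intro allI AEm)
  then show ?thesis
  proof (eventually_elim, intro impI)
    fix x assume x: "\<forall>m. \<not> (x \<in> dcube Q0 - high_set w Q0 c \<and> ennreal (c + 1 / real (Suc m)) < w x)"
      and in_set: "x \<in> dcube Q0 - high_set w Q0 c"
    then have le: "w x \<le> ennreal (c + 1 / real (Suc m))" for m by (auto simp: not_less)
    have "(\<lambda>m. ennreal (c + 1 / real (Suc m))) \<longlonglongrightarrow> ennreal (c + 0)"
      by (intro tendsto_ennrealI tendsto_add tendsto_const LIMSEQ_Suc[OF lim_1_over_n])
    then show "w x \<le> ennreal c" using le by (intro Lim_bounded2) auto
  qed
qed

section \<open>Decay of a scalar weight on its high sets\<close>

context
  fixes w :: "real ^ 'n \<Rightarrow> ennreal" and Q0 :: "'n dyadic" and K :: real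
  assumes w [measurable]: "w \<in> borel_measurable lebesgue"
    and wfin: "(\<integral>\<^sup>+x\<in>dcube Q0. w x \<partial>lebesgue) < top"
    and K: "1 \<le> K"
    and large: "\<And>Q E. E \<in> sets lebesgue \<Longrightarrow> E \<subseteq> dcube Q \<Longrightarrow>
      emeasure lebesgue (dcube Q) \<le> 2 * emeasure lebesgue E \<Longrightarrow>
      (\<integral>\<^sup>+x\<in>dcube Q. w x \<partial>lebesgue) \<le> ennreal K * (\<integral>\<^sup>+x\<in>E. w x \<partial>lebesgue)"
begin

abbreviation (input) wmeas :: "(real ^ 'n) set \<Rightarrow> ennreal" where
  "wmeas E \<equiv> (\<integral>\<^sup>+x\<in>E. w x \<partial>lebesgue)"

lemma wmeas_mono: "A \<subseteq> B \<Longrightarrow> wmeas A \<le> wmeas B"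
  by (intro nn_integral_mono) (auto simp: indicator_def)

text \<open>The average over M can exceed c by at most the factor 2^n, because the parent of M is
  not high. The parent is still a subcube of Q0, since the average over Q0 is at most c and so M is
  not Q0.\<close>

lemma maximal_high_cube_le:
  assumes M: "M \<in> maximal_cubes (high_cubes w Q0 c)" and c: "davg Q0 w \<le> ennreal c" "0 < c"
  shows "wmeas (dcube M) \<le> ennreal (2 ^ CARD('n) * c) * emeasure lebesgue (dcube M)"
proof -
  have Mh: "M \<in> high_cubes w Q0 c" using M maximal_cubes_subset by blast
  then obtain l where l: "parent l M = Q0" by (auto simp: high_cubes_def subcubes_def)
  have "l \<noteq> 0"
  proof
    assume "l = 0"
    then have "M = Q0" using l by simp
    then show False using Mh leD[OF c(1)] by (simp add: high_cubes_def)
  qed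
  then obtain l' where l': "l = l' + 1" by (metis Suc_eq_plus1 not0_implies_Suc)
  then have "parent 1 M \<in> subcubes Q0" using l by (auto simp: subcubes_def parent_parent)
  moreover have "parent 1 M \<notin> high_cubes w Q0 c" using M by (simp add: maximal_cubes_def)
  ultimately have "davg (parent 1 M) w \<le> ennreal c" by (simp add: high_cubes_def not_less)
  then have "wmeas (dcube (parent 1 M)) \<le> ennreal c * emeasure lebesgue (dcube (parent 1 M))"
    by (rule integral_le_of_davg_le)
  moreover have "wmeas (dcube M) \<le> wmeas (dcube (parent 1 M))" by (intro wmeas_mono dcube_parent)
  moreover have "emeasure lebesgue (dcube (parent 1 M)) = ennreal (2 ^ CARD('n)) * emeasure lebesgue (dcube M)"
  proof -
    have "dlen (parent 1 M) = 2 * dlen M"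
      by (simp add: dlen_def parent_def power_int_diff power_int_minus divide_inverse)
    then show ?thesis by (simp add: emeasure_dcube power_mult_distrib less_imp_le flip: ennreal_mult)
  qed
  ultimately show ?thesis using c(2) by (simp add: ennreal_mult mult.assoc mult.left_commute)
qed

text \<open>The cubes of height d inside M have total measure at most 1/d times the mass of M, hence
  at most (2^n c / d) |M|. The ratio d / c = 2 2^n makes this one half.\<close>

lemma high_set_small:
  assumes M: "M \<in> maximal_cubes (high_cubes w Q0 c)" and c: "davg Q0 w \<le> ennreal c" "0 < c"
    and d: "d = 2 * 2 ^ CARD('n) * c"
  shows "2 * emeasure lebesgue (dcube M \<inter> high_set w Q0 d) \<le> emeasure lebesgue (dcube M)"
proof -
  let ?N = "maximal_cubes (high_cubes w Q0 d)"
  have cd: "c \<le> d" "0 < d"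
  proof -
    have "1 * c \<le> (2 * 2 ^ CARD('n)) * c"
      using c(2) one_le_power[of "2::real" "CARD('n)"] by (intro mult_right_mono) linarith+
    then show "c \<le> d" by (simp add: d)
    then show "0 < d" using c by linarith
  qed
  have each: "emeasure lebesgue (dcube N \<inter> dcube M) \<le> ennreal (1 / d) * wmeas (dcube N \<inter> dcube M)" if N: "N \<in> ?N" for N
  proof (cases "dcube N \<inter> dcube M = {}")
    case False
    have Nh: "N \<in> high_cubes w Q0 d" using N maximal_cubes_subset by blast
    then have "N \<in> high_cubes w Q0 c"
      using le_less_trans[OF ennreal_leI[OF cd(1)]] by (auto simp: high_cubes_def)
    then obtain l where l: "parent l N \<in> maximal_cubes (high_cubes w Q0 c)"
      using maximal_cubes_ancestor[of N "high_cubes w Q0 c" "fst Q0"] by (auto simp: high_cubes_def subcubes_level)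
    have "parent l N = M"
    proof (rule ccontr)
      assume "parent l N \<noteq> M"
      then have "dcube (parent l N) \<inter> dcube M = {}"
        using disjoint_family_maximal_cubes[of "high_cubes w Q0 c"] l M by (auto simp: disjoint_family_on_def)
      then show False using False dcube_parent[of N l] by blast
    qed
    then have "dcube N \<inter> dcube M = dcube N" using dcube_parent[of N l] by blast
    moreover have "emeasure lebesgue (dcube N) \<le> ennreal (1 / d) * wmeas (dcube N)"
      using Nh cd by (intro emeasure_le_of_le_davg) (auto simp: high_cubes_def)
    ultimately show ?thesis by simp
  qed simp
  have disj: "disjoint_family_on (\<lambda>N. dcube N \<inter> dcube M) ?N"
    by (intro disjoint_family_on_Int disjoint_family_maximal_cubes)
  have un: "dcube M \<inter> high_set w Q0 d = (\<Union>N\<in>?N. dcube N \<inter> dcube M)"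
    by (auto simp: high_set_eq_maximal)
  have "emeasure lebesgue (dcube M \<inter> high_set w Q0 d) = (\<integral>\<^sup>+x\<in>(\<Union>N\<in>?N. dcube N \<inter> dcube M). 1 \<partial>lebesgue)"
    unfolding un[symmetric] by simp
  also have "\<dots> = csum (\<lambda>N. indicator ?N N * emeasure lebesgue (dcube N \<inter> dcube M))"
    by (subst nn_integral_disjoint_UN[OF disj]) auto
  also have "\<dots> \<le> csum (\<lambda>N. ennreal (1 / d) * (indicator ?N N * wmeas (dcube N \<inter> dcube M)))"
    using each by (intro csum_mono) (auto simp: indicator_def)
  also have "\<dots> = ennreal (1 / d) * wmeas (dcube M \<inter> high_set w Q0 d)"
    unfolding un csum_cmult by (subst nn_integral_disjoint_UN[OF disj]) auto
  also have "\<dots> \<le> ennreal (1 / d) * (ennreal (2 ^ CARD('n) * c) * emeasure lebesgue (dcube M))"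
    by (intro mult_left_mono order_trans[OF wmeas_mono maximal_high_cube_le[OF M c]]) auto
  also have "\<dots> = ennreal (1 / 2) * emeasure lebesgue (dcube M)"
  proof -
    have "1 / d * (2 ^ CARD('n) * c) = 1 / 2" using c(2) by (simp add: d)
    then show ?thesis using cd c by (simp add: mult.assoc[symmetric] ennreal_mult[symmetric])
  qed
  finally have "2 * emeasure lebesgue (dcube M \<inter> high_set w Q0 d) \<le> 2 * (ennreal (1 / 2) * emeasure lebesgue (dcube M))"
    by (rule mult_left_mono) simp
  also have "2 * (ennreal (1 / 2) * emeasure lebesgue (dcube M)) = ennreal (2 * (1 / 2)) * emeasure lebesgue (dcube M)"
    by (simp only: mult.assoc[symmetric] ennreal_mult) simp
  finally show ?thesis by simp
qed

text \<open>The rest of M has at least half the measure of M, so by hypothesis it carries at least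
  the fraction 1/K of the mass.\<close>

lemma wmeas_high_set_maximal:
  assumes M: "M \<in> maximal_cubes (high_cubes w Q0 c)" and c: "davg Q0 w \<le> ennreal c" "0 < c"
    and d: "d = 2 * 2 ^ CARD('n) * c"
  shows "wmeas (dcube M \<inter> high_set w Q0 d) \<le> ennreal (1 - 1 / K) * wmeas (dcube M)"
proof -
  define E where "E = dcube M - high_set w Q0 d"
  define F where "F = dcube M \<inter> high_set w Q0 d"
  have [measurable]: "E \<in> sets lebesgue" "F \<in> sets lebesgue" by (auto simp: E_def F_def)
  have EF: "dcube M = E \<union> F" "E \<inter> F = {}" by (auto simp: E_def F_def)
  have "M \<in> high_cubes w Q0 c" using M maximal_cubes_subset by blast
  then have "dcube M \<subseteq> dcube Q0" by (intro subcubes_subset) (simp add: high_cubes_def)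
  then have fin: "wmeas (dcube M) < top" using wmeas_mono wfin by (meson le_less_trans)
  have split: "wmeas (dcube M) = wmeas E + wmeas F"
  proof -
    have "indicator (dcube M) x = indicator E x + (indicator F x :: ennreal)" for x
      using EF by (auto simp: indicator_def)
    then show ?thesis by (simp add: distrib_left nn_integral_add)
  qed
  have "emeasure lebesgue (dcube M) \<le> 2 * emeasure lebesgue E"
  proof -
    have m: "emeasure lebesgue (dcube M) = emeasure lebesgue E + emeasure lebesgue F"
      using EF by (subst plus_emeasure) auto
    have "2 * emeasure lebesgue F \<le> emeasure lebesgue E + emeasure lebesgue F"
      using high_set_small[OF assms] unfolding F_def[symmetric] m[symmetric] .
    moreover have "emeasure lebesgue F \<noteq> top" using m emeasure_dcube_nz(2)[of M] by auto
    ultimately have "emeasure lebesgue F \<le> emeasure lebesgue E"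
      by (simp add: mult_2 ennreal_add_left_cancel_le add.commute[of "emeasure lebesgue E"])
    then show ?thesis by (simp add: m mult_2)
  qed
  then have "wmeas (dcube M) \<le> ennreal K * wmeas E" using EF by (intro large) auto
  moreover have "wmeas E < top" "wmeas F < top" using fin split by auto
  moreover define a where "a = enn2real (wmeas E)"
  moreover define b where "b = enn2real (wmeas F)"
  ultimately have ab: "wmeas E = ennreal a" "wmeas F = ennreal b" "0 \<le> a" "0 \<le> b" "ennreal (a + b) \<le> ennreal (K * a)"
    using K by (auto simp: split ennreal_mult)
  then have "a + b \<le> K * a" using K by (subst (asm) ennreal_le_iff) auto
  then have "b \<le> (1 - 1 / K) * (a + b)" using K by (simp add: field_simps)
  then have "ennreal b \<le> ennreal (1 - 1 / K) * ennreal (a + b)"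
    using K ab by (simp add: ennreal_mult[symmetric] ennreal_leI del: ennreal_plus)
  then show ?thesis unfolding split using ab by (simp add: F_def)
qed

lemma wmeas_high_set_decay:
  assumes c: "davg Q0 w \<le> ennreal c" "0 < c" and d: "d = 2 * 2 ^ CARD('n) * c"
  shows "wmeas (high_set w Q0 d) \<le> ennreal (1 - 1 / K) * wmeas (high_set w Q0 c)"
proof -
  let ?M = "maximal_cubes (high_cubes w Q0 c)"
  have "1 * c \<le> (2 * 2 ^ CARD('n)) * c"
    using c(2) one_le_power[of "2::real" "CARD('n)"] by (intro mult_right_mono) linarith+
  then have sub: "high_set w Q0 d \<subseteq> high_set w Q0 c" by (intro high_set_antimono) (simp add: d)
  have disj: "disjoint_family_on (\<lambda>N. dcube N \<inter> high_set w Q0 d) ?M"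
    by (intro disjoint_family_on_Int disjoint_family_maximal_cubes)
  have "high_set w Q0 d = (\<Union>N\<in>?M. dcube N \<inter> high_set w Q0 d)" using sub by (auto simp: high_set_eq_maximal[of w Q0 c])
  then have "wmeas (high_set w Q0 d) = wmeas (\<Union>N\<in>?M. dcube N \<inter> high_set w Q0 d)" by simp
  also have "\<dots> = csum (\<lambda>N. indicator ?M N * wmeas (dcube N \<inter> high_set w Q0 d))"
    by (rule nn_integral_disjoint_UN[OF disj]) auto
  also have "\<dots> \<le> csum (\<lambda>N. ennreal (1 - 1 / K) * (indicator ?M N * wmeas (dcube N)))"
    using wmeas_high_set_maximal[OF _ assms] by (intro csum_mono) (auto simp: indicator_def)
  also have "\<dots> = ennreal (1 - 1 / K) * wmeas (high_set w Q0 c)"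
    unfolding csum_cmult high_set_eq_maximal[of w Q0 c]
    by (subst nn_integral_disjoint_UN[OF disjoint_family_maximal_cubes]) auto
  finally show ?thesis .
qed

text \<open>Between two consecutive high sets w is at most the next height, so the integral of
  w^(1+\<delta>) is bounded by a series of heights^\<delta> times masses of high sets. The heights
  grow like L^k and the masses decay like \<theta>^k; the assumption on \<delta> makes the series
  geometric.\<close>

lemma dyadic_reverse_Hoelder_aux:
  defines "\<theta> \<equiv> 1 - 1 / K" and "L \<equiv> 2 * 2 ^ CARD('n) :: real"
  assumes \<delta>: "0 < \<delta>" "L powr \<delta> * \<theta> < 1"
  shows "davg Q0 (\<lambda>x. epowr (w x) (1 + \<delta>)) \<le> ennreal (1 + L powr \<delta> / (1 - L powr \<delta> * \<theta>)) * epowr (davg Q0 w) (1 + \<delta>)"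
proof (cases "davg Q0 w = 0")
  case True
  then have "wmeas (dcube Q0) = 0" by (simp add: davg_def divide_ennreal_def)
  then have "AE x in lebesgue. w x * indicator (dcube Q0) x = 0" by (simp add: nn_integral_0_iff_AE)
  then have "AE x in lebesgue. epowr (w x) (1 + \<delta>) * indicator (dcube Q0) x = 0" by eventually_elim auto
  then have "(\<integral>\<^sup>+x\<in>dcube Q0. epowr (w x) (1 + \<delta>) \<partial>lebesgue) = 0" by (simp add: nn_integral_0_iff_AE)
  then show ?thesis by (simp add: davg_def)
next
  case False
  have \<theta>: "0 \<le> \<theta>" using K by (simp add: \<theta>_def)
  have L: "1 < L" unfolding L_def using one_le_power[of "2::real" "CARD('n)"] by linarith
  have "davg Q0 w < top"
    using wfin by (simp add: davg_def divide_ennreal_def ennreal_mult_less_top emeasure_dcube_dvol inverse_ennreal)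
  define c0 where "c0 = enn2real (davg Q0 w)"
  have c0: "davg Q0 w = ennreal c0" "0 < c0"
    using False \<open>davg Q0 w < top\<close>
    by (simp_all add: c0_def enn2real_positive_iff zero_less_iff_neq_zero[symmetric])
  \<comment> \<open>The heights start at the average over Q0, the least admissible value, and grow
    by the ratio for which the mass decay has been shown.\<close>
  define c where "c k = c0 * L ^ k" for k
  have c_pos: "0 < c k" for k using c0 L by (simp add: c_def)
  have c_ge: "davg Q0 w \<le> ennreal (c k)" for k
  proof -
    have "c0 * 1 \<le> c0 * L ^ k" using c0 L by (intro mult_left_mono one_le_power) auto
    then show ?thesis by (simp add: c0(1) c_def ennreal_leI)
  qed
  let ?\<Omega> = "\<lambda>k. high_set w Q0 (c k)"
  have decay: "wmeas (?\<Omega> k) \<le> ennreal (\<theta> ^ k) * wmeas (dcube Q0)" for k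
  proof (induction k)
    case 0
    then show ?case by (simp add: wmeas_mono[OF high_set_subset])
  next
    case (Suc k)
    have "wmeas (?\<Omega> (Suc k)) \<le> ennreal \<theta> * wmeas (?\<Omega> k)"
      unfolding \<theta>_def by (rule wmeas_high_set_decay[OF c_ge c_pos]) (simp add: c_def L_def)
    also have "\<dots> \<le> ennreal \<theta> * (ennreal (\<theta> ^ k) * wmeas (dcube Q0))" by (rule mult_left_mono[OF Suc]) simp
    also have "\<dots> = ennreal (\<theta> ^ Suc k) * wmeas (dcube Q0)"
      using \<theta> by (simp add: mult.assoc[symmetric] ennreal_mult)
    finally show ?case .
  qed
  let ?f = "\<lambda>k. ennreal (c (Suc k) powr \<delta>)"
  have "AE x in lebesgue. \<forall>k. x \<in> dcube Q0 - ?\<Omega> k \<longrightarrow> w x \<le> ennreal (c k)"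
    unfolding AE_all_countable by (intro allI AE_le_off_high_set[OF w c_pos])
  then have pw: "AE x in lebesgue. epowr (w x) (1 + \<delta>) * indicator (dcube Q0) x
      \<le> ennreal (c 0 powr \<delta>) * (w x * indicator (dcube Q0) x) + csum (\<lambda>k::nat. ?f k * (w x * indicator (?\<Omega> k) x))"
  proof eventually_elim
    fix x assume x: "\<forall>k. x \<in> dcube Q0 - ?\<Omega> k \<longrightarrow> w x \<le> ennreal (c k)"
    let ?S = "csum (\<lambda>k::nat. ?f k * (w x * indicator (?\<Omega> k) x))"
    have pow: "epowr (w x) (1 + \<delta>) = epowr (w x) \<delta> * w x"
      using epowr_add[of "w x" \<delta> 1] by (simp add: add.commute[of 1])
    show "epowr (w x) (1 + \<delta>) * indicator (dcube Q0) x \<le> ennreal (c 0 powr \<delta>) * (w x * indicator (dcube Q0) x) + ?S"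
    proof (cases "x \<in> dcube Q0")
      case True
      consider "x \<notin> ?\<Omega> 0" | k where "x \<in> ?\<Omega> k" "x \<notin> ?\<Omega> (Suc k)" | "\<forall>k. x \<in> ?\<Omega> k"
      proof (cases "\<forall>k. x \<in> ?\<Omega> k")
        case False
        define k where "k = (LEAST k. x \<notin> ?\<Omega> k)"
        have k: "x \<notin> ?\<Omega> k" unfolding k_def by (rule LeastI_ex) (use False in simp)
        have less: "x \<in> ?\<Omega> m" if "m < k" for m using not_less_Least[OF that[unfolded k_def]] by simp
        show ?thesis
        proof (cases k)
          case 0
          then show ?thesis using k that(1) by simp
        next
          case (Suc m)
          then show ?thesis using k less[of m] that(2) by simp
        qed
      qed (rule that(3))
      then show ?thesis
      proof cases
        case 1
        then have "epowr (w x) \<delta> \<le> epowr (ennreal (c 0)) \<delta>" using x True \<delta> by (intro epowr_mono) auto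
        then have "epowr (w x) (1 + \<delta>) \<le> ennreal (c 0 powr \<delta>) * w x"
          using c_pos[of 0] by (simp add: pow epowr_ennreal mult_right_mono)
        then show ?thesis using True by (simp add: add_increasing2)
      next
        case (2 k)
        then have "epowr (w x) \<delta> \<le> epowr (ennreal (c (Suc k))) \<delta>" using x True \<delta> by (intro epowr_mono) auto
        then have "epowr (w x) (1 + \<delta>) \<le> ?f k * (w x * indicator (?\<Omega> k) x)"
          using c_pos[of "Suc k"] 2 by (simp add: pow epowr_ennreal mult_right_mono)
        also have "\<dots> \<le> ?S" by (rule le_csum)
        finally show ?thesis using True by (simp add: add_increasing)
      next
        \<comment> \<open>At a point of all high sets the height bounds give no information, but
          then every term of the series is present; it diverges unless w vanishes at x.\<close>
        case 3
        show ?thesis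
        proof (cases "w x = 0")
          case False
          have "of_nat m * w x \<le> ?S" for m :: nat
          proof -
            have "1 < L powr \<delta>" using L \<delta> by simp
            then obtain k where k: "real m / c0 powr \<delta> < (L powr \<delta>) ^ k" using real_arch_pow by blast
            have "real m \<le> c0 powr \<delta> * (L powr \<delta>) ^ k" using k c0 by (simp add: field_simps)
            also have "\<dots> \<le> c0 powr \<delta> * (L powr \<delta>) ^ Suc k"
              using \<open>1 < L powr \<delta>\<close> by (intro mult_left_mono power_increasing) auto
            also have "\<dots> = c (Suc k) powr \<delta>"
              using c0 L by (simp only: c_def powr_mult power_powr_commute)
            finally have "of_nat m * w x \<le> ?f k * w x"
              by (intro mult_right_mono) (auto simp: ennreal_of_nat_eq_real_of_nat ennreal_leI)
            also have "\<dots> = ?f k * (w x * indicator (?\<Omega> k) x)" using 3 by simp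
            also have "\<dots> \<le> ?S" by (rule le_csum)
            finally show ?thesis .
          qed
          then have "(SUP m. of_nat m * w x) \<le> ?S" by (intro SUP_least)
          then have "top * w x \<le> ?S" by (simp add: SUP_mult_right_ennreal[symmetric] ennreal_SUP_of_nat_eq_top)
          then have "?S = top" using False by (simp add: ennreal_top_mult top_unique)
          then show ?thesis by simp
        qed simp
      qed
    qed simp
  qed
  have "(\<integral>\<^sup>+x\<in>dcube Q0. epowr (w x) (1 + \<delta>) \<partial>lebesgue)
      \<le> (\<integral>\<^sup>+x. ennreal (c 0 powr \<delta>) * (w x * indicator (dcube Q0) x) + csum (\<lambda>k::nat. ?f k * (w x * indicator (?\<Omega> k) x)) \<partial>lebesgue)"
    by (rule nn_integral_mono_AE[OF pw])
  also have "\<dots> = (\<integral>\<^sup>+x. ennreal (c 0 powr \<delta>) * (w x * indicator (dcube Q0) x) \<partial>lebesgue)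
      + (\<integral>\<^sup>+x. csum (\<lambda>k::nat. ?f k * (w x * indicator (?\<Omega> k) x)) \<partial>lebesgue)"
    by (rule nn_integral_add) auto
  also have "\<dots> = ennreal (c 0 powr \<delta>) * wmeas (dcube Q0) + csum (\<lambda>k::nat. ?f k * wmeas (?\<Omega> k))"
    by (simp add: nn_integral_cmult nn_integral_csum)
  also have "\<dots> \<le> ennreal (c 0 powr \<delta>) * wmeas (dcube Q0) + csum (\<lambda>k::nat. ?f k * (ennreal (\<theta> ^ k) * wmeas (dcube Q0)))"
    by (intro add_left_mono csum_mono mult_left_mono decay) simp
  also have "csum (\<lambda>k::nat. ?f k * (ennreal (\<theta> ^ k) * wmeas (dcube Q0))) = csum (\<lambda>k::nat. ?f k * ennreal (\<theta> ^ k)) * wmeas (dcube Q0)"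
    by (simp add: csum_multc[symmetric] mult.assoc)
  also have "csum (\<lambda>k::nat. ?f k * ennreal (\<theta> ^ k)) = ennreal (c0 powr \<delta> * L powr \<delta> / (1 - L powr \<delta> * \<theta>))"
  proof -
    have "c (Suc k) powr \<delta> * \<theta> ^ k = (c0 powr \<delta> * L powr \<delta>) * (L powr \<delta> * \<theta>) ^ k" for k
    proof -
      show ?thesis using c0 L by (simp add: c_def powr_mult power_mult_distrib power_powr_commute)
    qed
    then have "csum (\<lambda>k::nat. ?f k * ennreal (\<theta> ^ k)) = (\<Sum>k. ennreal ((c0 powr \<delta> * L powr \<delta>) * (L powr \<delta> * \<theta>) ^ k))"
      using \<theta> by (simp add: nn_integral_count_space_nat ennreal_mult[symmetric])
    also have "\<dots> = ennreal (c0 powr \<delta> * L powr \<delta> / (1 - L powr \<delta> * \<theta>))"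
      using \<delta> \<theta> by (intro suminf_geometric_ennreal) auto
    finally show ?thesis .
  qed
  also have "ennreal (c 0 powr \<delta>) * wmeas (dcube Q0) + ennreal (c0 powr \<delta> * L powr \<delta> / (1 - L powr \<delta> * \<theta>)) * wmeas (dcube Q0)
      = ennreal (1 + L powr \<delta> / (1 - L powr \<delta> * \<theta>)) * ennreal (c0 powr \<delta>) * wmeas (dcube Q0)"
  proof -
    have nn: "0 \<le> L powr \<delta> / (1 - L powr \<delta> * \<theta>)" using \<delta> by simp
    have "ennreal (1 + L powr \<delta> / (1 - L powr \<delta> * \<theta>)) * ennreal (c0 powr \<delta>)
      = ennreal (c0 powr \<delta> + c0 powr \<delta> * L powr \<delta> / (1 - L powr \<delta> * \<theta>))"
      using nn by (simp add: ennreal_mult[symmetric] algebra_simps del: ennreal_plus)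
    also have "\<dots> = ennreal (c 0 powr \<delta>) + ennreal (c0 powr \<delta> * L powr \<delta> / (1 - L powr \<delta> * \<theta>))"
      using \<delta> by (simp add: c_def)
    finally show ?thesis by (simp add: distrib_right)
  qed
  finally have "davg Q0 (\<lambda>x. epowr (w x) (1 + \<delta>))
      \<le> ennreal (1 + L powr \<delta> / (1 - L powr \<delta> * \<theta>)) * ennreal (c0 powr \<delta>) * wmeas (dcube Q0) / emeasure lebesgue (dcube Q0)"
    unfolding davg_def by (rule divide_right_mono_ennreal)
  also have "\<dots> = ennreal (1 + L powr \<delta> / (1 - L powr \<delta> * \<theta>)) * (ennreal (c0 powr \<delta>) * davg Q0 w)"
    by (simp add: davg_def divide_ennreal_def mult.assoc)
  also have "ennreal (c0 powr \<delta>) * davg Q0 w = epowr (davg Q0 w) (1 + \<delta>)"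
    using epowr_add[of "davg Q0 w" \<delta> 1] c0 by (simp add: epowr_ennreal add.commute)
  finally show ?thesis .
qed

end

text \<open>Applied to w = |V e|^r. The constant K is the same for all e and all cubes, hence so are
  \<delta> and C. A gain of \<delta> for w is a gain of r \<delta> in the exponent of the
  seminorm.\<close>

lemma dyadic_reverse_Hoelder:
  fixes smul :: "'k::real_or_complex \<Rightarrow> 'a::banach \<Rightarrow> 'a" and V :: "real ^ 'n \<Rightarrow> 'a \<Rightarrow>\<^sub>L 'a"
  assumes smul: "normed_space_over smul" and Ap: "Ap_weight smul r V"
  shows "\<exists>\<epsilon>>0. \<exists>C>0. \<forall>Q e. rho V (r + \<epsilon>) (dcube Q) e \<le> ennreal C * rho V r (dcube Q) e"
proof -
  have r: "0 < r" and V: "p_weight smul UNIV r V" using Ap by (auto simp: Ap_weight_def)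
  obtain K where K: "1 \<le> K" "\<And>Q e E. E \<in> sets lebesgue \<Longrightarrow> E \<subseteq> dcube Q \<Longrightarrow>
    emeasure lebesgue (dcube Q) \<le> 2 * emeasure lebesgue E \<Longrightarrow> wint V r e (dcube Q) \<le> ennreal K * wint V r e E"
    using Ap_lower[OF smul Ap] by blast
  define \<theta> where "\<theta> = 1 - 1 / K"
  define L :: real where "L = 2 * 2 ^ CARD('n)"
  have \<theta>: "0 \<le> \<theta>" "\<theta> < 1" using K by (auto simp: \<theta>_def)
  have L: "1 < L" unfolding L_def using one_le_power[of "2::real" "CARD('n)"] by linarith
  \<comment> \<open>This makes L^\<delta> = 2 / (1 + \<theta>), so that L^\<delta> \<theta> = 2
    \<theta> / (1 + \<theta>) < 1.\<close>
  define \<delta> where "\<delta> = ln (2 / (1 + \<theta>)) / ln L"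
  have \<delta>: "0 < \<delta>" using \<theta> L by (simp add: \<delta>_def)
  have "L powr \<delta> = 2 / (1 + \<theta>)" using L \<theta> by (simp add: \<delta>_def powr_def)
  then have "L powr \<delta> * \<theta> = 2 * \<theta> / (1 + \<theta>)" by simp
  also have "\<dots> < 1" using \<theta> by simp
  finally have "L powr \<delta> * \<theta> < 1" .
  define C where "C = 1 + L powr \<delta> / (1 - L powr \<delta> * \<theta>)"
  have C: "0 < C" using \<open>L powr \<delta> * \<theta> < 1\<close> by (simp add: C_def add_pos_nonneg)
  have "rho V (r + r * \<delta>) (dcube Q) e \<le> ennreal (C powr (1 / (r * (1 + \<delta>)))) * rho V r (dcube Q) e" for Q e
  proof -
    let ?w = "\<lambda>x. ennreal (norm (blinfun_apply (V x) e) powr r)"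
    have "davg Q (\<lambda>x. epowr (?w x) (1 + \<delta>)) \<le> ennreal C * epowr (davg Q ?w) (1 + \<delta>)"
      unfolding C_def L_def \<theta>_def
    proof (rule dyadic_reverse_Hoelder_aux)
      show "?w \<in> borel_measurable lebesgue" by (rule weight_powr_measurable[OF p_weightD(1)[OF V] UNIV_I])
      show "(\<integral>\<^sup>+x\<in>dcube Q. ?w x \<partial>lebesgue) < top"
        using wint_dcube_less_top[OF V] by (simp add: wint_def)
    qed (use K \<delta> \<open>L powr \<delta> * \<theta> < 1\<close> in \<open>auto simp: wint_def L_def \<theta>_def\<close>)
    then have "epowr (davg Q (\<lambda>x. epowr (?w x) (1 + \<delta>))) (1 / (r * (1 + \<delta>)))
        \<le> epowr (ennreal C * epowr (davg Q ?w) (1 + \<delta>)) (1 / (r * (1 + \<delta>)))"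
      using r \<delta> by (intro epowr_mono) auto
    also have "\<dots> = ennreal (C powr (1 / (r * (1 + \<delta>)))) * epowr (davg Q ?w) (1 / r)"
    proof -
      have "(1 + \<delta>) * (1 / (r * (1 + \<delta>))) = 1 / r"
        using \<delta> r nonzero_mult_divide_mult_cancel_right[of "1 + \<delta>" 1 r] by simp
      then show ?thesis using C by (simp add: epowr_mult epowr_epowr epowr_ennreal)
    qed
    also have "epowr (davg Q ?w) (1 / r) = rho V r (dcube Q) e"
      by (simp add: rho_def davg_def)
    also have "epowr (davg Q (\<lambda>x. epowr (?w x) (1 + \<delta>))) (1 / (r * (1 + \<delta>))) = rho V (r + r * \<delta>) (dcube Q) e"
      using r \<delta> by (simp add: rho_def davg_def epowr_ennreal powr_powr distrib_left)
    finally show ?thesis .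
  qed
  then show ?thesis using r \<delta> C by (intro exI[of _ "r * \<delta>"] conjI exI[of _ "C powr (1 / (r * (1 + \<delta>)))"]) auto
qed

section \<open>Weighted averages and reducing seminorms\<close>

lemma dvol_nonneg [simp]: "0 \<le> dvol Q"
  by (simp add: less_imp_le)

lemma wint_mono: "A \<subseteq> B \<Longrightarrow> wint V r e A \<le> wint V r e B"
  unfolding wint_def by (intro nn_integral_mono) (auto simp: indicator_def)

text \<open>A neighbour of the ancestor of R need not contain R, but the triple of the ancestor
  contains both. Doubling is applied from R to the triple, and passing down to the neighbour costs
  only the ratio of volumes.\<close>

lemma doubling_neighbour:
  fixes V :: "real ^ 'n \<Rightarrow> 'a::real_normed_vector \<Rightarrow>\<^sub>L 'a"
  assumes r: "0 < r" and dd: "has_doubling_dimension V r \<beta>"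
  shows "\<exists>C>0. \<forall>l R e. \<forall>\<nu>\<in>nbrs. rho V r (dcube (fst R - int l, anc l (snd R) + \<nu>)) e
    \<le> ennreal (C * 2 powr (real l * (\<beta> - real CARD('n)) / r)) * rho V r (dcube R) e"
proof -
  obtain C0 :: real where C0: "\<And>a b l m e. 0 < l \<Longrightarrow> 0 < m \<Longrightarrow> cube a l \<subseteq> cube b m \<Longrightarrow>
      rho V r (cube b m) e \<le> ennreal (C0 * (m / l) powr ((\<beta> - real CARD('n)) / r)) * rho V r (cube a l) e"
    using dd unfolding has_doubling_dimension_def by meson
  \<comment> \<open>The first factor is the volume ratio 3^n of the triple to the neighbour; the
    power of 3 at the end appears because the triple has side 3 2^l times that of R.\<close>
  define C where "C = (3 ^ CARD('n)) powr (1 / r) * (max C0 1 * 3 powr ((\<beta> - real CARD('n)) / r))"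
  have "0 < C" by (simp add: C_def)
  moreover have "rho V r (dcube (fst R - int l, anc l (snd R) + \<nu>)) e
    \<le> ennreal (C * 2 powr (real l * (\<beta> - real CARD('n)) / r)) * rho V r (dcube R) e"
    if \<nu>: "\<nu> \<in> nbrs" for l e and R :: "'n dyadic" and \<nu>
  proof -
    let ?T = "parent l R" and ?S = "(fst R - int l, anc l (snd R) + \<nu>)"
    let ?\<gamma> = "(\<beta> - real CARD('n)) / r"
    have T: "?T = (fst R - int l, anc l (snd R))" by (simp add: parent_def)
    have S: "dcube ?S \<subseteq> dtriple ?T" unfolding T by (rule dcube_nbr_subset_dtriple[OF \<nu>])
    have "dcube R \<subseteq> dtriple ?T"
      using dcube_parent[of R l] dcube_nbr_subset_dtriple[OF zero_nbrs, of "fst ?T" "snd ?T"] by simp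
    then have "rho V r (dtriple ?T) e \<le> ennreal (C0 * (3 * dlen ?T / dlen R) powr ?\<gamma>) * rho V r (dcube R) e"
      unfolding dtriple_def dcube_def by (intro C0) auto
    also have "\<dots> \<le> ennreal (max C0 1 * (3 * dlen ?T / dlen R) powr ?\<gamma>) * rho V r (dcube R) e"
      by (intro mult_right_mono ennreal_leI) auto
    also have "dlen ?T / dlen R = 2 ^ l"
      by (simp add: T dlen_def power_int_diff power_int_minus)
    then have "3 * dlen ?T / dlen R = 3 * 2 ^ l" by simp
    also have "(3 * 2 ^ l) powr ?\<gamma> = 3 powr ?\<gamma> * 2 powr (real l * (\<beta> - real CARD('n)) / r)"
      by (simp add: powr_mult powr_realpow[symmetric] powr_powr)
    finally have 1: "rho V r (dtriple ?T) e
      \<le> ennreal (max C0 1 * (3 powr ?\<gamma> * 2 powr (real l * (\<beta> - real CARD('n)) / r))) * rho V r (dcube R) e" .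
    have vol: "emeasure lebesgue (dtriple ?T) = ennreal (3 ^ CARD('n)) * emeasure lebesgue (dcube ?S)"
    proof -
      have "emeasure lebesgue (dcube ?S) = emeasure lebesgue (dcube ?T)" unfolding T by (rule emeasure_dcube_level)
      moreover have "(3::ennreal) ^ CARD('n) = ennreal (3 ^ CARD('n))" using ennreal_power[of 3 "CARD('n)"] by simp
      ultimately show ?thesis by (simp add: emeasure_dtriple)
    qed
    have "wint V r e (dcube ?S) / emeasure lebesgue (dcube ?S) \<le> wint V r e (dtriple ?T) / emeasure lebesgue (dcube ?S)"
      by (intro divide_right_mono_ennreal wint_mono S)
    also have "\<dots> = ennreal (3 ^ CARD('n)) * (wint V r e (dtriple ?T) / emeasure lebesgue (dtriple ?T))"
    proof -
      have "ennreal (3 ^ CARD('n)) * inverse (ennreal (3 ^ CARD('n) * dvol ?S)) = inverse (ennreal (dvol ?S))"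
        by (simp add: inverse_ennreal ennreal_mult[symmetric])
      then show ?thesis
        unfolding vol emeasure_dcube_dvol divide_ennreal_def
        by (simp add: ennreal_mult mult.left_commute[of "ennreal (3 ^ CARD('n))"])
    qed
    finally have "rho V r (dcube ?S) e
        \<le> epowr (ennreal (3 ^ CARD('n)) * (wint V r e (dtriple ?T) / emeasure lebesgue (dtriple ?T))) (1 / r)"
      unfolding rho_eq_epowr using r by (intro epowr_mono) auto
    also have "\<dots> = ennreal ((3 ^ CARD('n)) powr (1 / r)) * rho V r (dtriple ?T) e"
      by (simp add: rho_eq_epowr epowr_mult epowr_ennreal)
    also have "\<dots> \<le> ennreal ((3 ^ CARD('n)) powr (1 / r)) *
        (ennreal (max C0 1 * (3 powr ?\<gamma> * 2 powr (real l * (\<beta> - real CARD('n)) / r))) * rho V r (dcube R) e)"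
      by (rule mult_left_mono[OF 1]) simp
    also have "\<dots> = ennreal (C * 2 powr (real l * (\<beta> - real CARD('n)) / r)) * rho V r (dcube R) e"
      by (simp add: C_def mult.assoc[symmetric] ennreal_mult[symmetric])
    finally show ?thesis .
  qed
  ultimately show ?thesis by blast
qed

text \<open>Up to a power of 2 depending on the level, this is the A-th power of
  \<open>averaged_part\<close>; \<open>wavg V A 0 0\<close> has the same relation to
  \<open>pointwise_part\<close>.\<close>

definition seqf :: "(real ^ 'n \<Rightarrow> 'a::real_normed_vector \<Rightarrow>\<^sub>L 'a) \<Rightarrow> real \<Rightarrow> real \<Rightarrow> ('n dyadic \<Rightarrow> 'a)
    \<Rightarrow> int \<Rightarrow> real ^ 'n \<Rightarrow> ennreal" where
  "seqf V r A t i x = epowr (rho V r (dcube (i, cell i x)) (t (i, cell i x))) A"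

text \<open>\<open>wavg V A l \<nu> t i x\<close> sums over the cubes of level \<open>i\<close> whose \<open>l\<close>-th ancestor is the translate by \<open>-\<nu>\<close>
  of the cube of level \<open>i - l\<close> containing \<open>x\<close>.\<close>

definition wavg :: "(real ^ 'n \<Rightarrow> 'a::real_normed_vector \<Rightarrow>\<^sub>L 'a) \<Rightarrow> real \<Rightarrow> nat \<Rightarrow> int ^ 'n \<Rightarrow> ('n dyadic \<Rightarrow> 'a)
    \<Rightarrow> int \<Rightarrow> real ^ 'n \<Rightarrow> ennreal" where
  "wavg V A l \<nu> t i x = csum (\<lambda>k. epowr (ennreal (norm (blinfun_apply (V x) (t (i, k))))) A
     * indicator (dcube (i - int l, anc l k + \<nu>)) x)"

lemma seqf_csum: "seqf V r A t i x = csum (\<lambda>k. epowr (rho V r (dcube (i, k)) (t (i, k))) A * indicator (dcube (i, k)) x)"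
  by (simp add: seqf_def csum_cell)

lemma seqf_measurable [measurable]: "seqf V r A t i \<in> borel_measurable lebesgue"
  unfolding seqf_csum[abs_def] by (intro borel_measurable_csum) measurable

lemma wavg_measurable:
  assumes "weight smul UNIV V"
  shows "wavg V A l \<nu> t i \<in> borel_measurable lebesgue"
proof -
  note [measurable] = weight_norm_measurable[OF assms UNIV_I]
  show ?thesis unfolding wavg_def[abs_def] by (intro borel_measurable_csum) measurable
qed

lemma wavg_0: "wavg V A 0 0 t i x = epowr (ennreal (norm (blinfun_apply (V x) (t (i, cell i x))))) A"
  by (simp add: wavg_def csum_cell)

lemma davg_epowr_eq_rho:
  assumes "0 < A" "0 < r"
  shows "epowr (davg Q (\<lambda>x. epowr (ennreal (norm (blinfun_apply (V x) e))) r)) (A / r) = epowr (rho V r (dcube Q) e) A"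
  using assms by (simp add: rho_def davg_def epowr_ennreal epowr_epowr)

lemma davg_Hoelder:
  assumes U: "1 < U" "1 < U'" "1 / U + 1 / U' = 1"
    and [measurable]: "f \<in> borel_measurable lebesgue" "h \<in> borel_measurable lebesgue"
  shows "(\<integral>\<^sup>+x\<in>dcube Q. f x * h x \<partial>lebesgue) \<le> epowr (davg Q (\<lambda>x. epowr (f x) U)) (1 / U)
    * epowr (davg Q (\<lambda>x. epowr (h x) U')) (1 / U') * emeasure lebesgue (dcube Q)"
proof -
  let ?v = "emeasure lebesgue (dcube Q)"
  have i: "(\<integral>\<^sup>+x. epowr (g x * indicator (dcube Q) x) a \<partial>lebesgue) = davg Q (\<lambda>x. epowr (g x) a) * ?v" for g a
    unfolding davg_times by (intro nn_integral_cong) (simp add: indicator_def)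
  have "(\<integral>\<^sup>+x\<in>dcube Q. f x * h x \<partial>lebesgue)
      = (\<integral>\<^sup>+x. (f x * indicator (dcube Q) x) * (h x * indicator (dcube Q) x) \<partial>lebesgue)"
    by (intro nn_integral_cong) (simp add: indicator_def)
  also have "\<dots> \<le> epowr (davg Q (\<lambda>x. epowr (f x) U) * ?v) (1 / U) * epowr (davg Q (\<lambda>x. epowr (h x) U') * ?v) (1 / U')"
    unfolding i[symmetric] by (rule Hoelder_nn_integral[OF U]) auto
  also have "\<dots> = epowr (davg Q (\<lambda>x. epowr (f x) U)) (1 / U) * epowr (davg Q (\<lambda>x. epowr (h x) U')) (1 / U')
      * (epowr ?v (1 / U) * epowr ?v (1 / U'))"
    unfolding epowr_mult by (simp only: ac_simps)
  also have "epowr ?v (1 / U) * epowr ?v (1 / U') = ?v" using U by (simp add: epowr_add)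
  finally show ?thesis .
qed

lemma exists_uniform_constant:
  assumes "finite I" "\<And>i. i \<in> I \<Longrightarrow> \<exists>C::real. 0 < C \<and> P i C" and mono: "\<And>i C D. P i C \<Longrightarrow> C \<le> D \<Longrightarrow> P i D"
  shows "\<exists>C::real. 0 < C \<and> (\<forall>i\<in>I. P i C)"
  using assms(1,2)
proof (induction I)
  case empty
  then show ?case by (intro exI[of _ 1]) simp
next
  case (insert i I)
  obtain C where "0 < C" "\<forall>i\<in>I. P i C" using insert by auto
  moreover obtain D where "0 < D" "P i D" using insert by auto
  ultimately show ?case by (intro exI[of _ "max C D"]) (auto intro: mono)
qed

lemma avgop_mix_uniform:
  assumes P: "1 < P" and Q: "1 < Q"
  shows "\<exists>C::real. 0 < C \<and> (\<forall>\<nu>\<in>nbrs. \<forall>c (f :: 'i::countable \<Rightarrow> real ^ 'n \<Rightarrow> ennreal). (\<forall>i. f i \<in> borel_measurable lebesgue) \<longrightarrow>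
    mix lebesgue P Q (\<lambda>i. avgop (c i) \<nu> (f i)) \<le> ennreal C * mix lebesgue P Q f)"
proof (rule exists_uniform_constant[OF finite_nbrs avgop_mix[OF _ P Q]])
  fix \<nu> :: "int ^ 'n" and C D :: real
  assume C: "\<forall>c (f :: 'i \<Rightarrow> real ^ 'n \<Rightarrow> ennreal). (\<forall>i. f i \<in> borel_measurable lebesgue) \<longrightarrow>
    mix lebesgue P Q (\<lambda>i. avgop (c i) \<nu> (f i)) \<le> ennreal C * mix lebesgue P Q f" and "C \<le> D"
  show "\<forall>c (f :: 'i \<Rightarrow> real ^ 'n \<Rightarrow> ennreal). (\<forall>i. f i \<in> borel_measurable lebesgue) \<longrightarrow>
    mix lebesgue P Q (\<lambda>i. avgop (c i) \<nu> (f i)) \<le> ennreal D * mix lebesgue P Q f"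
  proof (intro allI impI)
    fix c and f :: "'i \<Rightarrow> real ^ 'n \<Rightarrow> ennreal" assume "\<forall>i. f i \<in> borel_measurable lebesgue"
    then have "mix lebesgue P Q (\<lambda>i. avgop (c i) \<nu> (f i)) \<le> ennreal C * mix lebesgue P Q f" using C by blast
    also have "\<dots> \<le> ennreal D * mix lebesgue P Q f" by (intro mult_right_mono ennreal_leI \<open>C \<le> D\<close>) simp
    finally show "mix lebesgue P Q (\<lambda>i. avgop (c i) \<nu> (f i)) \<le> ennreal D * mix lebesgue P Q f" .
  qed
qed

text \<open>On each cube S of the larger scale, Hoelder's inequality with exponent U0 / A separates
  V from h. The factor with V is a seminorm over S, which the hypothesis compares with the one over
  R = (i, k). The product of the two factors is a constant, and writing its integral over S as one
  over R costs |S|/|R| = 2^(l n).\<close>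

lemma wavg_pairing:
  fixes V :: "real ^ 'n \<Rightarrow> 'a::real_normed_vector \<Rightarrow>\<^sub>L 'a"
  assumes V: "weight smul UNIV V" and A: "0 < A" and U0: "A < U0"
    and U': "U' = (U0 / A) / (U0 / A - 1)"
    and c: "0 < c" "\<And>k. rho V U0 (dcube (i - int l, anc l k + \<nu>)) (t (i, k)) \<le> ennreal c * rho V r (dcube (i, k)) (t (i, k))"
    and [measurable]: "h \<in> borel_measurable lebesgue"
  shows "(\<integral>\<^sup>+x. wavg V A l \<nu> t i x * h x \<partial>lebesgue) \<le> ennreal (c powr A * 2 powr (real l * real CARD('n)))
    * (\<integral>\<^sup>+x. seqf V r A t i x * epowr (avgop (i - int l) \<nu> (\<lambda>x. epowr (h x) U') x) (1 / U') \<partial>lebesgue)"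
proof -
  note [measurable] = weight_norm_measurable[OF V UNIV_I]
  define U where "U = U0 / A"
  have U: "1 < U" using A U0 by (simp add: U_def)
  have UU: "1 < U'" "1 / U + 1 / U' = 1" using conjugate_exponent[OF U] by (auto simp: U' U_def)
  let ?S = "\<lambda>k. (i - int l, anc l k + \<nu>)"
  let ?m = "\<lambda>k. epowr (davg (?S k) (\<lambda>x. epowr (h x) U')) (1 / U')"
  let ?a = "\<lambda>k. epowr (rho V r (dcube (i, k)) (t (i, k))) A"
  let ?n = "\<lambda>k x. epowr (ennreal (norm (blinfun_apply (V x) (t (i, k))))) A"
  let ?c = "ennreal (c powr A * 2 powr (real l * real CARD('n)))"
  have vol: "emeasure lebesgue (dcube (?S k)) = ennreal (2 powr (real l * real CARD('n))) * emeasure lebesgue (dcube (i, k))" for k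
    by (simp add: emeasure_dcube_dvol dvol_level ennreal_mult[symmetric] powr_add[symmetric] algebra_simps)
  have "(\<integral>\<^sup>+x\<in>dcube (?S k). ?n k x * h x \<partial>lebesgue) \<le> ?c * (?a k * ?m k * emeasure lebesgue (dcube (i, k)))" for k
  proof -
    have "epowr (davg (?S k) (\<lambda>x. epowr (?n k x) U)) (1 / U) = epowr (rho V U0 (dcube (?S k)) (t (i, k))) A"
      using davg_epowr_eq_rho[of A U0 "?S k" V "t (i, k)"] A U0 by (simp add: epowr_epowr U_def)
    also have "\<dots> \<le> epowr (ennreal c * rho V r (dcube (i, k)) (t (i, k))) A"
      using A c(2) by (intro epowr_mono) auto
    also have "\<dots> = ennreal (c powr A) * ?a k" using c(1) by (simp add: epowr_mult epowr_ennreal)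
    finally have le: "epowr (davg (?S k) (\<lambda>x. epowr (?n k x) U)) (1 / U) \<le> ennreal (c powr A) * ?a k" .
    have "(\<integral>\<^sup>+x\<in>dcube (?S k). ?n k x * h x \<partial>lebesgue)
        \<le> epowr (davg (?S k) (\<lambda>x. epowr (?n k x) U)) (1 / U) * ?m k * emeasure lebesgue (dcube (?S k))"
      by (rule davg_Hoelder[OF U UU]) auto
    also have "\<dots> \<le> (ennreal (c powr A) * ?a k) * ?m k * emeasure lebesgue (dcube (?S k))"
      by (intro mult_right_mono le) auto
    also have "\<dots> = (ennreal (c powr A) * ennreal (2 powr (real l * real CARD('n)))) * (?a k * ?m k * emeasure lebesgue (dcube (i, k)))"
      unfolding vol by (simp only: ac_simps)
    finally show ?thesis by (simp add: ennreal_mult)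
  qed
  note each = this
  have "(\<integral>\<^sup>+x. wavg V A l \<nu> t i x * h x \<partial>lebesgue)
      = (\<integral>\<^sup>+x. csum (\<lambda>k. ?n k x * h x * indicator (dcube (?S k)) x) \<partial>lebesgue)"
    unfolding wavg_def csum_multc[symmetric] by (simp only: ac_simps)
  also have "\<dots> = csum (\<lambda>k. \<integral>\<^sup>+x\<in>dcube (?S k). ?n k x * h x \<partial>lebesgue)"
    by (rule nn_integral_csum) simp
  also have "\<dots> \<le> csum (\<lambda>k. ?c * (?a k * ?m k * emeasure lebesgue (dcube (i, k))))"
    by (intro csum_mono each)
  also have "\<dots> = ?c * csum (\<lambda>k. ?a k * ?m k * emeasure lebesgue (dcube (i, k)))" by (rule csum_cmult)
  also have "csum (\<lambda>k. ?a k * ?m k * emeasure lebesgue (dcube (i, k)))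
      = csum (\<lambda>k. \<integral>\<^sup>+x\<in>dcube (i, k). seqf V r A t i x * epowr (avgop (i - int l) \<nu> (\<lambda>x. epowr (h x) U') x) (1 / U') \<partial>lebesgue)"
  proof (rule nn_integral_cong)
    fix k :: "int ^ 'n"
    have "(\<integral>\<^sup>+x\<in>dcube (i, k). seqf V r A t i x * epowr (avgop (i - int l) \<nu> (\<lambda>x. epowr (h x) U') x) (1 / U') \<partial>lebesgue)
        = (\<integral>\<^sup>+x. ?a k * ?m k * indicator (dcube (i, k)) x \<partial>lebesgue)"
      by (intro nn_integral_cong) (auto simp: indicator_def mem_dcube seqf_def avgop_def anc_cell)
    then show "?a k * ?m k * emeasure lebesgue (dcube (i, k)) = (\<integral>\<^sup>+x\<in>dcube (i, k).
        seqf V r A t i x * epowr (avgop (i - int l) \<nu> (\<lambda>x. epowr (h x) U') x) (1 / U') \<partial>lebesgue)"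
      by (simp add: nn_integral_cmult_indicator)
  qed
  also have "\<dots> = (\<integral>\<^sup>+x. seqf V r A t i x * epowr (avgop (i - int l) \<nu> (\<lambda>x. epowr (h x) U') x) (1 / U') \<partial>lebesgue)"
    by (rule nn_integral_dcubes[symmetric]) simp
  finally show ?thesis .
qed

text \<open>By duality the averages fall on U'-th powers of h. Conjugation turns p, q < U0 into U' <
  P' and U' < Q', so these averages are bounded for the exponents P'/U' and Q'/U'. The growth in l
  combines the volume ratio 2^(l n) with the A-th power of the doubling factor.\<close>

lemma wavg_mix:
  fixes V :: "real ^ 'n \<Rightarrow> 'a::real_normed_vector \<Rightarrow>\<^sub>L 'a"
  assumes V: "weight smul UNIV V" and r: "0 < r" and dd: "has_doubling_dimension V r \<beta>"
    and RH: "0 < C0" "\<And>Q e. rho V U0 (dcube Q) e \<le> ennreal C0 * rho V r (dcube Q) e"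
    and A: "0 < A" "A < p" "A < q" and U0: "p < U0" "q < U0"
  shows "\<exists>C>0. \<forall>l. \<forall>\<nu>\<in>nbrs. \<forall>t (g :: int \<Rightarrow> ennreal).
    mix lebesgue (p / A) (q / A) (\<lambda>i x. g i * wavg V A l \<nu> t i x)
      \<le> ennreal (C * 2 powr (real l * (real CARD('n) + A * (\<beta> - real CARD('n)) / r)))
        * mix lebesgue (p / A) (q / A) (\<lambda>i x. g i * seqf V r A t i x)"
proof -
  obtain C1 where C1: "0 < C1" "\<And>l R e \<nu>. \<nu> \<in> nbrs \<Longrightarrow> rho V r (dcube (fst R - int l, anc l (snd R) + \<nu>)) e
    \<le> ennreal (C1 * 2 powr (real l * (\<beta> - real CARD('n)) / r)) * rho V r (dcube R) e"
    using doubling_neighbour[OF r dd] by metis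
  define P where "P = p / A"
  define Q where "Q = q / A"
  define U where "U = U0 / A"
  define P' where "P' = P / (P - 1)"
  define Q' where "Q' = Q / (Q - 1)"
  define U' where "U' = U / (U - 1)"
  have PQ: "1 < P" "1 < Q" and PU: "P < U" "Q < U" and U: "1 < U"
    using A U0 by (auto simp: P_def Q_def U_def divide_strict_right_mono)
  have P': "1 < P'" "1 / P + 1 / P' = 1" and Q': "1 < Q'" "1 / Q + 1 / Q' = 1" and U': "1 < U'" "1 / U + 1 / U' = 1"
    using conjugate_exponent[OF PQ(1)] conjugate_exponent[OF PQ(2)] conjugate_exponent[OF U]
    by (auto simp: P'_def Q'_def U'_def)
  have PU': "1 < P' / U'" "1 < Q' / U'"
    using PU PQ U by (simp_all add: P'_def Q'_def U'_def field_simps)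
  obtain C2 :: real where C2_pos: "0 < C2" and C2: "\<forall>\<nu>\<in>nbrs. \<forall>c (f :: int \<Rightarrow> real ^ 'n \<Rightarrow> ennreal).
    (\<forall>i. f i \<in> borel_measurable lebesgue) \<longrightarrow>
    mix lebesgue (P' / U') (Q' / U') (\<lambda>i. avgop (c i) \<nu> (f i)) \<le> ennreal C2 * mix lebesgue (P' / U') (Q' / U') f"
    using avgop_mix_uniform[OF PU'] by blast
  define C where "C = (C0 * C1) powr A * C2 powr (1 / U')"
  have "0 < C" using RH C1 C2_pos by (simp add: C_def)
  moreover have "mix lebesgue P Q (\<lambda>i x. g i * wavg V A l \<nu> t i x)
      \<le> ennreal (C * 2 powr (real l * (real CARD('n) + A * (\<beta> - real CARD('n)) / r)))
        * mix lebesgue P Q (\<lambda>i x. g i * seqf V r A t i x)"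
    if \<nu>: "\<nu> \<in> nbrs" for l \<nu> t and g :: "int \<Rightarrow> ennreal"
  proof (rule mix_le_of_dual[OF sigma_finite_lebesgue PQ(1) P' PQ(2) Q'])
    note [measurable] = wavg_measurable[OF V]
    show "(\<lambda>x. g i * wavg V A l \<nu> t i x) \<in> borel_measurable lebesgue" for i by measurable
    fix h :: "int \<Rightarrow> real ^ 'n \<Rightarrow> ennreal" assume h [measurable]: "\<And>i. h i \<in> borel_measurable lebesgue"
    define c where "c = C0 * (C1 * 2 powr (real l * (\<beta> - real CARD('n)) / r))"
    have c: "0 < c" using RH C1 by (simp add: c_def)
    let ?M = "\<lambda>i x. epowr (avgop (i - int l) \<nu> (\<lambda>x. epowr (h i x) U') x) (1 / U')"
    let ?c = "ennreal (c powr A * 2 powr (real l * real CARD('n)))"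
    have pair: "(\<integral>\<^sup>+x. wavg V A l \<nu> t i x * h i x \<partial>lebesgue) \<le> ?c * (\<integral>\<^sup>+x. seqf V r A t i x * ?M i x \<partial>lebesgue)" for i
    proof (rule wavg_pairing[OF V A(1) _ _ c])
      show "A < U0" using A U0 by simp
      show "U' = (U0 / A) / (U0 / A - 1)" by (simp add: U'_def U_def)
      fix k :: "int ^ 'n"
      have "rho V U0 (dcube (i - int l, anc l k + \<nu>)) (t (i, k)) \<le> ennreal C0 * rho V r (dcube (i - int l, anc l k + \<nu>)) (t (i, k))"
        by (rule RH)
      also have "\<dots> \<le> ennreal C0 * (ennreal (C1 * 2 powr (real l * (\<beta> - real CARD('n)) / r)) * rho V r (dcube (i, k)) (t (i, k)))"
        using C1(2)[OF \<nu>, of "(i, k)" l] by (intro mult_left_mono) auto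
      also have "\<dots> = ennreal c * rho V r (dcube (i, k)) (t (i, k))"
        using RH C1 by (simp add: c_def mult.assoc[symmetric] ennreal_mult[symmetric])
      finally show "rho V U0 (dcube (i - int l, anc l k + \<nu>)) (t (i, k)) \<le> ennreal c * rho V r (dcube (i, k)) (t (i, k))" .
    qed simp
    have "csum (\<lambda>i. \<integral>\<^sup>+x. g i * wavg V A l \<nu> t i x * h i x \<partial>lebesgue)
        = csum (\<lambda>i. g i * (\<integral>\<^sup>+x. wavg V A l \<nu> t i x * h i x \<partial>lebesgue))"
      by (simp add: nn_integral_cmult[symmetric] mult.assoc)
    also have "\<dots> \<le> csum (\<lambda>i. g i * (?c * (\<integral>\<^sup>+x. seqf V r A t i x * ?M i x \<partial>lebesgue)))"
      by (intro csum_mono mult_left_mono pair) simp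
    also have "\<dots> = ?c * csum (\<lambda>i. \<integral>\<^sup>+x. (g i * seqf V r A t i x) * ?M i x \<partial>lebesgue)"
      by (simp add: nn_integral_cmult[symmetric] csum_cmult[symmetric] ac_simps)
    also have "\<dots> \<le> ?c * (mix lebesgue P Q (\<lambda>i x. g i * seqf V r A t i x) * mix lebesgue P' Q' ?M)"
      by (intro mult_left_mono mix_Hoelder PQ P' Q') auto
    also have "mix lebesgue P' Q' ?M \<le> ennreal (C2 powr (1 / U')) * mix lebesgue P' Q' h"
    proof -
      have *: "mix lebesgue P' Q' (\<lambda>i x. epowr (f i x) (1 / U')) = epowr (mix lebesgue (P' / U') (Q' / U') f) (1 / U')"
        for f :: "int \<Rightarrow> real ^ 'n \<Rightarrow> ennreal"
        using mix_epowr[of "1 / U'" P' Q' lebesgue f] U' P' Q' by simp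
      have "mix lebesgue P' Q' ?M = epowr (mix lebesgue (P' / U') (Q' / U') (\<lambda>i. avgop (i - int l) \<nu> (\<lambda>x. epowr (h i x) U'))) (1 / U')"
        by (rule *)
      also have "\<dots> \<le> epowr (ennreal C2 * mix lebesgue (P' / U') (Q' / U') (\<lambda>i x. epowr (h i x) U')) (1 / U')"
        using U' by (intro epowr_mono C2[rule_format] \<nu>) auto
      also have "\<dots> = ennreal (C2 powr (1 / U')) * mix lebesgue P' Q' h"
        using C2_pos U' *[of "\<lambda>i x. epowr (h i x) U'"] by (simp add: epowr_mult epowr_ennreal epowr_epowr)
      finally show ?thesis .
    qed
    also have "?c * (mix lebesgue P Q (\<lambda>i x. g i * seqf V r A t i x) * (ennreal (C2 powr (1 / U')) * mix lebesgue P' Q' h))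
        = (?c * ennreal (C2 powr (1 / U'))) * mix lebesgue P Q (\<lambda>i x. g i * seqf V r A t i x) * mix lebesgue P' Q' h"
      by (simp only: ac_simps)
    also have "?c * ennreal (C2 powr (1 / U')) = ennreal (C * 2 powr (real l * (real CARD('n) + A * (\<beta> - real CARD('n)) / r)))"
    proof -
      have "c powr A = (C0 * C1) powr A * 2 powr (real l * (\<beta> - real CARD('n)) / r * A)"
        using RH C1 by (simp add: c_def powr_mult powr_powr)
      moreover have "(2::real) powr (real l * (\<beta> - real CARD('n)) / r * A) * 2 powr (real l * real CARD('n))
          = 2 powr (real l * (real CARD('n) + A * (\<beta> - real CARD('n)) / r))"
        by (simp add: powr_add[symmetric] algebra_simps diff_divide_distrib)
      ultimately have "c powr A * 2 powr (real l * real CARD('n)) * C2 powr (1 / U')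
          = C * 2 powr (real l * (real CARD('n) + A * (\<beta> - real CARD('n)) / r))"
        by (simp add: C_def ac_simps)
      then show ?thesis by (simp add: ennreal_mult[symmetric])
    qed
    finally show "csum (\<lambda>i. \<integral>\<^sup>+x. g i * wavg V A l \<nu> t i x * h i x \<partial>lebesgue)
      \<le> ennreal (C * 2 powr (real l * (real CARD('n) + A * (\<beta> - real CARD('n)) / r)))
        * mix lebesgue P Q (\<lambda>i x. g i * seqf V r A t i x) * mix lebesgue P' Q' h"
      by (simp add: mult_left_mono)
  qed
  ultimately show ?thesis unfolding P_def Q_def by blast
qed

text \<open>Let E be the part of Q on which |V e| \<ge> \<kappa> \<rho>(e). If E had less than half
  the measure, its complement would control the whole integral up to the factor K, although |V e|^r
  \<le> \<kappa>^r \<rho>(e)^r there. So E is large, and averages of every positive power of |V e|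
  see it.\<close>

lemma rho_le_davg:
  fixes smul :: "'k::real_or_complex \<Rightarrow> 'a::banach \<Rightarrow> 'a" and V :: "real ^ 'n \<Rightarrow> 'a \<Rightarrow>\<^sub>L 'a"
  assumes smul: "normed_space_over smul" and Ap: "Ap_weight smul r V" and A: "0 < A"
  shows "\<exists>C>0. \<forall>Q e. epowr (rho V r (dcube Q) e) A \<le> ennreal C * davg Q (\<lambda>x. epowr (ennreal (norm (blinfun_apply (V x) e))) A)"
proof -
  have r: "0 < r" and V: "p_weight smul UNIV r V" using Ap by (auto simp: Ap_weight_def)
  obtain K where K: "1 \<le> K" "\<And>Q e E. E \<in> sets lebesgue \<Longrightarrow> E \<subseteq> dcube Q \<Longrightarrow>
    emeasure lebesgue (dcube Q) \<le> 2 * emeasure lebesgue E \<Longrightarrow> wint V r e (dcube Q) \<le> ennreal K * wint V r e E"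
    using Ap_lower[OF smul Ap] by blast
  \<comment> \<open>Chosen so that K \<kappa>^r = 1/2, which contradicts the lower bound when E is
    small.\<close>
  define \<kappa> where "\<kappa> = (1 / (2 * K)) powr (1 / r)"
  have \<kappa>: "0 < \<kappa>" "K * \<kappa> powr r = 1 / 2" using K r by (auto simp: \<kappa>_def powr_powr)
  have "epowr (rho V r (dcube Q) e) A \<le> ennreal (2 / \<kappa> powr A) * davg Q (\<lambda>x. epowr (ennreal (norm (blinfun_apply (V x) e))) A)" for Q e
  proof (cases "rho V r (dcube Q) e = 0")
    case False
    note weight_norm_measurable[OF p_weightD(1)[OF V] UNIV_I, measurable]
    let ?v = "emeasure lebesgue (dcube Q)"
    have fin: "rho V r (dcube Q) e < top" using rho_finite[OF smul V r] .
    define \<rho> where "\<rho> = enn2real (rho V r (dcube Q) e)"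
    have \<rho>: "rho V r (dcube Q) e = ennreal \<rho>" using fin by (simp add: \<rho>_def)
    have "0 < \<rho>" using False \<rho> by (metis ennreal_0 ennreal_neg linorder_not_le nle_le)
    define E where "E = {x \<in> space lebesgue. x \<in> dcube Q \<and> \<kappa> * \<rho> \<le> norm (blinfun_apply (V x) e)}"
    define E' where "E' = dcube Q - E"
    have [measurable]: "E \<in> sets lebesgue" unfolding E_def by measurable
    have [measurable]: "E' \<in> sets lebesgue" by (simp add: E'_def)
    have EE: "E \<subseteq> dcube Q" "E' \<subseteq> dcube Q" "E \<inter> E' = {}" "dcube Q = E \<union> E'" by (auto simp: E_def E'_def)
    have m: "?v = emeasure lebesgue E + emeasure lebesgue E'" using EE by (subst plus_emeasure) auto
    have wQ: "wint V r e (dcube Q) = ennreal (\<rho> powr r) * ?v"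
      using epowr_rho[OF r, of V "dcube Q" e] \<open>0 < \<rho>\<close>
      by (simp add: \<rho> epowr_ennreal ennreal_divide_times)
    have "?v \<le> 2 * emeasure lebesgue E"
    proof (rule ccontr)
      assume "\<not> ?thesis"
      then have "emeasure lebesgue E + emeasure lebesgue E \<le> emeasure lebesgue E + emeasure lebesgue E'"
        by (simp add: m mult_2 not_le less_imp_le)
      moreover have "emeasure lebesgue E \<noteq> top" using m emeasure_dcube_nz(2)[of Q] by auto
      ultimately have "emeasure lebesgue E \<le> emeasure lebesgue E'" by (simp add: ennreal_add_left_cancel_le)
      then have "?v \<le> 2 * emeasure lebesgue E'" by (simp add: m mult_2)
      then have "wint V r e (dcube Q) \<le> ennreal K * wint V r e E'" using EE by (intro K) auto
      also have "wint V r e E' \<le> (\<integral>\<^sup>+x. ennreal ((\<kappa> * \<rho>) powr r) * indicator (dcube Q) x \<partial>lebesgue)"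
        unfolding wint_def using r
        by (intro nn_integral_mono) (auto simp: E'_def E_def indicator_def intro!: ennreal_leI powr_mono2)
      also have "\<dots> = ennreal ((\<kappa> * \<rho>) powr r) * ?v" by (simp add: nn_integral_cmult_indicator)
      finally have "ennreal (\<rho> powr r) * ?v \<le> ennreal K * (ennreal ((\<kappa> * \<rho>) powr r) * ?v)"
        unfolding wQ by (simp add: mult_left_mono)
      then have "ennreal (\<rho> powr r * dvol Q) \<le> ennreal (K * ((\<kappa> * \<rho>) powr r * dvol Q))"
        using K by (simp add: emeasure_dcube_dvol ennreal_mult[symmetric])
      then have "\<rho> powr r * dvol Q \<le> K * ((\<kappa> * \<rho>) powr r * dvol Q)"
        using K by (subst (asm) ennreal_le_iff) (auto intro!: mult_nonneg_nonneg less_imp_le)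
      also have "\<dots> = (K * \<kappa> powr r) * (\<rho> powr r * dvol Q)" using \<kappa> \<open>0 < \<rho>\<close> by (simp add: powr_mult)
      also have "\<dots> = (\<rho> powr r * dvol Q) / 2" unfolding \<kappa>(2) by simp
      finally show False using \<open>0 < \<rho>\<close> mult_pos_pos[of "\<rho> powr r" "dvol Q"] by simp
    qed
    have "ennreal (\<kappa> powr A) * epowr (rho V r (dcube Q) e) A * emeasure lebesgue E
        = (\<integral>\<^sup>+x. ennreal ((\<kappa> * \<rho>) powr A) * indicator E x \<partial>lebesgue)"
      using \<kappa> \<open>0 < \<rho>\<close> by (simp add: nn_integral_cmult_indicator \<rho> epowr_ennreal powr_mult ennreal_mult)
    also have "\<dots> \<le> (\<integral>\<^sup>+x\<in>dcube Q. epowr (ennreal (norm (blinfun_apply (V x) e))) A \<partial>lebesgue)"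
      using A \<kappa> \<open>0 < \<rho>\<close> by (intro nn_integral_mono) (auto simp: E_def indicator_def epowr_ennreal intro!: ennreal_leI powr_mono2)
    also have "\<dots> = davg Q (\<lambda>x. epowr (ennreal (norm (blinfun_apply (V x) e))) A) * ?v" (is "_ = ?D * _")
      by (rule davg_times[symmetric])
    finally have main: "ennreal (\<kappa> powr A) * epowr (rho V r (dcube Q) e) A * emeasure lebesgue E \<le> ?D * ?v" .
    have "ennreal (\<kappa> powr A) * epowr (rho V r (dcube Q) e) A * ?v
        \<le> ennreal (\<kappa> powr A) * epowr (rho V r (dcube Q) e) A * (2 * emeasure lebesgue E)"
      by (rule mult_left_mono[OF \<open>?v \<le> 2 * emeasure lebesgue E\<close>]) simp
    also have "\<dots> = 2 * (ennreal (\<kappa> powr A) * epowr (rho V r (dcube Q) e) A * emeasure lebesgue E)" by (simp only: ac_simps)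
    also have "\<dots> \<le> 2 * (?D * ?v)" by (rule mult_left_mono[OF main]) simp
    finally have "?v * (ennreal (\<kappa> powr A) * epowr (rho V r (dcube Q) e) A) \<le> ?v * (2 * ?D)" by (simp only: ac_simps)
    then have le: "ennreal (\<kappa> powr A) * epowr (rho V r (dcube Q) e) A \<le> 2 * ?D"
      by (simp add: ennreal_mult_le_mult_iff)
    have "epowr (rho V r (dcube Q) e) A = ennreal (1 / \<kappa> powr A) * (ennreal (\<kappa> powr A) * epowr (rho V r (dcube Q) e) A)"
      using \<kappa>(1) by (simp add: mult.assoc[symmetric] ennreal_mult[symmetric])
    also have "\<dots> \<le> ennreal (1 / \<kappa> powr A) * (2 * ?D)" by (rule mult_left_mono[OF le]) simp
    also have "\<dots> = ennreal (2 / \<kappa> powr A) * ?D"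
    proof -
      have "ennreal (2 / \<kappa> powr A) = ennreal (1 / \<kappa> powr A) * 2"
        using ennreal_mult[of "1 / \<kappa> powr A" 2] by simp
      then show ?thesis by (simp only: mult.assoc)
    qed
    finally show ?thesis .
  qed simp
  moreover have "0 < 2 / \<kappa> powr A" using \<kappa> by simp
  ultimately show ?thesis by blast
qed

text \<open>On a single cube of level i the coefficient is constant, so the A-th power of its
  seminorm is bounded by an average of \<open>wavg\<close> at the same level, and the averaging
  operators with \<open>c i = i\<close> are bounded.\<close>

lemma seqf_mix_le_wavg:
  fixes smul :: "'k::real_or_complex \<Rightarrow> 'a::banach \<Rightarrow> 'a" and V :: "real ^ 'n \<Rightarrow> 'a \<Rightarrow>\<^sub>L 'a"
  assumes smul: "normed_space_over smul" and Ap: "Ap_weight smul r V" and A: "0 < A" "A < p" "A < q"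
  shows "\<exists>C>0. \<forall>t (g :: int \<Rightarrow> ennreal). mix lebesgue (p / A) (q / A) (\<lambda>i x. g i * seqf V r A t i x)
      \<le> ennreal C * mix lebesgue (p / A) (q / A) (\<lambda>i x. g i * wavg V A 0 0 t i x)"
proof -
  have r: "0 < r" and V: "weight smul UNIV V" using Ap by (auto simp: Ap_weight_def p_weight_def)
  obtain C1 where C1: "0 < C1" "\<And>Q e. epowr (rho V r (dcube Q) e) A \<le> ennreal C1 * davg Q (\<lambda>x. epowr (ennreal (norm (blinfun_apply (V x) e))) A)"
    using rho_le_davg[OF smul Ap A(1)] by blast
  have PQ: "1 < p / A" "1 < q / A" using A by auto
  obtain C2 :: real where "0 < C2" and C2: "\<forall>c (f :: int \<Rightarrow> real ^ 'n \<Rightarrow> ennreal). (\<forall>i. f i \<in> borel_measurable lebesgue) \<longrightarrow>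
    mix lebesgue (p / A) (q / A) (\<lambda>i. avgop (c i) 0 (f i)) \<le> ennreal C2 * mix lebesgue (p / A) (q / A) f"
    using avgop_mix[OF zero_nbrs PQ] by blast
  note [measurable] = wavg_measurable[OF V]
  have "mix lebesgue (p / A) (q / A) (\<lambda>i x. g i * seqf V r A t i x)
      \<le> ennreal (C1 * C2) * mix lebesgue (p / A) (q / A) (\<lambda>i x. g i * wavg V A 0 0 t i x)" for t g
  proof -
    have "g i * seqf V r A t i x \<le> ennreal C1 * avgop i 0 (\<lambda>x. g i * wavg V A 0 0 t i x) x" for i x
    proof -
      let ?Q = "(i, cell i x)"
      have "seqf V r A t i x \<le> ennreal C1 * davg ?Q (\<lambda>y. epowr (ennreal (norm (blinfun_apply (V y) (t ?Q)))) A)"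
        unfolding seqf_def by (rule C1)
      also have "davg ?Q (\<lambda>y. epowr (ennreal (norm (blinfun_apply (V y) (t ?Q)))) A) = davg ?Q (wavg V A 0 0 t i)"
        unfolding davg_def
        by (intro arg_cong2[where f = "(/)"] nn_integral_cong) (auto simp: wavg_0 indicator_def mem_dcube)
      finally have "g i * seqf V r A t i x \<le> g i * (ennreal C1 * davg ?Q (wavg V A 0 0 t i))"
        by (rule mult_left_mono) simp
      also have "\<dots> = ennreal C1 * davg ?Q (\<lambda>x. g i * wavg V A 0 0 t i x)"
        by (simp add: davg_def mult.assoc nn_integral_cmult divide_ennreal_def ac_simps)
      finally show ?thesis by (simp add: avgop_def)
    qed
    then have "mix lebesgue (p / A) (q / A) (\<lambda>i x. g i * seqf V r A t i x)
        \<le> mix lebesgue (p / A) (q / A) (\<lambda>i x. ennreal C1 * avgop i 0 (\<lambda>x. g i * wavg V A 0 0 t i x) x)"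
      using PQ by (intro mix_mono) auto
    also have "\<dots> = ennreal C1 * mix lebesgue (p / A) (q / A) (\<lambda>i. avgop i 0 (\<lambda>x. g i * wavg V A 0 0 t i x))"
      using PQ by (intro mix_cmult) auto
    also have "\<dots> \<le> ennreal C1 * (ennreal C2 * mix lebesgue (p / A) (q / A) (\<lambda>i x. g i * wavg V A 0 0 t i x))"
      by (intro mult_left_mono C2[rule_format]) auto
    finally show ?thesis using C1 \<open>0 < C2\<close> by (simp add: ennreal_mult mult.assoc)
  qed
  then show ?thesis using C1 \<open>0 < C2\<close> by (intro exI[of _ "C1 * C2"]) auto
qed

section \<open>Almost diagonal matrices\<close>

text \<open>The index is (level difference, dyadic distance, neighbour). A positive d means that R
  is smaller than Q; \<open>a1\<close> is the rate of decay there, and \<open>a2\<close> the rate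
  for larger R.\<close>

definition coef :: "real \<Rightarrow> real \<Rightarrow> real \<Rightarrow> real \<Rightarrow> int \<times> nat \<times> (int ^ 'n) \<Rightarrow> ennreal" where
  "coef K a a1 a2 = (\<lambda>(d, k, \<nu>). ennreal (K * 2 powr (- (a * real k) - a1 * max (real_of_int d) 0
     - a2 * max (- real_of_int d) 0)) * indicator nbrs \<nu>)"

lemma epowr_coef:
  "0 \<le> K \<Longrightarrow> epowr (coef K a a1 a2 x) \<rho> = coef (K powr \<rho>) (a * \<rho>) (a1 * \<rho>) (a2 * \<rho>) x"
  by (cases x) (auto simp: coef_def epowr_mult epowr_ennreal powr_mult powr_powr indicator_def algebra_simps)

lemma coef_summable:
  assumes a: "0 < a" "0 < a1" "0 < a2" and K: "0 \<le> K"
  shows "csum (coef K a a1 a2 :: int \<times> nat \<times> (int ^ 'n) \<Rightarrow> ennreal) < top"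
proof -
  let ?d = "\<lambda>d::int. ennreal (2 powr (- (a1 * max (real_of_int d) 0) - a2 * max (- real_of_int d) 0))"
  have eq: "coef K a a1 a2 (d, k, \<nu>) = ennreal K * (?d d * (ennreal (2 powr (- (a * real k))) * indicator nbrs \<nu>))"
    for d k and \<nu> :: "int ^ 'n"
  proof -
    have "(2::real) powr (- (a * real k) - a1 * max (real_of_int d) 0 - a2 * max (- real_of_int d) 0)
        = 2 powr (- (a1 * max (real_of_int d) 0) - a2 * max (- real_of_int d) 0) * 2 powr (- (a * real k))"
      by (simp add: powr_add[symmetric] algebra_simps)
    then have "ennreal (2 powr (- (a * real k) - a1 * max (real_of_int d) 0 - a2 * max (- real_of_int d) 0))
        = ?d d * ennreal (2 powr (- (a * real k)))" by (simp add: ennreal_mult)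
    then show ?thesis unfolding coef_def by (simp add: ennreal_mult[OF K] mult.assoc)
  qed
  have nb: "csum (indicator (nbrs :: (int ^ 'n) set) :: int ^ 'n \<Rightarrow> ennreal) < top"
    by (simp add: of_nat_less_top)
  have ks: "csum (\<lambda>k::nat. ennreal (2 powr (- (a * real k)))) < top"
  proof -
    have "2 powr (- (a * real k)) = 1 * (2 powr (- a)) ^ k" for k
      by (simp add: powr_realpow[symmetric] powr_powr)
    then have "csum (\<lambda>k::nat. ennreal (2 powr (- (a * real k)))) = (\<Sum>k. ennreal (1 * (2 powr (- a)) ^ k))"
      by (simp only: nn_integral_count_space_nat)
    also have "\<dots> = ennreal (1 / (1 - 2 powr (- a)))"
      using a by (intro suminf_geometric_ennreal) (auto simp: powr_less_one)
    finally show ?thesis by simp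
  qed
  have ds: "csum ?d < top"
  proof -
    have "?d d \<le> ennreal (2 powr (a2 * d)) * indicator {..0::int} d + ennreal (2 powr (a1 * real_of_int (- d))) * indicator {..0::int} (- d)" for d
      by (cases "0 \<le> d") (auto simp: indicator_def max_def intro!: ennreal_leI)
    then have "csum ?d \<le> csum (\<lambda>d::int. ennreal (2 powr (a2 * d)) * indicator {..0::int} d
        + ennreal (2 powr (a1 * real_of_int (- d))) * indicator {..0::int} (- d))"
      by (rule csum_mono)
    also have "\<dots> = csum (\<lambda>d::int. ennreal (2 powr (a2 * d)) * indicator {..0::int} d)
        + csum (\<lambda>d::int. ennreal (2 powr (a1 * real_of_int (- d))) * indicator {..0::int} (- d))"
      by (rule csum_add)
    also have "csum (\<lambda>d::int. ennreal (2 powr (a1 * real_of_int (- d))) * indicator {..0::int} (- d))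
        = csum (\<lambda>d::int. ennreal (2 powr (a1 * real_of_int d)) * indicator {..0::int} d)"
      by (rule csum_reindex[of uminus "\<lambda>d::int. ennreal (2 powr (a1 * real_of_int d)) * indicator {..0::int} d"]) (rule bij_uminus)
    finally show ?thesis
      unfolding csum_geometric_le[OF a(2)] csum_geometric_le[OF a(3)] by (rule le_less_trans) simp
  qed
  have "csum (coef K a a1 a2 :: int \<times> nat \<times> (int ^ 'n) \<Rightarrow> ennreal)
      = ennreal K * (csum ?d * (csum (\<lambda>k::nat. ennreal (2 powr (- (a * real k)))) * csum (indicator (nbrs :: (int ^ 'n) set))))"
    unfolding csum_iterated eq csum_cmult csum_multc ..
  also have "\<dots> < top" using nb ks ds by (intro ennreal_mult_less_top[THEN iffD2] disjI2 conjI) auto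
  finally show ?thesis .
qed

text \<open>The base lies between max(1, 2^a) and twice this number; the factor 2^|e| covers both
  signs of e, as is necessary for E and F of arbitrary sign.\<close>

lemma one_plus_powr_le:
  fixes a e :: real
  shows "(1 + 2 powr a) powr e \<le> 2 powr \<bar>e\<bar> * 2 powr (max a 0 * e)"
proof -
  have *: "y powr e \<le> 2 powr \<bar>e\<bar>" if "1 \<le> y" "y \<le> 2" for y :: real
  proof (cases "0 \<le> e")
    case True
    then show ?thesis using that by (simp add: powr_mono2)
  next
    case False
    then have "y powr e \<le> 1 powr e" using that by (intro powr_mono2') auto
    also have "\<dots> \<le> 2 powr \<bar>e\<bar>" using ge_one_powr_ge_zero[of 2 "\<bar>e\<bar>"] by simp
    finally show ?thesis .
  qed
  show ?thesis
  proof (cases "0 \<le> a")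
    case True
    have "1 + 2 powr a = 2 powr a * (1 + 2 powr (- a))" by (simp add: distrib_left powr_add[symmetric])
    then have "(1 + 2 powr a) powr e = 2 powr (a * e) * (1 + 2 powr (- a)) powr e" by (simp add: powr_mult powr_powr)
    also have "\<dots> \<le> 2 powr (a * e) * 2 powr \<bar>e\<bar>"
      using True powr_mono[of "- a" 0 2] by (intro mult_left_mono *) auto
    finally show ?thesis using True by (simp add: max_def mult.commute)
  next
    case False
    then have "(1 + 2 powr a) powr e \<le> 2 powr \<bar>e\<bar>" using powr_mono[of a 0 2] by (intro *) auto
    then show ?thesis using False by (simp add: max_def)
  qed
qed

lemma cell_nbrs:
  assumes "\<And>c. \<bar>u $ c - v $ c\<bar> < 2 powi (- m)"
  shows "cell m u - cell m v \<in> nbrs"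
proof -
  have "\<lfloor>u $ c * 2 powi m\<rfloor> - \<lfloor>v $ c * 2 powi m\<rfloor> \<in> {-1, 0, 1}" for c
  proof -
    have "\<bar>u $ c - v $ c\<bar> * 2 powi m < 2 powi (- m) * 2 powi m"
      using assms[of c] by (intro mult_strict_right_mono) auto
    then have "\<bar>u $ c * 2 powi m - v $ c * 2 powi m\<bar> < 1"
      by (simp add: power_int_minus abs_mult left_diff_distrib[symmetric])
    then have "\<bar>\<lfloor>u $ c * 2 powi m\<rfloor> - \<lfloor>v $ c * 2 powi m\<rfloor>\<bar> \<le> 1" by linarith
    then show ?thesis by auto
  qed
  then show ?thesis by (simp add: nbrs_def cell_def)
qed

text \<open>The index \<open>(d, k, \<nu>)\<close> of a matrix entry \<open>(Q, R)\<close>: the level difference, the dyadic distance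
  of \<open>Q\<close> and \<open>R\<close>, and the relative position of their ancestors of a size comparable to
  their distance.\<close>

lemma matrix_entry_location:
  fixes Q :: "('n::finite) dyadic"
  assumes D: "0 \<le> D" and C: "0 \<le> C"
    and b: "bQR \<le> C * (1 + dlen R / dlen Q) powr (- E) * (1 + dlen Q / dlen R) powr (- F)
       * (1 + norm (dvertex Q - dvertex R) / max (dlen Q) (dlen R)) powr (- D)"
    and x: "x \<in> dcube Q"
  obtains k \<nu> where "\<nu> \<in> nbrs"
    "x \<in> dcube (fst R - int (nat (max (fst R - fst Q) 0) + k), anc (nat (max (fst R - fst Q) 0) + k) (snd R) + \<nu>)"
    "bQR \<le> C * 2 powr (\<bar>E\<bar> + \<bar>F\<bar> + D) * 2 powr (- (real k * D) - max (real_of_int (fst R - fst Q)) 0 * F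
       - max (- real_of_int (fst R - fst Q)) 0 * E)"
proof -
  define d where "d = fst R - fst Q"
  define \<delta> where "\<delta> = norm (dvertex Q - dvertex R) / max (dlen Q) (dlen R)"
  have dlen_eq: "dlen S = 2 powr (- real_of_int (fst S))" for S :: "'n dyadic" by (cases S) (simp add: dlen_level)
  have max_pos: "0 < max (dlen Q) (dlen R)" by (simp add: less_max_iff_disj)
  have \<delta>0: "0 \<le> \<delta>" unfolding \<delta>_def using max_pos by simp
  obtain k0 where "\<delta> < 2 ^ k0" using real_arch_pow[of 2 \<delta>] by auto
  \<comment> \<open>By minimality 1 + \<delta> \<ge> 2^(k-1) when k > 0; the lost generation is the
    factor 2^D in the constant.\<close>
  define k where "k = (LEAST k. \<delta> < 2 ^ k)"
  have k: "\<delta> < 2 ^ k" unfolding k_def by (rule LeastI) fact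
  have k_min: "\<not> \<delta> < 2 ^ m" if "m < k" for m using not_less_Least[OF that[unfolded k_def]] .
  \<comment> \<open>So many generations above R, cubes have side 2^k times the larger of the two
    sides. This exceeds the distance of the vertices, whence the ancestors of Q and R at that level
    are neighbours or equal.\<close>
  define l where "l = nat (max d 0) + k"
  define m where "m = fst R - int l"
  define \<nu> where "\<nu> = cell m x - anc l (snd R)"
  have Rq: "anc l (snd R) = cell m (dvertex R)"
    by (metis anc_cell cell_dvertex m_def prod.collapse)
  have "m \<le> fst Q" by (auto simp: m_def l_def d_def)
  have "cell m x = cell m (dvertex Q)"
  proof -
    have "cell (fst Q) x = cell (fst Q) (dvertex Q)" using x dvertex_in_dcube[of Q] by (simp add: mem_dcube)
    then have "anc (nat (fst Q - m)) (cell (fst Q) x) = anc (nat (fst Q - m)) (cell (fst Q) (dvertex Q))" by simp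
    then show ?thesis using \<open>m \<le> fst Q\<close> by (simp add: anc_cell)
  qed
  have "max (dlen Q) (dlen R) * 2 ^ k = 2 powi (- m)"
  proof -
    have "max (dlen Q) (dlen R) = 2 powi (int (nat (max d 0)) - fst R)"
    proof (cases "0 \<le> d")
      case True
      then have "dlen R \<le> dlen Q" by (simp add: dlen_eq d_def)
      moreover have "int (nat (max d 0)) - fst R = - fst Q" using True by (simp add: d_def)
      ultimately show ?thesis by (simp add: max_def dlen_def)
    next
      case False
      then have "dlen Q \<le> dlen R" by (simp add: dlen_eq d_def)
      moreover have "int (nat (max d 0)) - fst R = - fst R" using False by simp
      ultimately show ?thesis by (simp add: max_def dlen_def)
    qed
    then show ?thesis by (simp add: m_def l_def power_int_add[symmetric] algebra_simps flip: power_int_of_nat)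
  qed
  then have "norm (dvertex Q - dvertex R) < 2 powi (- m)"
    using k max_pos by (simp add: \<delta>_def divide_less_eq mult.commute)
  then have close: "\<bar>dvertex Q $ c - dvertex R $ c\<bar> < 2 powi (- m)" for c
    using component_le_norm_cart[of "dvertex Q - dvertex R" c] by (simp add: le_less_trans)
  have "\<nu> \<in> nbrs" unfolding \<nu>_def Rq \<open>cell m x = _\<close> by (rule cell_nbrs[OF close])
  moreover have "x \<in> dcube (fst R - int (nat (max (fst R - fst Q) 0) + k), anc (nat (max (fst R - fst Q) 0) + k) (snd R) + \<nu>)"
    unfolding d_def[symmetric] l_def[symmetric] m_def[symmetric] by (simp add: mem_dcube \<nu>_def)
  moreover have "bQR \<le> C * 2 powr (\<bar>E\<bar> + \<bar>F\<bar> + D) * 2 powr (- (real k * D) - max (real_of_int (fst R - fst Q)) 0 * F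
       - max (- real_of_int (fst R - fst Q)) 0 * E)"
  proof -
    have r1: "dlen R / dlen Q = 2 powr (- real_of_int d)" "dlen Q / dlen R = 2 powr real_of_int d"
      by (simp_all add: dlen_eq d_def powr_diff[symmetric])
    have e1: "(1 + dlen R / dlen Q) powr (- E) \<le> 2 powr \<bar>E\<bar> * 2 powr (max (- real_of_int d) 0 * (- E))"
      using one_plus_powr_le[of "- real_of_int d" "- E"] by (simp add: r1)
    have e2: "(1 + dlen Q / dlen R) powr (- F) \<le> 2 powr \<bar>F\<bar> * 2 powr (max (real_of_int d) 0 * (- F))"
      using one_plus_powr_le[of "real_of_int d" "- F"] by (simp add: r1)
    have e3: "(1 + \<delta>) powr (- D) \<le> 2 powr D * 2 powr (- (real k * D))"
    proof (cases k)
      case 0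
      have "(1 + \<delta>) powr (- D) \<le> 1 powr (- D)" using \<delta>0 D by (intro powr_mono2') auto
      also have "\<dots> \<le> 2 powr D" using ge_one_powr_ge_zero[of 2 D] D by simp
      finally show ?thesis using 0 by simp
    next
      case (Suc k')
      have "2 ^ k' \<le> 1 + \<delta>" using k_min[of k'] Suc by simp
      then have "(1 + \<delta>) powr (- D) \<le> (2 ^ k') powr (- D)" using D by (intro powr_mono2') auto
      also have "\<dots> = 2 powr D * 2 powr (- (real k * D))"
        by (simp add: Suc powr_realpow[symmetric] powr_powr powr_add[symmetric] algebra_simps)
      finally show ?thesis .
    qed
    have "bQR \<le> C * (1 + dlen R / dlen Q) powr (- E) * (1 + dlen Q / dlen R) powr (- F) * (1 + \<delta>) powr (- D)"
      using b by (simp add: \<delta>_def)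
    also have "\<dots> \<le> C * (2 powr \<bar>E\<bar> * 2 powr (max (- real_of_int d) 0 * (- E)))
        * (2 powr \<bar>F\<bar> * 2 powr (max (real_of_int d) 0 * (- F))) * (2 powr D * 2 powr (- (real k * D)))"
      using C by (intro mult_mono e1 e2 e3 order_refl mult_nonneg_nonneg) auto
    also have "\<dots> = C * 2 powr (\<bar>E\<bar> + \<bar>F\<bar> + D) * 2 powr (- (real k * D) - max (real_of_int d) 0 * F
       - max (- real_of_int d) 0 * E)"
      by (simp add: powr_add powr_diff powr_minus divide_inverse ac_simps)
    finally show ?thesis by (simp add: d_def)
  qed
  ultimately show ?thesis by (rule that)
qed

text \<open>A majorant of |V(x) (B t)_Q|^A for the cube Q of level j containing x, if A \<le> 1.
  Being a sum of norms, it makes sense before the series for (B t)_Q is known to converge.\<close>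

definition absmat :: "(('n::finite) dyadic \<Rightarrow> 'n dyadic \<Rightarrow> 'k::real_or_complex)
    \<Rightarrow> (real ^ 'n \<Rightarrow> 'a::real_normed_vector \<Rightarrow>\<^sub>L 'a) \<Rightarrow> real \<Rightarrow> ('n dyadic \<Rightarrow> 'a) \<Rightarrow> int \<Rightarrow> real ^ 'n \<Rightarrow> ennreal" where
  "absmat b V A t j x = csum (\<lambda>R. epowr (ennreal (norm (b (j, cell j x) R) * norm (blinfun_apply (V x) (t R)))) A)"

lemma absmat_measurable:
  assumes "weight smul UNIV V"
  shows "absmat b V A t j \<in> borel_measurable lebesgue"
proof -
  note [measurable] = weight_norm_measurable[OF assms UNIV_I]
  let ?f = "\<lambda>k R x. epowr (ennreal (norm (b (j, k) R) * norm (blinfun_apply (V x) (t R)))) A"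
  have "absmat b V A t j = (\<lambda>x. csum (\<lambda>k. csum (\<lambda>R. ?f k R x) * indicator (dcube (j, k)) x))"
    by (simp add: fun_eq_iff csum_cell absmat_def)
  then show ?thesis
    by (simp only:) (intro borel_measurable_csum borel_measurable_times_ennreal; measurable)
qed

text \<open>Each R occurs under one triple (d, k, \<nu>) at which its entry has the stated bound;
  since all terms are nonnegative, the sum may be extended over all triples. For a fixed triple the
  sum over the cubes R of level j + d is \<open>wavg\<close>.\<close>

lemma absmat_le:
  fixes b :: "('n::finite) dyadic \<Rightarrow> 'n dyadic \<Rightarrow> 'k::real_or_complex"
  assumes D: "0 \<le> D" and C: "0 \<le> C" and A: "0 < A"
    and b: "\<And>Q R. norm (b Q R) \<le> C * (1 + dlen R / dlen Q) powr (- E) * (1 + dlen Q / dlen R) powr (- F)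
       * (1 + norm (dvertex Q - dvertex R) / max (dlen Q) (dlen R)) powr (- D)"
  shows "absmat b V A t j x \<le> csum (\<lambda>(d, k, \<nu>). ennreal ((C * 2 powr (\<bar>E\<bar> + \<bar>F\<bar> + D) *
      2 powr (- (real k * D) - max (real_of_int d) 0 * F - max (- real_of_int d) 0 * E)) powr A) * indicator nbrs \<nu>
      * wavg V A (nat (max d 0) + k) \<nu> t (j + d) x)"
proof -
  let ?c = "\<lambda>d k. ennreal ((C * 2 powr (\<bar>E\<bar> + \<bar>F\<bar> + D) *
      2 powr (- (real k * D) - max (real_of_int d) 0 * F - max (- real_of_int d) 0 * E)) powr A)"
  let ?l = "\<lambda>d k. nat (max d 0) + k"
  let ?n = "\<lambda>R. epowr (ennreal (norm (blinfun_apply (V x) (t R)))) A"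
  have entry: "epowr (ennreal (norm (b (j, cell j x) (i, m)) * norm (blinfun_apply (V x) (t (i, m))))) A
      \<le> csum (\<lambda>(k, \<nu>). ?c (i - j) k * indicator nbrs \<nu> * (?n (i, m) * indicator (dcube (i - int (?l (i - j) k), anc (?l (i - j) k) m + \<nu>)) x))"
    (is "_ \<le> csum ?g") for i m
  proof -
    have "x \<in> dcube (j, cell j x)" by (simp add: mem_dcube)
    then obtain k \<nu> where k: "\<nu> \<in> nbrs"
      "x \<in> dcube (fst (i, m) - int (nat (max (fst (i, m) - fst (j, cell j x)) 0) + k),
          anc (nat (max (fst (i, m) - fst (j, cell j x)) 0) + k) (snd (i, m)) + \<nu>)"
      "norm (b (j, cell j x) (i, m)) \<le> C * 2 powr (\<bar>E\<bar> + \<bar>F\<bar> + D) * 2 powr (- (real k * D)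
        - max (real_of_int (fst (i, m) - fst (j, cell j x))) 0 * F - max (- real_of_int (fst (i, m) - fst (j, cell j x))) 0 * E)"
      using matrix_entry_location[OF D C b[of "(j, cell j x)" "(i, m)"], of x] by metis
    have "epowr (ennreal (norm (b (j, cell j x) (i, m)) * norm (blinfun_apply (V x) (t (i, m))))) A
        = epowr (ennreal (norm (b (j, cell j x) (i, m)))) A * ?n (i, m)"
      by (simp add: ennreal_mult epowr_mult)
    also have "\<dots> \<le> ?c (i - j) k * ?n (i, m)"
      using k(3) A by (intro mult_right_mono) (auto simp: epowr_ennreal intro!: ennreal_leI powr_mono2)
    also have "\<dots> = ?g (k, \<nu>)" using k(1,2) by simp
    also have "\<dots> \<le> csum ?g" by (rule le_csum)
    finally show ?thesis .
  qed
  have "absmat b V A t j x = csum (\<lambda>i. csum (\<lambda>m. epowr (ennreal (norm (b (j, cell j x) (i, m)) * norm (blinfun_apply (V x) (t (i, m))))) A))"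
    unfolding absmat_def by (rule csum_iterated)
  also have "\<dots> \<le> csum (\<lambda>i. csum (\<lambda>m. csum (\<lambda>(k, \<nu>). ?c (i - j) k * indicator nbrs \<nu> *
      (?n (i, m) * indicator (dcube (i - int (?l (i - j) k), anc (?l (i - j) k) m + \<nu>)) x))))"
    by (intro csum_mono entry)
  also have "\<dots> = csum (\<lambda>i. csum (\<lambda>(k, \<nu>). csum (\<lambda>m. ?c (i - j) k * indicator nbrs \<nu> *
      (?n (i, m) * indicator (dcube (i - int (?l (i - j) k), anc (?l (i - j) k) m + \<nu>)) x))))"
    by (subst csum_swap) (simp add: case_prod_unfold)
  also have "\<dots> = csum (\<lambda>i. csum (\<lambda>(k, \<nu>). ?c (i - j) k * indicator nbrs \<nu> * wavg V A (?l (i - j) k) \<nu> t i x))"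
    by (simp add: csum_cmult wavg_def)
  also have "\<dots> = csum (\<lambda>d. csum (\<lambda>(k, \<nu>). ?c ((j + d) - j) k * indicator nbrs \<nu> * wavg V A (?l ((j + d) - j) k) \<nu> t (j + d) x))"
    by (rule csum_reindex[symmetric]) (rule bij_plus)
  also have "\<dots> = csum (\<lambda>d. csum (\<lambda>k\<nu>. case (d, k\<nu>) of (d, k, \<nu>) \<Rightarrow> ?c d k * indicator nbrs \<nu> * wavg V A (?l d k) \<nu> t (j + d) x))"
    by simp
  also have "\<dots> = csum (\<lambda>(d, k, \<nu>). ?c d k * indicator nbrs \<nu> * wavg V A (?l d k) \<nu> t (j + d) x)"
    by (rule csum_iterated[symmetric])
  finally show ?thesis .
qed

text \<open>The weights e select output levels: all of them in the Triebel--Lizorkin case, a single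
  one in the Besov case. Reindexing by the input level i = j + d turns them into e(i - d). The
  growth T per generation is charged l = max(d, 0) + k times, so it is subtracted from the decay in
  k and from the decay for d > 0, but not from that for d < 0.\<close>

lemma absmat_mix:
  fixes b :: "('n::finite) dyadic \<Rightarrow> 'n dyadic \<Rightarrow> 'k::real_or_complex"
  assumes V: "weight smul UNIV V" and D: "0 \<le> D" and C: "0 \<le> C" and A: "0 < A" and PQ: "1 < P" "1 < Q"
    and b: "\<And>Q R. norm (b Q R) \<le> C * (1 + dlen R / dlen Q) powr (- E) * (1 + dlen Q / dlen R) powr (- F)
       * (1 + norm (dvertex Q - dvertex R) / max (dlen Q) (dlen R)) powr (- D)"
    and C2: "0 \<le> C2" and wavg: "\<And>l \<nu> g. \<nu> \<in> nbrs \<Longrightarrow> mix lebesgue P Q (\<lambda>i x. g i * wavg V A l \<nu> t i x)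
      \<le> ennreal (C2 * 2 powr (real l * T)) * mix lebesgue P Q (\<lambda>i x. g i * seqf V r A t i x)"
  shows "mix lebesgue P Q (\<lambda>j x. e j * (ennreal (2 powr (real_of_int j * \<sigma> * A)) * absmat b V A t j x))
    \<le> csum (\<lambda>z :: int \<times> nat \<times> (int ^ 'n). coef ((C * 2 powr (\<bar>E\<bar> + \<bar>F\<bar> + D)) powr A * C2) (A * D - T) (A * (F + \<sigma>) - T) (A * (E - \<sigma>)) z
        * mix lebesgue P Q (\<lambda>i x. (e (i - fst z) * ennreal (2 powr (real_of_int i * \<sigma> * A))) * seqf V r A t i x))"
proof -
  note [measurable] = wavg_measurable[OF V]
  let ?g = "\<lambda>i. ennreal (2 powr (real_of_int i * \<sigma> * A))"
  let ?l = "\<lambda>d k. nat (max d 0) + k"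
  define K0 where "K0 = C * 2 powr (\<bar>E\<bar> + \<bar>F\<bar> + D)"
  have K0: "0 \<le> K0" using C by (simp add: K0_def)
  let ?c = "\<lambda>d k. ennreal ((K0 * 2 powr (- (real k * D) - max (real_of_int d) 0 * F - max (- real_of_int d) 0 * E)) powr A)"
  define w where "w z = (case z of (d, k, \<nu> :: int ^ 'n) \<Rightarrow> ?c d k * indicator nbrs \<nu> * ennreal (2 powr (- (real_of_int d * \<sigma> * A))))" for z
  define f where "f z j x = (case z of (d, k, \<nu>) \<Rightarrow> (e j * ?g (j + d)) * wavg V A (?l d k) \<nu> t (j + d) x)" for z j x
  have [measurable]: "f z j \<in> borel_measurable lebesgue" for z j
    by (cases z) (auto simp: f_def[abs_def])
  have "e j * (?g j * absmat b V A t j x) \<le> csum (\<lambda>z. w z * f z j x)" for j x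
  proof -
    have gj: "?g j = ennreal (2 powr (- (real_of_int d * \<sigma> * A))) * ?g (j + d)" for d
      by (simp add: ennreal_mult[symmetric] powr_add[symmetric] algebra_simps)
    have "e j * (?g j * absmat b V A t j x)
        \<le> e j * (?g j * csum (\<lambda>(d, k, \<nu>). ?c d k * indicator nbrs \<nu> * wavg V A (?l d k) \<nu> t (j + d) x))"
      unfolding K0_def by (intro mult_left_mono absmat_le[OF D C A b]) auto
    also have "\<dots> = csum (\<lambda>z. case z of (d, k, \<nu>) \<Rightarrow> e j * (?g j * (?c d k * indicator nbrs \<nu> * wavg V A (?l d k) \<nu> t (j + d) x)))"
      by (simp add: csum_cmult[symmetric] case_prod_unfold)
    also have "\<dots> = csum (\<lambda>z. w z * f z j x)"
    proof (rule nn_integral_cong)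
      fix z :: "int \<times> nat \<times> (int ^ 'n)"
      obtain d k \<nu> where z: "z = (d, k, \<nu>)" by (cases z)
      show "(case z of (d, k, \<nu>) \<Rightarrow> e j * (?g j * (?c d k * indicator nbrs \<nu> * wavg V A (?l d k) \<nu> t (j + d) x))) = w z * f z j x"
        unfolding z w_def f_def prod.case gj[of d] by (simp only: ac_simps)
    qed
    finally show ?thesis .
  qed
  then have "mix lebesgue P Q (\<lambda>j x. e j * (?g j * absmat b V A t j x)) \<le> mix lebesgue P Q (\<lambda>j x. csum (\<lambda>z. w z * f z j x))"
    using PQ by (intro mix_mono) auto
  also have "\<dots> \<le> csum (\<lambda>z. mix lebesgue P Q (\<lambda>j x. w z * f z j x))"
    by (rule mix_csum_le[OF sigma_finite_lebesgue PQ]) measurable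
  also have "\<dots> = csum (\<lambda>z. w z * mix lebesgue P Q (f z))"
    using PQ by (intro nn_integral_cong mix_cmult) auto
  also have "\<dots> \<le> csum (\<lambda>z :: int \<times> nat \<times> (int ^ 'n). coef (K0 powr A * C2) (A * D - T) (A * (F + \<sigma>) - T) (A * (E - \<sigma>)) z
        * mix lebesgue P Q (\<lambda>i x. (e (i - fst z) * ?g i) * seqf V r A t i x))"
  proof (rule csum_mono)
    fix z :: "int \<times> nat \<times> (int ^ 'n)"
    obtain d k \<nu> where z: "z = (d, k, \<nu>)" by (cases z)
    show "w z * mix lebesgue P Q (f z) \<le> coef (K0 powr A * C2) (A * D - T) (A * (F + \<sigma>) - T) (A * (E - \<sigma>)) z
        * mix lebesgue P Q (\<lambda>i x. (e (i - fst z) * ?g i) * seqf V r A t i x)"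
    proof (cases "\<nu> \<in> nbrs")
      case True
      have "mix lebesgue P Q (f z) = mix lebesgue P Q (\<lambda>j. (\<lambda>i x. (e (i - d) * ?g i) * wavg V A (?l d k) \<nu> t i x) (j + d))"
        by (simp add: z f_def[abs_def])
      also have "\<dots> = mix lebesgue P Q (\<lambda>i x. (e (i - d) * ?g i) * wavg V A (?l d k) \<nu> t i x)"
        by (rule mix_reindex) (rule bij_plus_right)
      also have "\<dots> \<le> ennreal (C2 * 2 powr (real (?l d k) * T)) * mix lebesgue P Q (\<lambda>i x. (e (i - d) * ?g i) * seqf V r A t i x)"
        by (rule wavg[OF True])
      finally have le: "w z * mix lebesgue P Q (f z) \<le> w z * (ennreal (C2 * 2 powr (real (?l d k) * T))
          * mix lebesgue P Q (\<lambda>i x. (e (i - d) * ?g i) * seqf V r A t i x))"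
        by (rule mult_left_mono) simp
      have "w z * ennreal (C2 * 2 powr (real (?l d k) * T)) = coef (K0 powr A * C2) (A * D - T) (A * (F + \<sigma>) - T) (A * (E - \<sigma>)) z"
      proof -
        have d: "real_of_int d = max (real_of_int d) 0 - max (- real_of_int d) 0" by (simp add: max_def)
        have l: "real (?l d k) = max (real_of_int d) 0 + real k" by (simp add: max_def)
        define u where "u = max (real_of_int d) 0"
        define v where "v = max (- real_of_int d) 0"
        have du: "real_of_int d = u - v" using d by (simp add: u_def v_def)
        have "(K0 * 2 powr (- (real k * D) - u * F - v * E)) powr A * 2 powr (- ((u - v) * \<sigma> * A)) * (C2 * 2 powr ((u + real k) * T))
            = K0 powr A * C2 * (2 powr ((- (real k * D) - u * F - v * E) * A) * 2 powr (- ((u - v) * \<sigma> * A)) * 2 powr ((u + real k) * T))"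
          using K0 by (simp add: powr_mult powr_powr)
        also have "2 powr ((- (real k * D) - u * F - v * E) * A) * 2 powr (- ((u - v) * \<sigma> * A)) * 2 powr ((u + real k) * T)
            = 2 powr (- ((A * D - T) * real k) - (A * (F + \<sigma>) - T) * u - A * (E - \<sigma>) * v)"
          by (simp add: powr_add[symmetric] algebra_simps)
        finally have real_eq: "(K0 * 2 powr (- (real k * D) - u * F - v * E)) powr A * 2 powr (- ((u - v) * \<sigma> * A)) * (C2 * 2 powr ((u + real k) * T))
            = K0 powr A * C2 * 2 powr (- ((A * D - T) * real k) - (A * (F + \<sigma>) - T) * u - A * (E - \<sigma>) * v)" .
        have "w z * ennreal (C2 * 2 powr (real (?l d k) * T)) = ennreal ((K0 * 2 powr (- (real k * D) - u * F - v * E)) powr A)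
            * ennreal (2 powr (- ((u - v) * \<sigma> * A))) * ennreal (C2 * 2 powr ((u + real k) * T))"
          using True unfolding z w_def prod.case l u_def[symmetric] v_def[symmetric] by (simp add: du)
        also have "\<dots> = ennreal ((K0 * 2 powr (- (real k * D) - u * F - v * E)) powr A * 2 powr (- ((u - v) * \<sigma> * A))
            * (C2 * 2 powr ((u + real k) * T)))"
          using C2 by (simp only: ennreal_mult mult_nonneg_nonneg powr_ge_zero)
        also have "\<dots> = coef (K0 powr A * C2) (A * D - T) (A * (F + \<sigma>) - T) (A * (E - \<sigma>)) z"
          unfolding real_eq using True by (simp add: z coef_def u_def v_def)
        finally show ?thesis .
      qed
      then show ?thesis using le by (simp add: z mult.assoc[symmetric])
    qed (simp add: z w_def)
  qed
  finally show ?thesis unfolding K0_def .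
qed

section \<open>Convergence of the series\<close>

lemma AE_ex_in_dcube:
  assumes "AE x in lebesgue. P x"
  shows "\<exists>x\<in>dcube Q. P x"
proof (rule ccontr)
  assume "\<not> ?thesis"
  then have "AE x in lebesgue. x \<notin> dcube Q" using assms by (auto elim!: eventually_mono)
  then have "emeasure lebesgue (dcube Q) = 0" by (subst (asm) AE_iff_measurable[of "dcube Q"]) auto
  then show False by simp
qed


text \<open>Absolute convergence is first known for the images under V(x). The bounded inverse of
  V(x) transports it back, completeness gives the sum, and the bounded operator V(x) may then be
  applied termwise.\<close>

lemma absmat_finite:
  fixes smul :: "'k::real_or_complex \<Rightarrow> 'a::banach \<Rightarrow> 'a" and V :: "real ^ 'n \<Rightarrow> 'a \<Rightarrow>\<^sub>L 'a"
  assumes smul: "normed_space_over smul" and V: "V x \<in> operators smul UNIV" "invertible_op smul UNIV (V x)"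
    and A: "0 < A" "A \<le> 1" and fin: "absmat b V A t j x < top"
  shows "(\<lambda>R. smul (b (j, cell j x) R) (t R)) summable_on UNIV"
    and "epowr (ennreal (norm (blinfun_apply (V x) (matrix_apply smul b t (j, cell j x))))) A \<le> absmat b V A t j x"
proof -
  interpret normed_space_over smul by (rule smul)
  define g where "g R = smul (b (j, cell j x) R) (t R)" for R
  define u where "u R = norm (b (j, cell j x) R) * norm (blinfun_apply (V x) (t R))" for R
  have Vg: "norm (blinfun_apply (V x) (g R)) = u R" for R
    using V(1) by (simp add: operators_def g_def u_def norm_scale)
  have le: "epowr (csum (\<lambda>R. ennreal (u R))) A \<le> absmat b V A t j x"
    unfolding absmat_def u_def by (rule epowr_csum_le[OF A])
  then have S: "csum (\<lambda>R. ennreal (u R)) < top" using fin by (metis epowr_less_top le_less_trans)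
  define s where "s = enn2real (csum (\<lambda>R. ennreal (u R)))"
  have s: "csum (\<lambda>R. ennreal (u R)) = ennreal s" using S by (simp add: s_def)
  have u0: "0 \<le> u R" for R by (simp add: u_def)
  have "0 \<le> s" by (simp add: s_def)
  have bound: "sum u F \<le> s" if "finite F" for F
  proof -
    have "ennreal (sum u F) = (\<Sum>R\<in>F. ennreal (u R))" using u0 by (simp add: sum_ennreal)
    also have "\<dots> \<le> ennreal s" unfolding s[symmetric] by (rule sum_le_csum[OF that])
    finally show ?thesis using \<open>0 \<le> s\<close> by (simp add: ennreal_le_iff)
  qed
  have su: "u summable_on UNIV"
    by (rule nonneg_bdd_above_summable_on) (auto intro!: u0 bdd_aboveI[of _ s] bound)
  let ?S = "inverse_op smul UNIV (V x)"
  have ng: "norm (g R) \<le> norm ?S * u R" for R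
  proof -
    have "g R = blinfun_apply ?S (blinfun_apply (V x) (g R))"
      using is_inverse_op_inverse[OF V(2)] by (simp add: is_inverse_op_def)
    then have "norm (g R) \<le> norm ?S * norm (blinfun_apply (V x) (g R))" by (metis norm_blinfun)
    then show ?thesis by (simp add: Vg)
  qed
  have "(\<lambda>R. norm (g R)) summable_on UNIV"
  proof (rule nonneg_bdd_above_summable_on)
    show "bdd_above (sum (\<lambda>R. norm (g R)) ` {F. F \<subseteq> UNIV \<and> finite F})"
    proof (rule bdd_aboveI[of _ "norm ?S * s"])
      fix y assume "y \<in> sum (\<lambda>R. norm (g R)) ` {F. F \<subseteq> UNIV \<and> finite F}"
      then obtain F where F: "finite F" "y = (\<Sum>R\<in>F. norm (g R))" by auto
      have "y \<le> (\<Sum>R\<in>F. norm ?S * u R)" unfolding F(2) by (intro sum_mono ng)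
      also have "\<dots> = norm ?S * sum u F" by (simp add: sum_distrib_left)
      also have "\<dots> \<le> norm ?S * s" by (intro mult_left_mono bound F) simp
      finally show "y \<le> norm ?S * s" .
    qed
  qed simp
  then have sg: "g summable_on UNIV" by (rule abs_summable_summable)
  then show "(\<lambda>R. smul (b (j, cell j x) R) (t R)) summable_on UNIV" by (simp add: g_def[abs_def])
  have "blinfun_apply (V x) (matrix_apply smul b t (j, cell j x)) = blinfun_apply (V x) (infsum g UNIV)"
    by (simp add: matrix_apply_def g_def[abs_def])
  also have "\<dots> = infsum (\<lambda>R. blinfun_apply (V x) (g R)) UNIV"
  proof (rule infsum_bounded_linear_strong[symmetric])
    have "(\<lambda>R. blinfun_apply (V x) (g R)) summable_on UNIV"
      by (rule abs_summable_summable) (simp add: Vg su)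
    then show "(\<lambda>R. blinfun_apply (V x) (g R)) summable_on UNIV \<longleftrightarrow> g summable_on UNIV" using sg by simp
  qed (rule blinfun.bounded_linear_right)
  also have "norm \<dots> \<le> infsum (\<lambda>R. norm (blinfun_apply (V x) (g R))) UNIV"
    by (rule norm_infsum_bound) (simp add: Vg su)
  also have "\<dots> = infsum u UNIV" by (simp add: Vg)
  also have "\<dots> \<le> s" by (rule infsum_le_finite_sums[OF su]) (rule bound)
  finally have "ennreal (norm (blinfun_apply (V x) (matrix_apply smul b t (j, cell j x)))) \<le> csum (\<lambda>R. ennreal (u R))"
    unfolding s by (rule ennreal_leI)
  then show "epowr (ennreal (norm (blinfun_apply (V x) (matrix_apply smul b t (j, cell j x))))) A \<le> absmat b V A t j x"
    using A by (intro order_trans[OF epowr_mono le]) auto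
qed

text \<open>The coefficient at Q does not depend on x, so a single good point of Q yields its
  convergence; a cube has positive measure and therefore contains one.\<close>

lemma absmat_AE_finite:
  fixes smul :: "'k::real_or_complex \<Rightarrow> 'a::banach \<Rightarrow> 'a" and V :: "real ^ 'n \<Rightarrow> 'a \<Rightarrow>\<^sub>L 'a"
  assumes smul: "normed_space_over smul" and V: "weight smul UNIV V"
    and A: "0 < A" "A \<le> 1" and fin: "\<And>j. AE x in lebesgue. absmat b V A t j x < top"
  shows "(\<lambda>R. smul (b Q R) (t R)) summable_on UNIV"
    and "AE x in lebesgue. wavg V A 0 0 (matrix_apply smul b t) j x \<le> absmat b V A t j x"
proof -
  have op: "V x \<in> operators smul UNIV" for x using V by (simp add: weight_def)
  have inv: "AE x in lebesgue. invertible_op smul UNIV (V x)" using V by (simp add: weight_def)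
  have "AE x in lebesgue. invertible_op smul UNIV (V x) \<and> absmat b V A t (fst Q) x < top"
    using inv fin[of "fst Q"] by eventually_elim simp
  from AE_ex_in_dcube[OF this, of Q]
  obtain x where x: "x \<in> dcube Q" "invertible_op smul UNIV (V x)" "absmat b V A t (fst Q) x < top"
    by blast
  have eq: "(fst Q, cell (fst Q) x) = Q" using x(1) by (simp add: mem_dcube prod_eq_iff)
  show "(\<lambda>R. smul (b Q R) (t R)) summable_on UNIV"
    using absmat_finite(1)[OF smul op x(2) A x(3)] unfolding eq .
  show "AE x in lebesgue. wavg V A 0 0 (matrix_apply smul b t) j x \<le> absmat b V A t j x"
    using inv fin[of j]
  proof eventually_elim
    fix x assume "invertible_op smul UNIV (V x)" "absmat b V A t j x < top"
    from absmat_finite(2)[OF smul op this(1) A this(2)]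
    show "wavg V A 0 0 (matrix_apply smul b t) j x \<le> absmat b V A t j x" unfolding wavg_0 .
  qed
qed

section \<open>Sequence spaces\<close>

lemma infsum_dcubes:
  fixes f :: "int ^ 'n \<Rightarrow> ennreal"
  shows "(\<Sum>\<^sub>\<infinity>k. f k * indicator (dcube (j, k)) x) = f (cell j x)"
  by (simp add: infsum_eq_csum csum_cell)

lemma dvol_powr: "dvol (j, k :: int ^ 'n) powr (- 1/2) = 2 powr (real_of_int j * (real CARD('n) / 2))"
  by (simp add: dvol_level powr_powr)

lemma level_fun_eq: "level_fun t j x = (dvol (j, cell j x) powr (- 1/2)) *\<^sub>R t (j, cell j x)"
proof -
  let ?f = "\<lambda>k. (dvol (j, k) powr (- 1/2) * indicator (dcube (j, k)) x) *\<^sub>R t (j, k)"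
  have "?f k = 0" if "k \<noteq> cell j x" for k using that by (simp add: indicator_def mem_dcube)
  then have "infsum ?f UNIV = infsum ?f {cell j x}" by (intro infsum_cong_neutral) auto
  then show ?thesis by (simp add: level_fun_def mem_dcube)
qed

lemma pointwise_part_eq:
  fixes V :: "real ^ 'n \<Rightarrow> 'a::real_normed_vector \<Rightarrow>\<^sub>L 'a"
  shows "pointwise_part V s t j x = ennreal (2 powr (real_of_int j * (s + real CARD('n) / 2)))
    * ennreal (norm (blinfun_apply (V x) (t (j, cell j x))))"
proof -
  have "(2::real) powr (real_of_int j * (s + real CARD('n) / 2)) = 2 powr (real_of_int j * s) * 2 powr (real_of_int j * (real CARD('n) / 2))"
    by (simp add: powr_add[symmetric] algebra_simps)
  then show ?thesis
    unfolding pointwise_part_def level_fun_eq dvol_powr blinfun.scaleR_right norm_scaleR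
    by (simp add: ennreal_mult[symmetric] mult.assoc)
qed

lemma averaged_part_eq:
  fixes V :: "real ^ 'n \<Rightarrow> 'a::real_normed_vector \<Rightarrow>\<^sub>L 'a"
  shows "averaged_part V r s t j x = ennreal (2 powr (real_of_int j * (s + real CARD('n) / 2)))
    * rho V r (dcube (j, cell j x)) (t (j, cell j x))"
proof -
  have "(2::real) powr (real_of_int j * (s + real CARD('n) / 2)) = 2 powr (real_of_int j * s) * 2 powr (real_of_int j * (real CARD('n) / 2))"
    by (simp add: powr_add[symmetric] algebra_simps)
  then show ?thesis
    unfolding averaged_part_def infsum_dcubes dvol_powr
    by (simp add: ennreal_mult ac_simps)
qed

abbreviation lvl :: "real \<Rightarrow> int \<Rightarrow> ennreal" where
  "lvl c i \<equiv> ennreal (2 powr (real_of_int i * c))"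

lemma epowr_pointwise_part:
  fixes V :: "real ^ 'n \<Rightarrow> 'a::real_normed_vector \<Rightarrow>\<^sub>L 'a"
  shows "epowr (pointwise_part V s t j x) A = lvl ((s + real CARD('n) / 2) * A) j * wavg V A 0 0 t j x"
  by (simp add: pointwise_part_eq wavg_0 epowr_mult epowr_ennreal powr_powr mult.assoc)

lemma epowr_averaged_part:
  fixes V :: "real ^ 'n \<Rightarrow> 'a::real_normed_vector \<Rightarrow>\<^sub>L 'a"
  shows "epowr (averaged_part V r s t j x) A = lvl ((s + real CARD('n) / 2) * A) j * seqf V r A t j x"
  by (simp add: averaged_part_eq seqf_def epowr_mult epowr_ennreal powr_powr mult.assoc)

lemma triebel_qnorm_mix:
  assumes "0 < q" "0 < p"
  shows "triebel_qnorm p (ennreal q) X = mix lebesgue p q X"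
  using assms by (simp add: triebel_qnorm_def Lp_qnorm_def lq_qnorm_def mix_def infsum_eq_csum epowr_epowr)

lemma epowr_triebel_qnorm:
  assumes "0 < q" "0 < p" "0 < A"
  shows "epowr (triebel_qnorm p (ennreal q) X) A = mix lebesgue (p / A) (q / A) (\<lambda>i x. epowr (X i x) A)"
  using assms by (simp add: triebel_qnorm_mix mix_epowr)

text \<open>A single level is regarded as a family concentrated at j, with both exponents equal to p
  / A. This places the Besov estimates inside the same mixed norms.\<close>

lemma epowr_Lp_qnorm:
  assumes "0 < p" "0 < A"
  shows "epowr (Lp_qnorm p (X j)) A = mix lebesgue (p / A) (p / A) (\<lambda>i x. indicator {j} i * epowr (X i x) A)"
  using assms by (subst mix_single[of _ _ j]) (auto simp: Lp_qnorm_def epowr_epowr)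

lemma mix_finite_AE:
  fixes X :: "'i::countable \<Rightarrow> 'x \<Rightarrow> ennreal"
  assumes "0 < P" "0 < Q" "mix M P Q X < top" and [measurable]: "\<And>i. X i \<in> borel_measurable M"
  shows "AE x in M. X i x < top"
proof -
  have "(\<integral>\<^sup>+x. epowr (csum (\<lambda>i. epowr (X i x) Q)) (P / Q) \<partial>M) \<noteq> \<infinity>"
    using assms(3) by (auto simp: mix_def)
  then have "AE x in M. epowr (csum (\<lambda>i. epowr (X i x) Q)) (P / Q) \<noteq> \<infinity>"
    by (intro nn_integral_PInf_AE) measurable
  then show ?thesis
  proof eventually_elim
    fix x assume "epowr (csum (\<lambda>i. epowr (X i x) Q)) (P / Q) \<noteq> \<infinity>"
    then have "csum (\<lambda>i. epowr (X i x) Q) < top" by (simp add: top.not_eq_extremum)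
    then have "epowr (X i x) Q < top" by (rule le_less_trans[OF le_csum])
    then show "X i x < top" by simp
  qed
qed

section \<open>Sequence norms over the levels and discrete convolution\<close>

lemma lq_qnorm_mono:
  assumes "\<And>j. a j \<le> c * b j" "q \<noteq> 0"
  shows "lq_qnorm q a \<le> c * lq_qnorm q b"
proof (cases "q = \<infinity>")
  case True
  have "a j \<le> c * (SUP j. b j)" for j
    by (rule order_trans[OF assms(1)]) (intro mult_left_mono SUP_upper; simp)
  then show ?thesis using True by (simp add: lq_qnorm_def SUP_le_iff)
next
  case False
  then have q: "0 < enn2real q" using assms(2) by (simp add: enn2real_positive_iff top.not_eq_extremum zero_less_iff_neq_zero)
  have "csum (\<lambda>j. epowr (a j) (enn2real q)) \<le> epowr c (enn2real q) * csum (\<lambda>j. epowr (b j) (enn2real q))"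
    unfolding csum_cmult[symmetric] epowr_mult[symmetric] using q assms(1) by (intro csum_mono epowr_mono) auto
  then have "epowr (csum (\<lambda>j. epowr (a j) (enn2real q))) (1 / enn2real q)
      \<le> epowr (epowr c (enn2real q) * csum (\<lambda>j. epowr (b j) (enn2real q))) (1 / enn2real q)"
    using q by (intro epowr_mono) auto
  then show ?thesis using False q by (simp add: lq_qnorm_def infsum_eq_csum epowr_mult epowr_epowr)
qed

lemma lq_qnorm_upper:
  assumes "q \<noteq> 0"
  shows "a j \<le> lq_qnorm q a"
proof (cases "q = \<infinity>")
  case True
  then show ?thesis by (auto simp: lq_qnorm_def intro: SUP_upper)
next
  case False
  then have q: "0 < enn2real q" using assms by (simp add: enn2real_positive_iff top.not_eq_extremum zero_less_iff_neq_zero)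
  have "epowr (a j) (enn2real q) \<le> csum (\<lambda>j. epowr (a j) (enn2real q))" by (rule le_csum)
  then show ?thesis using False q by (simp add: lq_qnorm_def infsum_eq_csum epowr_le_swap)
qed

text \<open>By Minkowski's inequality if \<open>q > A\<close>, by subadditivity of powers if \<open>q \<le> A\<close>.\<close>

lemma lq_qnorm_convolution:
  assumes q: "q \<noteq> 0" and A: "0 < A" and c: "0 < \<alpha>" "0 < \<alpha>1" "0 < \<alpha>2" "0 \<le> K"
  shows "\<exists>C::real. \<forall>y a. (\<forall>j. epowr (y j) A \<le> csum (\<lambda>z :: int \<times> nat \<times> (int ^ 'n). coef K \<alpha> \<alpha>1 \<alpha>2 z * epowr (a (j + fst z)) A))
    \<longrightarrow> lq_qnorm q y \<le> ennreal C * lq_qnorm q a"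
proof -
  let ?c = "coef K \<alpha> \<alpha>1 \<alpha>2 :: int \<times> nat \<times> (int ^ 'n) \<Rightarrow> ennreal"
  have finish: "\<exists>C::real. \<forall>y a. (\<forall>j. epowr (y j) A \<le> csum (\<lambda>z. ?c z * epowr (a (j + fst z)) A)) \<longrightarrow> lq_qnorm q y \<le> ennreal C * lq_qnorm q a"
    if "X < top" "\<And>y a. (\<And>j. epowr (y j) A \<le> csum (\<lambda>z. ?c z * epowr (a (j + fst z)) A)) \<Longrightarrow> lq_qnorm q y \<le> X * lq_qnorm q a" for X
    using that by (intro exI[of _ "enn2real X"]) simp
  have cs: "csum ?c < top" by (rule coef_summable[OF c])
  consider "q = \<infinity>" | "q \<noteq> \<infinity>" "enn2real q \<le> A" | "q \<noteq> \<infinity>" "A < enn2real q" by linarith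
  then show ?thesis
  proof cases
    case 1
    show ?thesis
    proof (rule finish)
      show "epowr (csum ?c) (1 / A) < top" using cs by simp
      fix y a :: "int \<Rightarrow> ennreal"
      assume le: "\<And>j. epowr (y j) A \<le> csum (\<lambda>z. ?c z * epowr (a (j + fst z)) A)"
      have "y j \<le> epowr (csum ?c) (1 / A) * (SUP j. a j)" for j
      proof -
        have "epowr (y j) A \<le> csum (\<lambda>z. ?c z * epowr (SUP j. a j) A)"
          using A by (intro order_trans[OF le] csum_mono mult_left_mono epowr_mono SUP_upper) auto
        also have "\<dots> = csum ?c * epowr (SUP j. a j) A" by (rule csum_multc)
        finally show ?thesis using A by (simp add: epowr_le_swap epowr_mult epowr_epowr)
      qed
      then show "lq_qnorm q y \<le> epowr (csum ?c) (1 / A) * lq_qnorm q a" using 1 by (simp add: lq_qnorm_def SUP_le_iff)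
    qed
  next
    case 2
    define \<rho> where "\<rho> = enn2real q / A"
    have q0: "0 < enn2real q" using 2 q by (simp add: enn2real_positive_iff top.not_eq_extremum zero_less_iff_neq_zero)
    have \<rho>: "0 < \<rho>" "\<rho> \<le> 1" "A * \<rho> = enn2real q" using 2 A q0 by (auto simp: \<rho>_def)
    let ?X = "csum (\<lambda>z. epowr (?c z) \<rho>)"
    show ?thesis
    proof (rule finish)
      \<comment> \<open>Powers of \<open>coef\<close> have the same form with positive rates, so the
        coefficients remain summable after being raised to the power \<rho> \<le> 1.\<close>
      have "?X < top" unfolding epowr_coef[OF c(4)] using c \<rho> by (intro coef_summable) auto
      then show "epowr ?X (1 / enn2real q) < top" by simp
      fix y a :: "int \<Rightarrow> ennreal"
      assume le: "\<And>j. epowr (y j) A \<le> csum (\<lambda>z. ?c z * epowr (a (j + fst z)) A)"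
      have "epowr (y j) (enn2real q) \<le> csum (\<lambda>z. epowr (?c z) \<rho> * epowr (a (j + fst z)) (enn2real q))" for j
      proof -
        have "epowr (epowr (y j) A) \<rho> \<le> epowr (csum (\<lambda>z. ?c z * epowr (a (j + fst z)) A)) \<rho>"
          using \<rho> by (intro epowr_mono le) auto
        also have "\<dots> \<le> csum (\<lambda>z. epowr (?c z * epowr (a (j + fst z)) A) \<rho>)" by (rule epowr_csum_le[OF \<rho>(1,2)])
        finally show ?thesis by (simp add: epowr_epowr epowr_mult \<rho>(3))
      qed
      then have "csum (\<lambda>j. epowr (y j) (enn2real q)) \<le> csum (\<lambda>j. csum (\<lambda>z. epowr (?c z) \<rho> * epowr (a (j + fst z)) (enn2real q)))"
        by (rule csum_mono)
      also have "\<dots> = csum (\<lambda>z. csum (\<lambda>j. epowr (?c z) \<rho> * epowr (a (j + fst z)) (enn2real q)))" by (rule csum_swap)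
      also have "\<dots> = csum (\<lambda>z. epowr (?c z) \<rho> * csum (\<lambda>j. epowr (a j) (enn2real q)))"
        by (intro nn_integral_cong) (simp add: csum_cmult csum_reindex[OF bij_plus_right, of "\<lambda>j. epowr (a j) (enn2real q)"])
      also have "\<dots> = ?X * csum (\<lambda>j. epowr (a j) (enn2real q))" by (rule csum_multc)
      finally have "epowr (csum (\<lambda>j. epowr (y j) (enn2real q))) (1 / enn2real q)
          \<le> epowr (?X * csum (\<lambda>j. epowr (a j) (enn2real q))) (1 / enn2real q)"
        using q0 by (intro epowr_mono) auto
      then show "lq_qnorm q y \<le> epowr ?X (1 / enn2real q) * lq_qnorm q a"
        using 2 by (simp add: lq_qnorm_def infsum_eq_csum epowr_mult)
    qed
  next
    case 3
    define \<rho> where "\<rho> = enn2real q / A"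
    have \<rho>: "1 < \<rho>" "A * \<rho> = enn2real q" using 3 A by (auto simp: \<rho>_def)
    \<comment> \<open>Over a one-point space the mixed norm is the norm of l^\<rho>, which brings
      Minkowski's inequality to bear on sequences.\<close>
    let ?U = "count_space (UNIV :: unit set)"
    have mixU: "mix ?U \<rho> \<rho> (\<lambda>j _. f j) = epowr (csum (\<lambda>j. epowr (f j) \<rho>)) (1 / \<rho>)" for f :: "int \<Rightarrow> ennreal"
      using \<rho> by (simp add: mix_def nn_integral_count_space_finite)
    have lq: "lq_qnorm q f = epowr (mix ?U \<rho> \<rho> (\<lambda>j _. epowr (f j) A)) (1 / A)" for f
      using 3 A \<rho> by (simp add: mixU lq_qnorm_def infsum_eq_csum epowr_epowr) (simp add: \<rho>_def)
    show ?thesis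
    proof (rule finish)
      show "epowr (csum ?c) (1 / A) < top" using cs by simp
      fix y a :: "int \<Rightarrow> ennreal"
      assume le: "\<And>j. epowr (y j) A \<le> csum (\<lambda>z. ?c z * epowr (a (j + fst z)) A)"
      have "mix ?U \<rho> \<rho> (\<lambda>j _. epowr (y j) A) \<le> mix ?U \<rho> \<rho> (\<lambda>j _. csum (\<lambda>z. ?c z * epowr (a (j + fst z)) A))"
        using \<rho> le by (intro mix_mono) auto
      also have "\<dots> \<le> csum (\<lambda>z. mix ?U \<rho> \<rho> (\<lambda>j _. ?c z * epowr (a (j + fst z)) A))"
        using \<rho> by (intro mix_csum_le sigma_finite_measure_count_space_finite) auto
      also have "\<dots> = csum (\<lambda>z. ?c z * mix ?U \<rho> \<rho> (\<lambda>j _. epowr (a (j + fst z)) A))"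
        using \<rho> by (intro nn_integral_cong mix_cmult) auto
      also have "\<dots> = csum (\<lambda>z. ?c z * mix ?U \<rho> \<rho> (\<lambda>j _. epowr (a j) A))"
        by (intro nn_integral_cong arg_cong2[where f = "(*)"] refl
          mix_reindex[OF bij_plus_right, where g = "\<lambda>j _. epowr (a j) A"])
      also have "\<dots> = csum ?c * mix ?U \<rho> \<rho> (\<lambda>j _. epowr (a j) A)" by (rule csum_multc)
      finally have "epowr (mix ?U \<rho> \<rho> (\<lambda>j _. epowr (y j) A)) (1 / A) \<le> epowr (csum ?c * mix ?U \<rho> \<rho> (\<lambda>j _. epowr (a j) A)) (1 / A)"
        using A by (intro epowr_mono) auto
      then show "lq_qnorm q y \<le> epowr (csum ?c) (1 / A) * lq_qnorm q a" by (simp add: lq epowr_mult)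
    qed
  qed
qed

text \<open>It is enough to bound the matrix from the averaged norm to the pointwise one, the
  direction in which the estimates come naturally. Equivalence of the norms then gives boundedness
  on both spaces, with a loss only in the constant.\<close>

lemma bounded_and_equal:
  assumes le1: "\<And>t. M t \<le> ennreal C1 * N t" and le2: "\<And>t. N t \<le> ennreal C2 * M t"
    and B: "\<And>t Q. N t < top \<Longrightarrow> (\<lambda>R. smul (b Q R) (t R)) summable_on UNIV"
    and B_le: "\<And>t. N t < top \<Longrightarrow> M (matrix_apply smul b t) \<le> ennreal C3 * N t"
  shows "same_qspace M N \<and> matrix_bounded_on smul b M \<and> matrix_bounded_on smul b N"
proof (intro conjI)
  have fin: "M t < top \<longleftrightarrow> N t < top" for t
    using le1[of t] le2[of t] by (metis ennreal_less_top ennreal_mult_less_top le_less_trans)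
  show "same_qspace M N"
    unfolding same_qspace_def
  proof (intro conjI exI ballI)
    show "qspace M = qspace N" by (simp add: qspace_def fin)
    fix t
    show "M t \<le> ennreal (max C1 C2) * N t"
      by (rule order_trans[OF le1]) (intro mult_right_mono ennreal_leI; simp)
    show "N t \<le> ennreal (max C1 C2) * M t"
      by (rule order_trans[OF le2]) (intro mult_right_mono ennreal_leI; simp)
  qed
  show "matrix_bounded_on smul b M"
    unfolding matrix_bounded_on_def qspace_def
  proof (intro exI[of _ "max C3 0 * max C2 0"] ballI conjI allI)
    fix t assume "t \<in> {t. M t < \<infinity>}"
    then have t: "N t < top" using fin by simp
    show "(\<lambda>R. smul (b Q R) (t R)) summable_on UNIV" for Q by (rule B[OF t])
    have "M (matrix_apply smul b t) \<le> ennreal (max C3 0) * N t"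
      by (rule order_trans[OF B_le[OF t]]) (intro mult_right_mono ennreal_leI; simp)
    also have "\<dots> \<le> ennreal (max C3 0) * (ennreal (max C2 0) * M t)"
      by (intro mult_left_mono order_trans[OF le2] mult_right_mono ennreal_leI) auto
    finally show "M (matrix_apply smul b t) \<le> ennreal (max C3 0 * max C2 0) * M t"
      by (simp add: ennreal_mult mult.assoc)
  qed
  show "matrix_bounded_on smul b N"
    unfolding matrix_bounded_on_def qspace_def
  proof (intro exI[of _ "max C2 0 * max C3 0"] ballI conjI allI)
    fix t assume "t \<in> {t. N t < \<infinity>}"
    then have t: "N t < top" by simp
    show "(\<lambda>R. smul (b Q R) (t R)) summable_on UNIV" for Q by (rule B[OF t])
    have "N (matrix_apply smul b t) \<le> ennreal (max C2 0) * M (matrix_apply smul b t)"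
      by (rule order_trans[OF le2]) (intro mult_right_mono ennreal_leI; simp)
    also have "\<dots> \<le> ennreal (max C2 0) * (ennreal (max C3 0) * N t)"
      by (intro mult_left_mono order_trans[OF B_le[OF t]] mult_right_mono ennreal_leI) auto
    finally show "N (matrix_apply smul b t) \<le> ennreal (max C2 0 * max C3 0) * N t"
      by (simp add: ennreal_mult mult.assoc)
  qed
qed

section \<open>Choice of the exponents and assembly of the two cases\<close>

lemma choose_exponent:
  fixes n m D F c :: real
  assumes "0 < n" "0 < m" "n / m + c < D" "n / m + c < F"
  obtains A where "0 < A" "A < m" "n + A * c < A * D" "n + A * c < A * F"
proof -
  have "n / m < min D F - c" using assms by (simp add: min_def)
  then obtain x where x: "n / m < x" "x < min D F - c" by (meson dense)
  have "0 < n / m" using assms by simp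
  then have x0: "0 < x" using x by linarith
  \<comment> \<open>In terms of x = n / A the requirements are n / m < x, x < D - c and x < F - c,
    so any intermediate x will do.\<close>
  define A where "A = n / x"
  have "0 < A" using assms x0 by (simp add: A_def)
  moreover have "A < m" using x x0 assms by (simp add: A_def field_simps)
  moreover have "n = A * x" using x0 by (simp add: A_def)
  moreover have "A * x < A * (D - c)" "A * x < A * (F - c)" using x \<open>0 < A\<close> by auto
  ultimately show ?thesis by (intro that[of A]) (auto simp: algebra_simps)
qed

text \<open>If q < r, any gain above r suffices, as p \<le> r. If q \<ge> r, the supremum defining
  the index exceeds q - r, so some admissible \<epsilon> does as well, and its inequality is
  restricted to dyadic cubes.\<close>

lemma dyadic_reverse_Hoelder_exponent:
  fixes smul :: "'k::real_or_complex \<Rightarrow> 'a::banach \<Rightarrow> 'a" and V :: "real ^ 'n \<Rightarrow> 'a \<Rightarrow>\<^sub>L 'a"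
  assumes smul: "normed_space_over smul" and Ap: "Ap_weight smul r V" and p: "p \<le> r"
    and q: "0 \<le> q" "ennreal q < ennreal r + reverse_Hoelder_index V r"
  obtains U0 C0 where "p < U0" "q < U0" "0 < (C0::real)" "\<And>Q e. rho V U0 (dcube Q) e \<le> ennreal C0 * rho V r (dcube Q) e"
proof (cases "q < r")
  case True
  obtain \<epsilon> C where e: "0 < \<epsilon>" "0 < C" "\<forall>Q e. rho V (r + \<epsilon>) (dcube Q) e \<le> ennreal C * rho V r (dcube Q) e"
    using dyadic_reverse_Hoelder[OF smul Ap] by blast
  show ?thesis by (rule that[of "r + \<epsilon>" C]) (use p True e in auto)
next
  case False
  have r: "0 < r" using Ap by (simp add: Ap_weight_def)
  have "ennreal (q - r) < reverse_Hoelder_index V r"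
  proof (rule ccontr)
    assume "\<not> ?thesis"
    then have "ennreal r + reverse_Hoelder_index V r \<le> ennreal r + ennreal (q - r)" by (intro add_left_mono) simp
    also have "\<dots> = ennreal q" using False r by (simp flip: ennreal_plus)
    finally show False using q by simp
  qed
  then obtain \<epsilon> C where e: "ennreal (q - r) < ennreal \<epsilon>" "0 < \<epsilon>"
    "\<forall>a. \<forall>l>0. \<forall>e. rho V (r + \<epsilon>) (cube a l) e \<le> ennreal C * rho V r (cube a l) e"
    unfolding reverse_Hoelder_index_def less_SUP_iff by blast
  have "q < r + \<epsilon>" using e(1) False by (simp add: ennreal_less_iff)
  moreover have "rho V (r + \<epsilon>) (dcube Q) e \<le> ennreal (max C 1) * rho V r (dcube Q) e" for Q e
  proof -
    have "rho V (r + \<epsilon>) (dcube Q) e \<le> ennreal C * rho V r (dcube Q) e"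
      using e(3) by (simp add: dcube_def)
    also have "\<dots> \<le> ennreal (max C 1) * rho V r (dcube Q) e" by (intro mult_right_mono ennreal_leI) auto
    finally show ?thesis .
  qed
  ultimately show ?thesis using p e(2) by (intro that[of "r + \<epsilon>" "max C 1"]) auto
qed

text \<open>The estimates common to both cases, for one fixed A and with free level weights e. The
  strict inequalities on D, E and F are exactly the positivity of the three decay rates.\<close>

lemma weighted_core:
  fixes smul :: "'k::real_or_complex \<Rightarrow> 'a::banach \<Rightarrow> 'a" and V :: "real ^ 'n \<Rightarrow> 'a \<Rightarrow>\<^sub>L 'a"
    and B :: "'n dyadic \<Rightarrow> 'n dyadic \<Rightarrow> 'k"
  assumes smul: "normed_space_over smul" and p: "p \<le> r" and Ap: "Ap_weight smul r V"
    and dd: "has_doubling_dimension V r \<beta>" and B: "almost_diagonal D E F B" and E: "\<sigma> < E"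
    and RH: "p < U0" "q < U0" "0 < (C0::real)" "\<And>Q e. rho V U0 (dcube Q) e \<le> ennreal C0 * rho V r (dcube Q) e"
    and A: "0 < A" "A < p" "A < q"
    and D: "real CARD('n) + A * ((\<beta> - real CARD('n)) / r) < A * D"
    and F: "real CARD('n) + A * ((\<beta> - real CARD('n)) / r) < A * (F + \<sigma>)"
  obtains C K \<alpha> \<alpha>1 \<alpha>2 :: real where "0 < C" "0 < \<alpha>" "0 < \<alpha>1" "0 < \<alpha>2" "0 \<le> K"
    "\<And>t e. mix lebesgue (p / A) (q / A) (\<lambda>i x. (e i * lvl (\<sigma> * A) i) * wavg V A 0 0 t i x)
      \<le> ennreal C * mix lebesgue (p / A) (q / A) (\<lambda>i x. (e i * lvl (\<sigma> * A) i) * seqf V r A t i x)"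
    "\<And>t e. mix lebesgue (p / A) (q / A) (\<lambda>i x. (e i * lvl (\<sigma> * A) i) * seqf V r A t i x)
      \<le> ennreal C * mix lebesgue (p / A) (q / A) (\<lambda>i x. (e i * lvl (\<sigma> * A) i) * wavg V A 0 0 t i x)"
    "\<And>t e. mix lebesgue (p / A) (q / A) (\<lambda>j x. e j * (lvl (\<sigma> * A) j * absmat B V A t j x))
      \<le> csum (\<lambda>z :: int \<times> nat \<times> (int ^ 'n). coef K \<alpha> \<alpha>1 \<alpha>2 z
        * mix lebesgue (p / A) (q / A) (\<lambda>i x. (e (i - fst z) * lvl (\<sigma> * A) i) * seqf V r A t i x))"
proof -
  have r: "0 < r" and V: "weight smul UNIV V" using Ap by (auto simp: Ap_weight_def p_weight_def)
  have PQ: "1 < p / A" "1 < q / A" using A by auto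
  define T where "T = real CARD('n) + A * (\<beta> - real CARD('n)) / r"
  obtain C1 where C1: "0 < C1" and wavg: "\<forall>l. \<forall>\<nu>\<in>nbrs. \<forall>t (g :: int \<Rightarrow> ennreal).
    mix lebesgue (p / A) (q / A) (\<lambda>i x. g i * wavg V A l \<nu> t i x)
      \<le> ennreal (C1 * 2 powr (real l * T)) * mix lebesgue (p / A) (q / A) (\<lambda>i x. g i * seqf V r A t i x)"
    using wavg_mix[OF V r dd RH(3,4) A RH(1,2)] unfolding T_def by blast
  obtain C2 where C2: "0 < C2" and lower: "\<forall>t (g :: int \<Rightarrow> ennreal). mix lebesgue (p / A) (q / A) (\<lambda>i x. g i * seqf V r A t i x)
      \<le> ennreal C2 * mix lebesgue (p / A) (q / A) (\<lambda>i x. g i * wavg V A 0 0 t i x)"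
    using seqf_mix_le_wavg[OF smul Ap A] by blast
  obtain CB where CB: "\<And>Q R. norm (B Q R) \<le> CB * (1 + dlen R / dlen Q) powr (- E) * (1 + dlen Q / dlen R) powr (- F)
       * (1 + norm (dvertex Q - dvertex R) / max (dlen Q) (dlen R)) powr (- D)"
    using B unfolding almost_diagonal_def by blast
  have CB': "norm (B Q R) \<le> max CB 0 * (1 + dlen R / dlen Q) powr (- E) * (1 + dlen Q / dlen R) powr (- F)
       * (1 + norm (dvertex Q - dvertex R) / max (dlen Q) (dlen R)) powr (- D)" for Q R
    by (rule order_trans[OF CB]) (intro mult_right_mono; simp)
  have "real CARD('n) \<le> \<beta>" using dd by (simp add: has_doubling_dimension_def)
  then have "0 \<le> A * ((\<beta> - real CARD('n)) / r)" using A r by simp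
  \<comment> \<open>The location of matrix entries by distance uses decay in the distance, that is D
    \<ge> 0; this follows from the lower bound for A D because \<beta> \<ge> n.\<close>
  then have "0 \<le> A * D" using D of_nat_0_le_iff[of "CARD('n)", where 'a = real] by linarith
  then have D0: "0 \<le> D" using A by (simp add: zero_le_mult_iff)
  have T: "T < A * D" "T < A * (F + \<sigma>)" using D F by (simp_all add: T_def)
  show ?thesis
  proof (rule that[of "max C1 C2" "A * D - T" "A * (F + \<sigma>) - T" "A * (E - \<sigma>)"
        "(max CB 0 * 2 powr (\<bar>E\<bar> + \<bar>F\<bar> + D)) powr A * C1"])
    fix t :: "'n dyadic \<Rightarrow> 'a" and e :: "int \<Rightarrow> ennreal"
    have "mix lebesgue (p / A) (q / A) (\<lambda>i x. (e i * lvl (\<sigma> * A) i) * wavg V A 0 0 t i x)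
      \<le> ennreal (C1 * 2 powr (real 0 * T)) * mix lebesgue (p / A) (q / A) (\<lambda>i x. (e i * lvl (\<sigma> * A) i) * seqf V r A t i x)"
      by (rule wavg[rule_format]) simp
    also have "\<dots> \<le> ennreal (max C1 C2) * mix lebesgue (p / A) (q / A) (\<lambda>i x. (e i * lvl (\<sigma> * A) i) * seqf V r A t i x)"
      by (intro mult_right_mono ennreal_leI) auto
    finally show "mix lebesgue (p / A) (q / A) (\<lambda>i x. (e i * lvl (\<sigma> * A) i) * wavg V A 0 0 t i x)
      \<le> ennreal (max C1 C2) * mix lebesgue (p / A) (q / A) (\<lambda>i x. (e i * lvl (\<sigma> * A) i) * seqf V r A t i x)" .
    have "mix lebesgue (p / A) (q / A) (\<lambda>i x. (e i * lvl (\<sigma> * A) i) * seqf V r A t i x)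
      \<le> ennreal C2 * mix lebesgue (p / A) (q / A) (\<lambda>i x. (e i * lvl (\<sigma> * A) i) * wavg V A 0 0 t i x)"
      by (rule lower[rule_format])
    also have "\<dots> \<le> ennreal (max C1 C2) * mix lebesgue (p / A) (q / A) (\<lambda>i x. (e i * lvl (\<sigma> * A) i) * wavg V A 0 0 t i x)"
      by (intro mult_right_mono ennreal_leI) auto
    finally show "mix lebesgue (p / A) (q / A) (\<lambda>i x. (e i * lvl (\<sigma> * A) i) * seqf V r A t i x)
      \<le> ennreal (max C1 C2) * mix lebesgue (p / A) (q / A) (\<lambda>i x. (e i * lvl (\<sigma> * A) i) * wavg V A 0 0 t i x)" .
    show "mix lebesgue (p / A) (q / A) (\<lambda>j x. e j * (lvl (\<sigma> * A) j * absmat B V A t j x))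
      \<le> csum (\<lambda>z :: int \<times> nat \<times> (int ^ 'n). coef ((max CB 0 * 2 powr (\<bar>E\<bar> + \<bar>F\<bar> + D)) powr A * C1)
          (A * D - T) (A * (F + \<sigma>) - T) (A * (E - \<sigma>)) z
        * mix lebesgue (p / A) (q / A) (\<lambda>i x. (e (i - fst z) * lvl (\<sigma> * A) i) * seqf V r A t i x))"
      using absmat_mix[OF V D0 _ A(1) PQ CB', of C1 t T r e \<sigma>] C1 wavg by (simp add: mult.assoc)
  qed (use C1 C2 T A E in auto)
qed

lemma epowr_le_cmultD:
  assumes "0 < A" "0 \<le> C" "epowr x A \<le> ennreal C * epowr y A"
  shows "x \<le> ennreal (C powr (1 / A)) * y"
proof -
  have "x \<le> epowr (ennreal C * epowr y A) (1 / A)" using assms by (simp add: epowr_le_swap)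
  then show ?thesis using assms by (simp add: epowr_mult epowr_epowr epowr_ennreal)
qed

lemma triebel_lizorkin_case:
  fixes smul :: "'k::real_or_complex \<Rightarrow> 'a::banach \<Rightarrow> 'a" and V :: "real ^ 'n \<Rightarrow> 'a \<Rightarrow>\<^sub>L 'a"
    and B :: "'n dyadic \<Rightarrow> 'n dyadic \<Rightarrow> 'k"
  assumes smul: "normed_space_over smul" and p: "0 < p" "p \<le> r" and Ap: "Ap_weight smul r V"
    and dd: "has_doubling_dimension V r \<beta>" and B: "almost_diagonal D E F B" and E: "real CARD('n) / 2 + s < E"
    and q: "0 < q" "ennreal q < ennreal r + reverse_Hoelder_index V r"
    and D: "real CARD('n) / Min {1, p, q} + (\<beta> - real CARD('n)) / r < D"
    and F: "real CARD('n) / Min {1, p, q} - real CARD('n) / 2 - s + (\<beta> - real CARD('n)) / r < F"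
  shows "same_qspace (f_V V s p (ennreal q)) (f_rho V r s p (ennreal q)) \<and>
    matrix_bounded_on smul B (f_V V s p (ennreal q)) \<and> matrix_bounded_on smul B (f_rho V r s p (ennreal q))"
proof -
  \<comment> \<open>The normalisation |Q|^(-1/2) adds n/2 to the smoothness. In terms of \<sigma>
    the conditions are E > \<sigma> and F + \<sigma> > J + (\<beta>-n)/r.\<close>
  define \<sigma> where "\<sigma> = s + real CARD('n) / 2"
  have V: "weight smul UNIV V" using Ap by (auto simp: Ap_weight_def p_weight_def)
  obtain U0 C0 where RH: "p < U0" "q < U0" "0 < (C0::real)" "\<And>Q e. rho V U0 (dcube Q) e \<le> ennreal C0 * rho V r (dcube Q) e"
    using dyadic_reverse_Hoelder_exponent[OF smul Ap p(2) less_imp_le[OF q(1)] q(2)] by metis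
  obtain A where A: "0 < A" "A < Min {1, p, q}"
    "real CARD('n) + A * ((\<beta> - real CARD('n)) / r) < A * D" "real CARD('n) + A * ((\<beta> - real CARD('n)) / r) < A * (F + \<sigma>)"
    by (rule choose_exponent[of "real CARD('n)" "Min {1, p, q}" "(\<beta> - real CARD('n)) / r" D "F + \<sigma>"])
      (use p q D F in \<open>auto simp: \<sigma>_def\<close>)
  have A1: "A < 1" "A < p" "A < q" using A(2) by auto
  obtain C K \<alpha> \<alpha>1 \<alpha>2 :: real where C: "0 < C" and K: "0 < \<alpha>" "0 < \<alpha>1" "0 < \<alpha>2" "0 \<le> K"
    and up: "\<And>t e. mix lebesgue (p / A) (q / A) (\<lambda>i x. (e i * lvl (\<sigma> * A) i) * wavg V A 0 0 t i x)
      \<le> ennreal C * mix lebesgue (p / A) (q / A) (\<lambda>i x. (e i * lvl (\<sigma> * A) i) * seqf V r A t i x)"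
    and low: "\<And>t e. mix lebesgue (p / A) (q / A) (\<lambda>i x. (e i * lvl (\<sigma> * A) i) * seqf V r A t i x)
      \<le> ennreal C * mix lebesgue (p / A) (q / A) (\<lambda>i x. (e i * lvl (\<sigma> * A) i) * wavg V A 0 0 t i x)"
    and mat: "\<And>t e. mix lebesgue (p / A) (q / A) (\<lambda>j x. e j * (lvl (\<sigma> * A) j * absmat B V A t j x))
      \<le> csum (\<lambda>z :: int \<times> nat \<times> (int ^ 'n). coef K \<alpha> \<alpha>1 \<alpha>2 z
        * mix lebesgue (p / A) (q / A) (\<lambda>i x. (e (i - fst z) * lvl (\<sigma> * A) i) * seqf V r A t i x))"
    by (rule weighted_core[OF smul p(2) Ap dd B _ RH A(1) A1(2,3) A(3,4)]) (use E in \<open>auto simp: \<sigma>_def\<close>)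
  have fV: "epowr (f_V V s p (ennreal q) t) A = mix lebesgue (p / A) (q / A) (\<lambda>i x. lvl (\<sigma> * A) i * wavg V A 0 0 t i x)" for t
    unfolding f_V_def using p q A by (simp add: epowr_triebel_qnorm epowr_pointwise_part \<sigma>_def)
  have frho: "epowr (f_rho V r s p (ennreal q) t) A = mix lebesgue (p / A) (q / A) (\<lambda>i x. lvl (\<sigma> * A) i * seqf V r A t i x)" for t
    unfolding f_rho_def using p q A by (simp add: epowr_triebel_qnorm epowr_averaged_part \<sigma>_def)
  define S where "S = csum (coef K \<alpha> \<alpha>1 \<alpha>2 :: int \<times> nat \<times> (int ^ 'n) \<Rightarrow> ennreal)"
  have S: "S < top" unfolding S_def by (rule coef_summable[OF K])
  \<comment> \<open>With e constant, the mixed norms on the right are the same for all triples, and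
    only the sum of the coefficients remains.\<close>
  have mat1: "mix lebesgue (p / A) (q / A) (\<lambda>j x. lvl (\<sigma> * A) j * absmat B V A t j x) \<le> S * epowr (f_rho V r s p (ennreal q) t) A" for t
    using mat[of "\<lambda>_. 1" t] by (simp add: frho S_def csum_multc)
  note meas [measurable] = absmat_measurable[OF V]
  have fin: "AE x in lebesgue. absmat B V A t j x < top" if t: "f_rho V r s p (ennreal q) t < top" for t j
  proof -
    have "S * epowr (f_rho V r s p (ennreal q) t) A < top" using S t by (intro ennreal_mult_less_top[THEN iffD2]) simp
    then have "mix lebesgue (p / A) (q / A) (\<lambda>j x. lvl (\<sigma> * A) j * absmat B V A t j x) < top"
      by (rule le_less_trans[OF mat1])
    then have "AE x in lebesgue. lvl (\<sigma> * A) j * absmat B V A t j x < top"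
      using p q A by (intro mix_finite_AE[where P = "p / A" and Q = "q / A"]) auto
    then show ?thesis by eventually_elim (auto simp: ennreal_mult_less_top)
  qed
  show ?thesis
  proof (rule bounded_and_equal)
    fix t :: "'n dyadic \<Rightarrow> 'a"
    show "f_V V s p (ennreal q) t \<le> ennreal (C powr (1 / A)) * f_rho V r s p (ennreal q) t"
      using up[of "\<lambda>_. 1" t] A C by (intro epowr_le_cmultD) (auto simp: fV frho)
    show "f_rho V r s p (ennreal q) t \<le> ennreal (C powr (1 / A)) * f_V V s p (ennreal q) t"
      using low[of "\<lambda>_. 1" t] A C by (intro epowr_le_cmultD) (auto simp: fV frho)
    assume t: "f_rho V r s p (ennreal q) t < top"
    show "(\<lambda>R. smul (B Q R) (t R)) summable_on UNIV" for Q
      using A A1 fin[OF t] by (intro absmat_AE_finite(1)[OF smul V, of A]) auto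
    have "mix lebesgue (p / A) (q / A) (\<lambda>i x. lvl (\<sigma> * A) i * wavg V A 0 0 (matrix_apply smul B t) i x)
        \<le> mix lebesgue (p / A) (q / A) (\<lambda>i x. lvl (\<sigma> * A) i * absmat B V A t i x)"
    proof (rule mix_mono_AE)
      fix i
      have "AE x in lebesgue. wavg V A 0 0 (matrix_apply smul B t) i x \<le> absmat B V A t i x"
        using A A1 fin[OF t] by (intro absmat_AE_finite(2)[OF smul V, of A]) auto
      then show "AE x in lebesgue. lvl (\<sigma> * A) i * wavg V A 0 0 (matrix_apply smul B t) i x \<le> lvl (\<sigma> * A) i * absmat B V A t i x"
        by eventually_elim (simp add: mult_left_mono)
    qed (use p q A in auto)
    also have "\<dots> \<le> S * epowr (f_rho V r s p (ennreal q) t) A" by (rule mat1)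
    finally show "f_V V s p (ennreal q) (matrix_apply smul B t) \<le> ennreal (enn2real S powr (1 / A)) * f_rho V r s p (ennreal q) t"
      using A S by (intro epowr_le_cmultD) (auto simp: fV)
  qed
qed

lemma besov_case:
  fixes smul :: "'k::real_or_complex \<Rightarrow> 'a::banach \<Rightarrow> 'a" and V :: "real ^ 'n \<Rightarrow> 'a \<Rightarrow>\<^sub>L 'a"
    and B :: "'n dyadic \<Rightarrow> 'n dyadic \<Rightarrow> 'k" and q :: ennreal
  assumes smul: "normed_space_over smul" and p: "0 < p" "p \<le> r" and Ap: "Ap_weight smul r V"
    and dd: "has_doubling_dimension V r \<beta>" and B: "almost_diagonal D E F B" and E: "real CARD('n) / 2 + s < E"
    and q: "q \<noteq> 0"
    and D: "real CARD('n) / min 1 p + (\<beta> - real CARD('n)) / r < D"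
    and F: "real CARD('n) / min 1 p - real CARD('n) / 2 - s + (\<beta> - real CARD('n)) / r < F"
  shows "same_qspace (b_V V s p q) (b_rho V r s p q) \<and>
    matrix_bounded_on smul B (b_V V s p q) \<and> matrix_bounded_on smul B (b_rho V r s p q)"
proof -
  define \<sigma> where "\<sigma> = s + real CARD('n) / 2"
  have V: "weight smul UNIV V" using Ap by (auto simp: Ap_weight_def p_weight_def)
  obtain \<epsilon> C0 where RH0: "0 < \<epsilon>" "0 < (C0::real)" "\<forall>Q e. rho V (r + \<epsilon>) (dcube Q) e \<le> ennreal C0 * rho V r (dcube Q) e"
    using dyadic_reverse_Hoelder[OF smul Ap] by blast
  have RH: "p < r + \<epsilon>" "p < r + \<epsilon>" "0 < C0" "\<And>Q e. rho V (r + \<epsilon>) (dcube Q) e \<le> ennreal C0 * rho V r (dcube Q) e"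
    using RH0 p by auto
  obtain A where A: "0 < A" "A < min 1 p"
    "real CARD('n) + A * ((\<beta> - real CARD('n)) / r) < A * D" "real CARD('n) + A * ((\<beta> - real CARD('n)) / r) < A * (F + \<sigma>)"
    by (rule choose_exponent[of "real CARD('n)" "min 1 p" "(\<beta> - real CARD('n)) / r" D "F + \<sigma>"])
      (use p D F in \<open>auto simp: \<sigma>_def\<close>)
  have A1: "A < 1" "A < p" using A(2) by auto
  obtain C K \<alpha> \<alpha>1 \<alpha>2 :: real where C: "0 < C" and K: "0 < \<alpha>" "0 < \<alpha>1" "0 < \<alpha>2" "0 \<le> K"
    and up: "\<And>t e. mix lebesgue (p / A) (p / A) (\<lambda>i x. (e i * lvl (\<sigma> * A) i) * wavg V A 0 0 t i x)
      \<le> ennreal C * mix lebesgue (p / A) (p / A) (\<lambda>i x. (e i * lvl (\<sigma> * A) i) * seqf V r A t i x)"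
    and low: "\<And>t e. mix lebesgue (p / A) (p / A) (\<lambda>i x. (e i * lvl (\<sigma> * A) i) * seqf V r A t i x)
      \<le> ennreal C * mix lebesgue (p / A) (p / A) (\<lambda>i x. (e i * lvl (\<sigma> * A) i) * wavg V A 0 0 t i x)"
    and mat: "\<And>t e. mix lebesgue (p / A) (p / A) (\<lambda>j x. e j * (lvl (\<sigma> * A) j * absmat B V A t j x))
      \<le> csum (\<lambda>z :: int \<times> nat \<times> (int ^ 'n). coef K \<alpha> \<alpha>1 \<alpha>2 z
        * mix lebesgue (p / A) (p / A) (\<lambda>i x. (e (i - fst z) * lvl (\<sigma> * A) i) * seqf V r A t i x))"
    by (rule weighted_core[OF smul p(2) Ap dd B _ RH A(1) A1(2,2) A(3,4)]) (use E in \<open>auto simp: \<sigma>_def\<close>)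
  let ?v = "\<lambda>t j. Lp_qnorm p (pointwise_part V s t j)" and ?a = "\<lambda>t j. Lp_qnorm p (averaged_part V r s t j)"
  have v: "epowr (?v t j) A = mix lebesgue (p / A) (p / A) (\<lambda>i x. (indicator {j} i * lvl (\<sigma> * A) i) * wavg V A 0 0 t i x)" for t j
    using p A by (simp add: epowr_Lp_qnorm[where X = "pointwise_part V s t"] epowr_pointwise_part \<sigma>_def mult.assoc)
  have a: "epowr (?a t j) A = mix lebesgue (p / A) (p / A) (\<lambda>i x. (indicator {j} i * lvl (\<sigma> * A) i) * seqf V r A t i x)" for t j
    using p A by (simp add: epowr_Lp_qnorm[where X = "averaged_part V r s t"] epowr_averaged_part \<sigma>_def mult.assoc)
  have bV: "b_V V s p q t = lq_qnorm q (?v t)" and brho: "b_rho V r s p q t = lq_qnorm q (?a t)" for t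
    by (simp_all add: b_V_def b_rho_def besov_qnorm_def)
  have mat1: "mix lebesgue (p / A) (p / A) (\<lambda>i x. indicator {j} i * (lvl (\<sigma> * A) i * absmat B V A t i x))
      \<le> csum (\<lambda>z :: int \<times> nat \<times> (int ^ 'n). coef K \<alpha> \<alpha>1 \<alpha>2 z * epowr (?a t (j + fst z)) A)" for t j
  proof -
    \<comment> \<open>Selecting the output level j amounts to selecting the input level j +
      d.\<close>
    have "indicator {j} (i - d) = (indicator {j + d} i :: ennreal)" for i d by (auto simp: indicator_def)
    then show ?thesis using mat[of "indicator {j}" t] by (simp add: a)
  qed
  define S where "S = csum (coef K \<alpha> \<alpha>1 \<alpha>2 :: int \<times> nat \<times> (int ^ 'n) \<Rightarrow> ennreal)"
  have S: "S < top" unfolding S_def by (rule coef_summable[OF K])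
  note meas [measurable] = absmat_measurable[OF V]
  have fin: "AE x in lebesgue. absmat B V A t j x < top" if t: "b_rho V r s p q t < top" for t j
  proof -
    \<comment> \<open>For finiteness almost everywhere a crude bound is enough: the norm of every
      single level is at most the full norm.\<close>
    have "csum (\<lambda>z :: int \<times> nat \<times> (int ^ 'n). coef K \<alpha> \<alpha>1 \<alpha>2 z * epowr (?a t (j + fst z)) A)
        \<le> csum (\<lambda>z :: int \<times> nat \<times> (int ^ 'n). coef K \<alpha> \<alpha>1 \<alpha>2 z * epowr (b_rho V r s p q t) A)"
      unfolding brho using A by (intro csum_mono mult_left_mono epowr_mono lq_qnorm_upper q) auto
    also have "\<dots> = S * epowr (b_rho V r s p q t) A" unfolding S_def by (rule csum_multc)
    also have "\<dots> < top" using S t by (intro ennreal_mult_less_top[THEN iffD2]) simp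
    finally have "mix lebesgue (p / A) (p / A) (\<lambda>i x. indicator {j} i * (lvl (\<sigma> * A) i * absmat B V A t i x)) < top"
      by (rule le_less_trans[OF mat1])
    then have "AE x in lebesgue. indicator {j} j * (lvl (\<sigma> * A) j * absmat B V A t j x) < top"
      using p A by (intro mix_finite_AE[where P = "p / A" and Q = "p / A"]) auto
    then show ?thesis by eventually_elim (auto simp: ennreal_mult_less_top)
  qed
  obtain C3 :: real where C3: "\<forall>y a. (\<forall>j. epowr (y j) A \<le> csum (\<lambda>z :: int \<times> nat \<times> (int ^ 'n). coef K \<alpha> \<alpha>1 \<alpha>2 z * epowr (a (j + fst z)) A))
      \<longrightarrow> lq_qnorm q y \<le> ennreal C3 * lq_qnorm q a"
    using lq_qnorm_convolution[OF q A(1) K] by blast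
  show ?thesis
  proof (rule bounded_and_equal)
    fix t :: "'n dyadic \<Rightarrow> 'a"
    show "b_V V s p q t \<le> ennreal (C powr (1 / A)) * b_rho V r s p q t"
      unfolding bV brho using up[where t = t] A C q by (intro lq_qnorm_mono epowr_le_cmultD) (auto simp: v a)
    show "b_rho V r s p q t \<le> ennreal (C powr (1 / A)) * b_V V s p q t"
      unfolding bV brho using low[where t = t] A C q by (intro lq_qnorm_mono epowr_le_cmultD) (auto simp: v a)
    assume t: "b_rho V r s p q t < top"
    show "(\<lambda>R. smul (B Q R) (t R)) summable_on UNIV" for Q
      using A A1 fin[OF t] by (intro absmat_AE_finite(1)[OF smul V, of A]) auto
    have "epowr (?v (matrix_apply smul B t) j) A \<le> csum (\<lambda>z :: int \<times> nat \<times> (int ^ 'n). coef K \<alpha> \<alpha>1 \<alpha>2 z * epowr (?a t (j + fst z)) A)" for j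
    proof -
      have "epowr (?v (matrix_apply smul B t) j) A
          \<le> mix lebesgue (p / A) (p / A) (\<lambda>i x. indicator {j} i * (lvl (\<sigma> * A) i * absmat B V A t i x))"
        unfolding v
      proof (rule mix_mono_AE)
        fix i
        have "AE x in lebesgue. wavg V A 0 0 (matrix_apply smul B t) i x \<le> absmat B V A t i x"
          using A A1 fin[OF t] by (intro absmat_AE_finite(2)[OF smul V, of A]) auto
        then show "AE x in lebesgue. (indicator {j} i * lvl (\<sigma> * A) i) * wavg V A 0 0 (matrix_apply smul B t) i x
            \<le> indicator {j} i * (lvl (\<sigma> * A) i * absmat B V A t i x)"
          by eventually_elim (simp add: mult_left_mono mult.assoc)
      qed (use p A in auto)
      also have "\<dots> \<le> csum (\<lambda>z :: int \<times> nat \<times> (int ^ 'n). coef K \<alpha> \<alpha>1 \<alpha>2 z * epowr (?a t (j + fst z)) A)"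
        by (rule mat1)
      finally show ?thesis .
    qed
    then show "b_V V s p q (matrix_apply smul B t) \<le> ennreal C3 * b_rho V r s p q t"
      unfolding bV brho by (intro C3[rule_format, where y = "?v (matrix_apply smul B t)" and a = "?a t"])
  qed
qed

theorem theorem17p12:
  fixes smul :: "'k::real_or_complex \<Rightarrow> 'a::banach \<Rightarrow> 'a"
    and V :: "real ^ 'n \<Rightarrow> 'a \<Rightarrow>\<^sub>L 'a"
    and B :: "'n dyadic \<Rightarrow> 'n dyadic \<Rightarrow> 'k"
    and p r \<beta> s D E F :: real
    and q :: ennreal
  assumes "normed_space_over smul"
    and "0 < p" and "p \<le> r"
    and "Ap_weight smul r V"
    and "has_doubling_dimension V r \<beta>"
    and "almost_diagonal D E F B"
    and "E > real CARD('n) / 2 + s"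
  shows
    "(let n = real CARD('n); J = n / min 1 p in
        0 < q \<and> D > J + (\<beta> - n) / r \<and> F > J - n / 2 - s + (\<beta> - n) / r \<longrightarrow>
          same_qspace (b_V V s p q) (b_rho V r s p q) \<and>
          matrix_bounded_on smul B (b_V V s p q) \<and>
          matrix_bounded_on smul B (b_rho V r s p q)) \<and>
     (let n = real CARD('n); J = n / Min {1, p, enn2real q} in
        0 < q \<and> q < ennreal r + reverse_Hoelder_index V r \<and>
        D > J + (\<beta> - n) / r \<and> F > J - n / 2 - s + (\<beta> - n) / r \<longrightarrow>
          same_qspace (f_V V s p q) (f_rho V r s p q) \<and>
          matrix_bounded_on smul B (f_V V s p q) \<and>
          matrix_bounded_on smul B (f_rho V r s p q))"
proof -
  let ?n = "real CARD('n)"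
  have E: "?n / 2 + s < E" using assms(7) by simp
  have besov: "same_qspace (b_V V s p q) (b_rho V r s p q) \<and>
      matrix_bounded_on smul B (b_V V s p q) \<and> matrix_bounded_on smul B (b_rho V r s p q)"
    if "0 < q" "D > ?n / min 1 p + (\<beta> - ?n) / r" "F > ?n / min 1 p - ?n / 2 - s + (\<beta> - ?n) / r"
    using that by (intro besov_case[OF assms(1-6) E]) auto
  have triebel: "same_qspace (f_V V s p q) (f_rho V r s p q) \<and>
      matrix_bounded_on smul B (f_V V s p q) \<and> matrix_bounded_on smul B (f_rho V r s p q)"
    if q: "0 < q" "q < ennreal r + reverse_Hoelder_index V r"
      "D > ?n / Min {1, p, enn2real q} + (\<beta> - ?n) / r" "F > ?n / Min {1, p, enn2real q} - ?n / 2 - s + (\<beta> - ?n) / r"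
  proof -
    \<comment> \<open>The index may be infinite, but the inequality is strict and so q is finite;
      hence \<open>enn2real\<close>, which sends \<open>top\<close> to 0, does not distort
      J.\<close>
    have fin: "q < top" by (rule less_le_trans[OF q(2) top_greatest])
    then have eq: "ennreal (enn2real q) = q" by (simp add: ennreal_enn2real)
    have "0 < enn2real q" using q(1) fin by (simp add: enn2real_positive_iff)
    then show ?thesis
      using triebel_lizorkin_case[OF assms(1-6) E, of "enn2real q"] q unfolding eq by blast
  qed
  show ?thesis unfolding Let_def using besov triebel by blast
qed

end
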